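(* Assume the family $\{f_t\}_t$ is Newton-admissible. Then, in a sufficiently small neighbourhood of the origin of $\mathbb{C}\times\mathbb{C}^n$, the canonical toric stratification $\mathcal{S}$ of $V(f)=f^{-1}(0)$ is a Whitney $(b)$-regular stratification. In particular, the family of hypersurfaces $\{V(f_t)\}_t$ is Whitney equisingular, i.e. $V(f)$ admits near the origin a Whitney $(b)$-regular stratification having the $t$-axis $\mathbb{C}\times\{\mathbf{0}\}$ as a stratum.
   Context: Let $(t,\mathbf{z})=(t,z_1,\ldots,z_n)$ be coordinates on $\mathbb{C}\times\mathbb{C}^n$. For $k\in K_0:=\{1,\ldots,k_0\}$ let $f^k\colon\mathbb{C}\times\mathbb{C}^n\to\mathbb{C}$ be a non-constant polynomial with $f^k(t,\mathbf{0})=0$ for all $t$; put $f:=f^1\cdots f^{k_0}$, $f_t(\mathbf{z}):=f(t,\mathbf{z})$, $f^k_t(\mathbf{z}):=f^k(t,\mathbf{z})$. All statements concern germs at the origin. Newton data: for a polynomial $g(\mathbf{z})=\sum_\alpha c_\alpha\mathbf{z}^\alpha$ with $g(\mathbf{0})=0$, $\Gamma_+(g)$ is the convex hull in $\mathbb{R}^n_+$ of $\bigcup_{c_\alpha\neq0}(\alpha+\mathbb{R}^n_+)$, and the Newton boundary $\Gamma(g)$ is the union of its compact faces. For a weight vector $\mathbf{w}=(w_1,\ldots,w_n)\in\mathbb{N}^n\setminus\{\mathbf{0}\}$ (nonnegative integers), $d(\mathbf{w};g):=\min\{\sum_i w_ix_i : x\in\Gamma_+(g)\}$, $\Delta(\mathbf{w};g)$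 is the face of $\Gamma_+(g)$ where this minimum is attained, $g_{\mathbf{w}}:=\sum_{\alpha\in\Delta(\mathbf{w};g)}c_\alpha\mathbf{z}^\alpha$ is the face function, and $I(\mathbf{w}):=\{i: w_i=0\}$. $\mathbf w$ is positive if all $w_i>0$. For $I\subseteq\{1,\ldots,n\}$, $\mathbb{C}^I:=\{\mathbf{z}: z_i=0 \text{ for } i\notin I\}$ and $\mathbb{C}^{*I}:=\{\mathbf{z}: z_i=0\iff i\notin I\}$; $\mathbb{C}^{*n}=\mathbb{C}^{*\{1,\ldots,n\}}$. $\mathcal{V}_g$ is the set of $I$ with $g|_{\mathbb{C}^I}\equiv0$. For $i_1,\ldots,i_m$ and $u_{i_j}\in\mathbb{C}^*$, $\mathbb{C}^{*n}(u_{i_1},\ldots,u_{i_m}):=\{\mathbf{z}\in\mathbb{C}^{*n}: z_{i_j}=u_{i_j},\ 1\le j\le m\}$. Non-degenerate complete intersection: polynomials $g^1,\ldots,g^p$ vanishing at $\mathbf 0$ define a non-degenerate complete intersection germ $V(g^1,\ldots,g^p)$ if for every positive weight vector $\mathbf{w}$, the $p$-form $dg^1_{\mathbf{w}}\wedge\cdots\wedge dg^p_{\mathbf{w}}$ is nowhere zero on $V^*(g^1_{\mathbf{w}},\ldots,g^p_{\mathbf{w}}):=\{\mathbf{z}\in\mathbb{C}^{*n}: g^1_{\mathbf{w}}(\mathbf{z})=\cdots=g^p_{\mathbf{w}}(\mathbf{z})=0\}$. Local tameness: $R>0$ is a radius of local tameness of $\{g^1,\ldots,g^p\}$ if for every nonempty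 $I=\{i_1,\ldots,i_m\}\in\mathcal{V}_{g^1}\cap\cdots\cap\mathcal{V}_{g^p}$, every $\mathbf{w}\in\mathbb{N}^n\setminus\{\mathbf 0\}$ with $I(\mathbf{w})=I$ and every $u_{i_1},\ldots,u_{i_m}\in\mathbb{C}^*$ with $\sum_j|u_{i_j}|^2<R$, the set $V^*(g^1_{\mathbf{w}},\ldots,g^p_{\mathbf{w}})\cap\mathbb{C}^{*n}(u_{i_1},\ldots,u_{i_m})$ is a reduced non-singular complete intersection in $\mathbb{C}^{*n}(u_{i_1},\ldots,u_{i_m})$, i.e. the differentials of $g^1_{\mathbf{w}},\ldots,g^p_{\mathbf{w}}$ with respect to the variables $(z_i)_{i\notin I}$ are linearly independent at each of its points; the germ is locally tame if such $R$ exists. Newton-admissible: $\{f_t\}_t$ is Newton-admissible if there is $R>0$ such that for all sufficiently small $t$: (i) for each $k\in K_0$, $\Gamma(f^k_t)$ is independent of $t$; (ii) for every nonempty $\{k_1,\ldots,k_p\}\subseteq K_0$, $V(f^{k_1}_t,\ldots,f^{k_p}_t)$ is a non-degenerate, locally tame complete intersection germ having a radius of local tameness greater than $R$ ($R$ independent of $t$ and of the subset). Canonical toric stratification: $\mathcal{S}$ is the collection of nonempty sets $S^I(K):=\{(t,\mathbf{z})\in\mathbb{C}\times\mathbb{C}^{*I}: f^k(t,\mathbf{z})=0\iff k\in K\}$ for $I\subseteq\{1,\ldots,n\}$, $K\subseteq K_0$ (near the origin these are non-singular, and $S^{\emptyset}(K_0)=\mathbb{C}\times\{\mathbf 0\}$).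 *)

theory Defs
  imports "HOL-Analysis.Analysis"
begin

section \<open>Polynomials represented by finitely supported coefficient functions\<close>

text \<open>A polynomial g(z) in n variables (n = CARD('n)) is a coefficient function
  c :: nat^'n => complex with finite support; a polynomial f(t,z) in C x C^n is
  P :: nat x nat^'n => complex with finite support (P (j,alpha) = coefficient of t^j z^alpha).\<close>

definition monom :: "nat^'n \<Rightarrow> complex^'n \<Rightarrow> complex" where
  "monom \<alpha> z = (\<Prod>i\<in>UNIV. (z$i) ^ (\<alpha>$i))"

definition peval :: "(nat^'n \<Rightarrow> complex) \<Rightarrow> complex^'n \<Rightarrow> complex" where
  "peval c z = (\<Sum>\<alpha>\<in>{\<alpha>. c \<alpha> \<noteq> 0}. c \<alpha> * monom \<alpha> z)"

definition feval :: "(nat \<times> (nat^'n) \<Rightarrow> complex) \<Rightarrow> complex \<Rightarrow> complex^'n \<Rightarrow> complex" where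
  "feval P t z = (\<Sum>m\<in>{m. P m \<noteq> 0}. P m * t ^ (fst m) * monom (snd m) z)"

text \<open>coefficients of f_t as a polynomial in z\<close>
definition zcoeff :: "(nat \<times> (nat^'n) \<Rightarrow> complex) \<Rightarrow> complex \<Rightarrow> nat^'n \<Rightarrow> complex" where
  "zcoeff P t \<alpha> = (\<Sum>j\<in>{j. P (j,\<alpha>) \<noteq> 0}. P (j,\<alpha>) * t ^ j)"

text \<open>formal partial derivative with respect to z_i, evaluated at z\<close>
definition pderiv_at :: "(nat^'n \<Rightarrow> complex) \<Rightarrow> 'n \<Rightarrow> complex^'n \<Rightarrow> complex" where
  "pderiv_at c i z = (\<Sum>\<alpha>\<in>{\<alpha>. c \<alpha> \<noteq> 0}.
      c \<alpha> * of_nat (\<alpha>$i) * (\<Prod>j\<in>UNIV. (z$j) ^ (if j = i then \<alpha>$j - 1 else \<alpha>$j)))"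

section \<open>Newton data\<close>

definition Gamma_plus :: "(nat^'n \<Rightarrow> complex) \<Rightarrow> (real^'n) set" where
  "Gamma_plus c = convex hull (\<Union>\<alpha>\<in>{\<alpha>. c \<alpha> \<noteq> 0}. {x. \<forall>i. real (\<alpha>$i) \<le> x$i})"

definition newton_boundary :: "(nat^'n \<Rightarrow> complex) \<Rightarrow> (real^'n) set" where
  "newton_boundary c = \<Union>{F. F face_of Gamma_plus c \<and> compact F}"

definition wdot :: "nat^'n \<Rightarrow> real^'n \<Rightarrow> real" where
  "wdot w x = (\<Sum>i\<in>UNIV. real (w$i) * x$i)"

definition d_weight :: "nat^'n \<Rightarrow> (nat^'n \<Rightarrow> complex) \<Rightarrow> real" where
  "d_weight w c = Inf (wdot w ` Gamma_plus c)"

definition Delta_face :: "nat^'n \<Rightarrow> (nat^'n \<Rightarrow> complex) \<Rightarrow> (real^'n) set" where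
  "Delta_face w c = {x \<in> Gamma_plus c. wdot w x = d_weight w c}"

definition face_fun :: "nat^'n \<Rightarrow> (nat^'n \<Rightarrow> complex) \<Rightarrow> nat^'n \<Rightarrow> complex" where
  "face_fun w c \<alpha> = (if (\<chi> i. real (\<alpha>$i)) \<in> Delta_face w c then c \<alpha> else 0)"

definition positive_weight :: "nat^'n \<Rightarrow> bool" where
  "positive_weight w \<longleftrightarrow> (\<forall>i. w$i > 0)"

definition I_w :: "nat^'n \<Rightarrow> 'n set" where
  "I_w w = {i. w$i = 0}"

text \<open>the set V_g of coordinate subspaces C^I on which g vanishes identically\<close>
definition V_set :: "(nat^'n \<Rightarrow> complex) \<Rightarrow> 'n set set" where
  "V_set c = {I. \<forall>z::complex^'n. (\<forall>i. i \<notin> I \<longrightarrow> z$i = 0) \<longrightarrow> peval c z = 0}"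

text \<open>V^*(g^k, k in K) inside the torus C^{*n}\<close>
definition Vstar :: "('k \<Rightarrow> nat^'n \<Rightarrow> complex) \<Rightarrow> 'k set \<Rightarrow> (complex^'n) set" where
  "Vstar gs K = {z. (\<forall>i. z$i \<noteq> 0) \<and> (\<forall>k\<in>K. peval (gs k) z = 0)}"

text \<open>linear independence over C of the differentials of g^k (k in K) with respect to the
  variables z_i, i in J, at the point z\<close>
definition diffs_indep :: "('k \<Rightarrow> nat^'n \<Rightarrow> complex) \<Rightarrow> 'k set \<Rightarrow> 'n set \<Rightarrow> complex^'n \<Rightarrow> bool" where
  "diffs_indep gs K J z \<longleftrightarrow>
     (\<forall>a::'k \<Rightarrow> complex. (\<forall>i\<in>J. (\<Sum>k\<in>K. a k * pderiv_at (gs k) i z) = 0) \<longrightarrow> (\<forall>k\<in>K. a k = 0))"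

definition nondegenerate_ci :: "('k \<Rightarrow> nat^'n \<Rightarrow> complex) \<Rightarrow> 'k set \<Rightarrow> bool" where
  "nondegenerate_ci gs K \<longleftrightarrow>
     (\<forall>w. positive_weight w \<longrightarrow>
        (\<forall>z\<in>Vstar (\<lambda>k. face_fun w (gs k)) K. diffs_indep (\<lambda>k. face_fun w (gs k)) K UNIV z))"

definition tameness_radius :: "('k \<Rightarrow> nat^'n \<Rightarrow> complex) \<Rightarrow> 'k set \<Rightarrow> real \<Rightarrow> bool" where
  "tameness_radius gs K R \<longleftrightarrow> R > 0 \<and>
     (\<forall>I. I \<noteq> {} \<and> (\<forall>k\<in>K. I \<in> V_set (gs k)) \<longrightarrow>
       (\<forall>w. w \<noteq> 0 \<and> I_w w = I \<longrightarrow>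
         (\<forall>u::complex^'n. (\<forall>i\<in>I. u$i \<noteq> 0) \<and> (\<Sum>i\<in>I. (cmod (u$i))\<^sup>2) < R \<longrightarrow>
           (\<forall>z\<in>Vstar (\<lambda>k. face_fun w (gs k)) K. (\<forall>i\<in>I. z$i = u$i) \<longrightarrow>
               diffs_indep (\<lambda>k. face_fun w (gs k)) K (- I) z))))"

definition finite_support :: "('a \<Rightarrow> complex) \<Rightarrow> bool" where
  "finite_support P \<longleftrightarrow> finite {m. P m \<noteq> 0}"

definition newton_admissible :: "nat \<Rightarrow> (nat \<Rightarrow> nat \<times> (nat^'n) \<Rightarrow> complex) \<Rightarrow> bool" where
  "newton_admissible k0 F \<longleftrightarrow>
     (\<exists>R>0. \<exists>\<epsilon>>0. \<forall>t. cmod t < \<epsilon> \<longrightarrow>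
        (\<forall>k\<in>{1..k0}. newton_boundary (zcoeff (F k) t) = newton_boundary (zcoeff (F k) 0)) \<and>
        (\<forall>K. K \<subseteq> {1..k0} \<and> K \<noteq> {} \<longrightarrow>
            nondegenerate_ci (\<lambda>k. zcoeff (F k) t) K \<and>
            (\<exists>R'>R. tameness_radius (\<lambda>k. zcoeff (F k) t) K R')))"

section \<open>Whitney stratifications in C x C^n\<close>

type_synonym ('n) amb = "complex \<times> (complex^('n::finite))"

text \<open>multiplication by i (the complex structure)\<close>
definition cJ :: "'n::finite amb \<Rightarrow> 'n amb" where
  "cJ p = (\<i> * fst p, \<chi> j. \<i> * (snd p)$j)"

text \<open>the complex line spanned by v\<close>
definition cline :: "'n::finite amb \<Rightarrow> ('n::finite amb) set" where
  "cline v = span {v, cJ v}"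

text \<open>tangent space: velocities of curves lying in X\<close>
definition tangent_space :: "'a::euclidean_space set \<Rightarrow> 'a \<Rightarrow> 'a set" where
  "tangent_space X x = {v. \<exists>\<gamma>::real \<Rightarrow> 'a. \<gamma> 0 = x \<and> (\<exists>e>0. \<forall>s. \<bar>s\<bar> < e \<longrightarrow> \<gamma> s \<in> X)
                                \<and> (\<gamma> has_vector_derivative v) (at 0)}"

text \<open>C^1 embedded submanifold: locally a C^1 graph over a linear subspace\<close>
definition C1_submanifold :: "'a::euclidean_space set \<Rightarrow> bool" where
  "C1_submanifold X \<longleftrightarrow> (\<forall>x\<in>X. \<exists>U L g g'. open U \<and> x \<in> U \<and> subspace L \<and>
       (\<forall>p. (g has_derivative blinfun_apply (g' p)) (at p)) \<and> continuous_on UNIV g' \<and>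
       (\<forall>p. \<forall>l\<in>L. g p \<bullet> l = 0) \<and>
       X \<inter> U = {p + g p | p. p \<in> L} \<inter> U)"

text \<open>non-singular complex submanifold: C^1 submanifold with complex tangent spaces\<close>
definition complex_submanifold :: "('n::finite amb) set \<Rightarrow> bool" where
  "complex_submanifold X \<longleftrightarrow> C1_submanifold X \<and> (\<forall>x\<in>X. cJ ` tangent_space X x \<subseteq> tangent_space X x)"

text \<open>convergence of linear subspaces (Hausdorff convergence of the unit balls)\<close>
definition subspace_lim :: "(nat \<Rightarrow> 'a::euclidean_space set) \<Rightarrow> 'a set \<Rightarrow> bool" where
  "subspace_lim Ls L \<longleftrightarrow> (\<forall>e>0. eventually (\<lambda>i.
       (\<forall>v\<in>Ls i \<inter> cball 0 1. infdist v (L \<inter> cball 0 1) < e) \<and>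
       (\<forall>v\<in>L \<inter> cball 0 1. infdist v (Ls i \<inter> cball 0 1) < e)) sequentially)"

definition whitney_b :: "('n::finite amb) set \<Rightarrow> ('n::finite amb) set \<Rightarrow> 'n amb \<Rightarrow> bool" where
  "whitney_b X Y y \<longleftrightarrow>
     (\<forall>xs ys l T. (\<forall>i. xs i \<in> X \<and> ys i \<in> Y \<and> xs i \<noteq> ys i) \<and> xs \<longlonglongrightarrow> y \<and> ys \<longlonglongrightarrow> y \<and>
        subspace l \<and> subspace T \<and> subspace_lim (\<lambda>i. cline (xs i - ys i)) l \<and>
        subspace_lim (\<lambda>i. tangent_space X (xs i)) T \<longrightarrow> l \<subseteq> T)"

definition whitney_b_stratification :: "('n::finite amb) set \<Rightarrow> ('n::finite amb) set set \<Rightarrow> bool" where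
  "whitney_b_stratification A S \<longleftrightarrow>
     finite S \<and> \<Union>S = A \<and> disjoint S \<and>
     (\<forall>X\<in>S. X \<noteq> {} \<and> complex_submanifold X) \<and>
     (\<forall>X\<in>S. \<forall>Y\<in>S. X \<noteq> Y \<longrightarrow> (\<forall>y\<in>Y. whitney_b X Y y))"

section \<open>Canonical toric stratification\<close>

definition toric_stratum :: "nat \<Rightarrow> (nat \<Rightarrow> nat \<times> (nat^'n) \<Rightarrow> complex) \<Rightarrow> 'n set \<Rightarrow> nat set \<Rightarrow> ('n::finite amb) set" where
  "toric_stratum k0 F I K = {(t,z). (\<forall>i. z$i \<noteq> 0 \<longleftrightarrow> i \<in> I) \<and>
                                   (\<forall>k\<in>{1..k0}. feval (F k) t z = 0 \<longleftrightarrow> k \<in> K)}"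

text \<open>strata of the canonical toric stratification contained in V(f) (K nonempty)\<close>
definition toric_strat_Vf :: "nat \<Rightarrow> (nat \<Rightarrow> nat \<times> (nat^'n) \<Rightarrow> complex) \<Rightarrow> ('n::finite amb) set set" where
  "toric_strat_Vf k0 F = {toric_stratum k0 F I K | I K. K \<subseteq> {1..k0} \<and> K \<noteq> {} \<and> toric_stratum k0 F I K \<noteq> {}}"

definition V_f :: "nat \<Rightarrow> (nat \<Rightarrow> nat \<times> (nat^'n) \<Rightarrow> complex) \<Rightarrow> ('n::finite amb) set" where
  "V_f k0 F = {(t,z). (\<Prod>k\<in>{1..k0}. feval (F k) t z) = 0}"

end

theory Submission
  imports Defs "HOL-Analysis.Kronecker_Approximation_Theorem"
begin

text \<open>The proof works with sequences instead of analytic arcs, so no curve selection lemma is needed.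
  Along a sequence of points with coordinates tending to zero, the logarithms of the moduli of the
  coordinates determine, after passing to a subsequence, an integral weight vector and a point of
  the torus such that every polynomial, divided by a dominating monomial, converges to its face
  function: project the logarithms to the span of the exponent differences on which they stay
  bounded, and approximate the remaining component by an integral vector.

  Non-degeneracy then gives, near the origin, independence of the differentials of those functions
  that do not vanish identically on the coordinate space of a stratum, so the strata are manifolds.
  For condition (b) one shows that unit conormal vectors pair with the unit secants to zero in the
  limit. Local tameness, or non-degeneracy on the parameter axis, bounds the multipliers of the
  functions vanishing on the smaller coordinate space by the distance of the two points. The rest is
  Euler's identity for face functions.\<close>

section \<open>Integral weights from sequences\<close>

text \<open>A monomial that dominates along a sequence may have a coefficient that vanishes at the
  limit parameter. Constancy of the Newton boundaries excludes the damage, in the form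
  \<open>min_weight\<close>: for every weight, zero entries allowed, the minimum over all exponents
  of the family is attained by one alive at each small t. So rescaled functions converge to genuine
  face functions of f_t at the limit parameter. The weight found vanishes exactly on the set J of
  nonzero coordinates of the limit point, and the torus point agrees with the limit point on J: the
  setting of tameness, or of non-degeneracy if J is empty. Coordinates that are zero on the stratum
  receive a weight so large that monomials containing them stay off the minimal face of every
  function that is not identically zero on the coordinate space. In condition (b), the differentials
  of functions vanishing on the smaller coordinate space can degenerate at the limit, which leaves
  their multipliers without an evident bound. Their logarithmic derivatives, divided by a dominating
  monomial, do have independent limits.\<close>

lemma finite_family_convergent_subseq:
  assumes "finite D" and "\<And>d. d \<in> D \<Longrightarrow> seq_compact (C d)" and "\<And>d m. d \<in> D \<Longrightarrow> g d m \<in> C d"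
  shows "\<exists>r::nat\<Rightarrow>nat. strict_mono r \<and> (\<forall>d\<in>D. \<exists>l\<in>C d. (\<lambda>m. g d (r m)) \<longlonglongrightarrow> l)"
  using assms
proof (induction D)
  case empty
  show ?case by (rule exI[of _ id]) (auto simp: strict_mono_def)
next
  case (insert d D)
  then obtain r where r: "strict_mono r" "\<forall>d\<in>D. \<exists>l\<in>C d. (\<lambda>m. g d (r m)) \<longlonglongrightarrow> l"
    by auto
  have "\<forall>m. g d (r m) \<in> C d" using insert.prems by auto
  then obtain l s where s: "l \<in> C d" "strict_mono s" "((\<lambda>m. g d (r m)) \<circ> s) \<longlonglongrightarrow> l"
    using insert.prems(1)[of d] unfolding seq_compact_def by (metis insertI1)
  show ?case
  proof (intro exI[of _ "r \<circ> s"] conjI ballI)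
    show "strict_mono (r \<circ> s)" using r(1) s(2) by (rule strict_mono_o)
  next
    fix e assume "e \<in> insert d D"
    show "\<exists>l\<in>C e. (\<lambda>m. g e ((r \<circ> s) m)) \<longlonglongrightarrow> l"
    proof (cases "e = d")
      case True then show ?thesis using s by (auto simp: o_def)
    next
      case False
      with \<open>e \<in> insert d D\<close> r(2) obtain l where "l \<in> C e" "(\<lambda>m. g e (r m)) \<longlonglongrightarrow> l" by auto
      then show ?thesis using LIMSEQ_subseq_LIMSEQ[OF _ s(2)] by (auto simp: o_def)
    qed
  qed
qed

text \<open>Simultaneous Diophantine approximation of a real solution of finitely many integral linear
  equations and strict inequalities solves the equations exactly, since the values it takes on the
  equations are integers of absolute value less than one.\<close>

lemma integral_weight:
  fixes l :: "real^'n" and D0 Dp :: "(real^'n) set"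
  assumes fin: "finite D0" "finite Dp"
    and int: "\<And>\<delta> i. \<delta> \<in> D0 \<union> Dp \<Longrightarrow> \<delta>$i \<in> \<int>"
    and eq: "\<And>\<delta>. \<delta> \<in> D0 \<Longrightarrow> \<delta> \<bullet> l = 0" and pos: "\<And>\<delta>. \<delta> \<in> Dp \<Longrightarrow> \<delta> \<bullet> l > 0"
  shows "\<exists>w::int^'n. (\<forall>\<delta>\<in>D0. \<delta> \<bullet> (\<chi> i. of_int (w$i)) = 0) \<and> (\<forall>\<delta>\<in>Dp. \<delta> \<bullet> (\<chi> i. of_int (w$i)) > 0)"
proof -
  define S where "S = 1 + (\<Sum>\<delta>\<in>D0 \<union> Dp. \<Sum>i\<in>UNIV. \<bar>\<delta>$i\<bar>)"
  have S: "(\<Sum>i\<in>UNIV. \<bar>\<delta>$i\<bar>) < S" if "\<delta> \<in> D0 \<union> Dp" for \<delta>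
  proof -
    have "(\<Sum>i\<in>UNIV. \<bar>\<delta>$i\<bar>) \<le> (\<Sum>\<delta>\<in>D0 \<union> Dp. \<Sum>i\<in>UNIV. \<bar>\<delta>$i\<bar>)"
      using that fin by (intro member_le_sum) (auto intro: sum_nonneg)
    then show ?thesis unfolding S_def by linarith
  qed
  have S1: "S \<ge> 1" unfolding S_def by (simp add: sum_nonneg)
  \<comment> \<open>The cap at 1 is for the equations, where the error must be smaller than any
    nonzero integer; the other entries are the margins available in the strict inequalities.\<close>
  define e where "e = Min (insert 1 ((\<lambda>\<delta>. \<delta> \<bullet> l) ` Dp))"
  have e: "e > 0" "\<And>\<delta>. \<delta> \<in> Dp \<Longrightarrow> e \<le> \<delta> \<bullet> l" "e \<le> 1"
    unfolding e_def using fin pos by auto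
  \<comment> \<open>Errors of size 1/N in each coordinate cost at most S/N on every
    \<open>\<delta>\<close>, so this choice keeps them below \<open>e\<close>.\<close>
  obtain N :: nat where N: "N > S / e" using reals_Archimedean2 by blast
  have N0: "N > 0" proof -
    have "S / e > 0" using S1 e by simp
    then have "real N > 0" using N by linarith
    then show ?thesis by simp
  qed
  have NS: "S / N < e" using N N0 e by (simp add: field_simps)
  obtain f :: "'n \<Rightarrow> nat" where f: "bij_betw f UNIV {0..<CARD('n)}"
    using ex_bij_betw_finite_nat[OF finite_class.finite_UNIV] by blast
  define \<theta> where "\<theta> j = l $ (inv_into UNIV f j)" for j
  have \<theta>: "\<theta> (f i) = l $ i" for i
    unfolding \<theta>_def using f by (metis bij_betw_inv_into_left iso_tuple_UNIV_I)
  obtain q p where q: "0 < q" and qp: "\<And>i. i < CARD('n) \<Longrightarrow> \<bar>of_int q * \<theta> i - of_int(p i)\<bar> < 1/N"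
    using Dirichlet_approx_simult[OF N0, of "CARD('n)" \<theta>] by metis
  define w :: "int^'n" where "w = (\<chi> i. p (f i))"
  have w: "\<bar>of_int q * l$i - of_int (w$i)\<bar> < 1/N" for i
  proof -
    have "f i < CARD('n)" using f by (auto simp: bij_betw_def)
    from qp[OF this] show ?thesis by (simp add: w_def \<theta>)
  qed
  have app: "\<bar>of_int q * (\<delta> \<bullet> l) - \<delta> \<bullet> (\<chi> i. of_int (w$i))\<bar> < e" if "\<delta> \<in> D0 \<union> Dp" for \<delta>
  proof -
    have "of_int q * (\<delta> \<bullet> l) - \<delta> \<bullet> (\<chi> i. of_int (w$i)) = (\<Sum>i\<in>UNIV. \<delta>$i * (of_int q * l$i - of_int (w$i)))"
      by (simp add: inner_vec_def sum_distrib_left sum_subtractf[symmetric] algebra_simps)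
    also have "\<bar>\<dots>\<bar> \<le> (\<Sum>i\<in>UNIV. \<bar>\<delta>$i\<bar> * (1/N))"
      by (rule order_trans[OF sum_abs]) (auto simp only: abs_mult intro!: sum_mono mult_left_mono less_imp_le[OF w])
    also have "\<dots> = (\<Sum>i\<in>UNIV. \<bar>\<delta>$i\<bar>) / N" by (simp add: sum_divide_distrib)
    also have "\<dots> \<le> S / N" using S[OF that] N0 by (intro divide_right_mono) auto
    finally show ?thesis using NS by linarith
  qed
  have "\<delta> \<bullet> (\<chi> i. of_int (w$i)) = 0" if "\<delta> \<in> D0" for \<delta>
  proof -
    have "\<delta> \<bullet> (\<chi> i. of_int (w$i)) \<in> \<int>"
      using int that by (auto simp: inner_vec_def intro!: Ints_sum Ints_mult)
    moreover have "\<bar>\<delta> \<bullet> (\<chi> i. of_int (w$i))\<bar> < 1"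
      using app[of \<delta>] that eq e by auto
    ultimately show ?thesis using Ints_nonzero_abs_less1 by blast
  qed
  moreover have "\<delta> \<bullet> (\<chi> i. of_int (w$i)) > 0" if "\<delta> \<in> Dp" for \<delta>
  proof -
    \<comment> \<open>The denominator \<open>q\<close> is at least 1, so the scaled margin is still
      at least \<open>e\<close> and the error cannot use it up.\<close>
    have "of_int q * (\<delta> \<bullet> l) \<ge> 1 * (\<delta> \<bullet> l)"
      using q pos[OF that] by (intro mult_right_mono) auto
    then show ?thesis using app[of \<delta>] that e(2)[OF that] by auto
  qed
  ultimately show ?thesis by blast
qed

text \<open>The basis formula is exported together with the projection because it reduces
  convergence of projected vectors to that of finitely many inner products.\<close>

lemma orthogonal_projection_onto_subspace:
  fixes S :: "'a::euclidean_space set"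
  assumes "subspace S"
  obtains P B where "bounded_linear P" "\<And>v. P v \<in> S" "\<And>v s. s \<in> S \<Longrightarrow> (v - P v) \<bullet> s = 0"
    "\<And>v. v \<in> S \<Longrightarrow> P v = v" "B \<subseteq> S" "\<And>v. P v = (\<Sum>b\<in>B. (v \<bullet> b) *\<^sub>R b)"
proof -
  obtain B where B: "B \<subseteq> S" "pairwise orthogonal B" "\<And>x. x \<in> B \<Longrightarrow> norm x = 1"
    "independent B" "span B = S"
    using orthonormal_basis_subspace[OF assms] by metis
  have fB: "finite B" using B independent_imp_finite by blast
  define P where "P v = (\<Sum>b\<in>B. (v \<bullet> b) *\<^sub>R b)" for v
  have bl: "bounded_linear P" unfolding P_def
    by (intro bounded_linear_sum bounded_linear_scaleR_const bounded_linear_inner_left)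
  have mem: "P v \<in> S" for v unfolding P_def
    using B by (intro subspace_sum[OF assms] subspace_scale[OF assms]) auto
  have on: "b \<bullet> c = (if b = c then 1 else 0)" if "b \<in> B" "c \<in> B" for b c
    using B(2,3) that by (auto simp: pairwise_def orthogonal_def dot_square_norm)
  have orB: "(v - P v) \<bullet> c = 0" if "c \<in> B" for v c
    unfolding P_def using that fB by (simp add: inner_diff_left inner_sum_left on if_distrib cong: if_cong)
  have orS: "(v - P v) \<bullet> s = 0" if "s \<in> S" for v s
  proof -
    have "orthogonal (v - P v) s"
      using that orB B(5) by (intro orthogonal_to_span[of s B]) (auto simp: orthogonal_def)
    then show ?thesis by (simp add: orthogonal_def)
  qed
  have id: "P v = v" if "v \<in> S" for v
  proof -
    have "v - P v \<in> S" using that mem by (intro subspace_diff[OF assms]) auto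
    then have "(v - P v) \<bullet> (v - P v) = 0" using orS by blast
    then show ?thesis by simp
  qed
  show thesis by (rule that[OF bl mem orS id B(1) P_def])
qed

text \<open>Compactness of the extended real line sorts the elements of \<open>D\<close> by limit:
  finite, plus infinity or minus infinity. Removing the projection to the span of the first class
  changes the pairings with the others by bounded amounts, so a single late index already supplies a
  real solution of all equations and strict inequalities. The vector \<open>b\<close> records the
  finite limits.\<close>

lemma weight_extraction:
  fixes v :: "nat \<Rightarrow> real^'n" and D :: "(real^'n) set"
  assumes fin: "finite D" and int: "\<And>\<delta> i. \<delta> \<in> D \<Longrightarrow> \<delta>$i \<in> \<int>"
  shows "\<exists>r (w::int^'n) (b::real^'n). strict_mono r \<and> (\<forall>\<delta>\<in>D.
     (\<delta> \<bullet> (\<chi> i. of_int (w$i)) = 0 \<and> (\<lambda>m. \<delta> \<bullet> v (r m)) \<longlonglongrightarrow> \<delta> \<bullet> b) \<or>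
     (\<delta> \<bullet> (\<chi> i. of_int (w$i)) > 0 \<and> filterlim (\<lambda>m. \<delta> \<bullet> v (r m)) at_top sequentially) \<or>
     (\<delta> \<bullet> (\<chi> i. of_int (w$i)) < 0 \<and> filterlim (\<lambda>m. \<delta> \<bullet> v (r m)) at_bot sequentially))"
proof -
  have "\<exists>r::nat\<Rightarrow>nat. strict_mono r \<and> (\<forall>d\<in>D. \<exists>l\<in>UNIV. (\<lambda>m. ereal (d \<bullet> v (r m))) \<longlonglongrightarrow> l)"
    by (rule finite_family_convergent_subseq[OF fin])
      (auto simp: seq_compact_eq_compact compact_UNIV)
  then obtain r where r: "strict_mono r" and "\<forall>d\<in>D. \<exists>l. (\<lambda>m. ereal (d \<bullet> v (r m))) \<longlonglongrightarrow> l"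
    by auto
  then obtain L where L: "\<And>d. d \<in> D \<Longrightarrow> (\<lambda>m. ereal (d \<bullet> v (r m))) \<longlonglongrightarrow> L d" by metis
  define D0 where "D0 = {d\<in>D. \<bar>L d\<bar> \<noteq> \<infinity>}"
  define Dp where "Dp = {d\<in>D. L d = \<infinity>}"
  define Dm where "Dm = {d\<in>D. L d = -\<infinity>}"
  have D0: "\<exists>x. (\<lambda>m. d \<bullet> v (r m)) \<longlonglongrightarrow> x" if "d \<in> D0" for d
    using L[of d] that unfolding D0_def by (cases "L d") auto
  have Dp: "filterlim (\<lambda>m. d \<bullet> v (r m)) at_top sequentially" if "d \<in> Dp" for d
    using L[of d] that unfolding Dp_def by (simp add: tendsto_PInfty_eq_at_top)
  have Dm: "filterlim (\<lambda>m. d \<bullet> v (r m)) at_bot sequentially" if "d \<in> Dm" for d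
    using L[of d] that by (auto simp: Dm_def tendsto_MInfty filterlim_at_bot_dense)
  obtain P B where P: "\<And>v s. s \<in> span D0 \<Longrightarrow> (v - P v) \<bullet> s = 0"
    and B: "B \<subseteq> span D0" "\<And>v. P v = (\<Sum>b\<in>B. (v \<bullet> b) *\<^sub>R b)"
    by (rule orthogonal_projection_onto_subspace[OF subspace_span[of D0]]) blast
  \<comment> \<open>Convergence passes by linearity from \<open>D0\<close> to its span, and so to
    the orthonormal basis \<open>B\<close>, which need not consist of elements of
    \<open>D\<close>.\<close>
  have sp: "\<exists>x. (\<lambda>m. s \<bullet> v (r m)) \<longlonglongrightarrow> x" if "s \<in> span D0" for s
    using that
  proof (induction rule: span_induct_alt)
    case base then show ?case by auto
  next
    case (step c x y)
    then obtain a b where "(\<lambda>m. x \<bullet> v (r m)) \<longlonglongrightarrow> a" "(\<lambda>m. y \<bullet> v (r m)) \<longlonglongrightarrow> b" using D0 by blast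
    then have "(\<lambda>m. c * (x \<bullet> v (r m)) + y \<bullet> v (r m)) \<longlonglongrightarrow> c * a + b" by (intro tendsto_intros)
    then show ?case unfolding inner_add_left inner_scaleR_left by (rule exI)
  qed
  then have "\<forall>b\<in>B. \<exists>x. (\<lambda>m. v (r m) \<bullet> b) \<longlonglongrightarrow> x"
    using B(1) by (simp only: inner_commute) blast
  then obtain X where X: "\<And>b. b \<in> B \<Longrightarrow> (\<lambda>m. v (r m) \<bullet> b) \<longlonglongrightarrow> X b"
    by metis
  define b where "b = (\<Sum>c\<in>B. X c *\<^sub>R c)"
  have Pb: "(\<lambda>m. P (v (r m))) \<longlonglongrightarrow> b"
    unfolding B(2) b_def by (intro tendsto_intros X)
  have d0: "(\<lambda>m. d \<bullet> v (r m)) \<longlonglongrightarrow> d \<bullet> b" if "d \<in> D0" for d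
  proof -
    have "d \<bullet> v (r m) = d \<bullet> P (v (r m))" for m
      using P[OF span_base[OF that], of "v (r m)"] by (simp add: inner_diff_left inner_diff_right inner_commute)
    then show ?thesis using tendsto_inner[OF tendsto_const Pb, of d] by simp
  qed
  define l where "l m = v (r m) - P (v (r m))" for m
  have lp: "eventually (\<lambda>m. d \<bullet> l m > 0) sequentially" if "d \<in> Dp" for d
  proof -
    have "(\<lambda>m. - (d \<bullet> P (v (r m)))) \<longlonglongrightarrow> - (d \<bullet> b)" by (intro tendsto_intros Pb)
    from filterlim_tendsto_add_at_top[OF this Dp[OF that]]
    have "\<forall>\<^sub>F m in sequentially. 0 < - (d \<bullet> P (v (r m))) + d \<bullet> v (r m)"
      unfolding filterlim_at_top_dense by blast
    then show ?thesis by (simp add: l_def inner_diff_right)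
  qed
  have lm: "eventually (\<lambda>m. (-d) \<bullet> l m > 0) sequentially" if "d \<in> Dm" for d
  proof -
    have "filterlim (\<lambda>m. - (d \<bullet> v (r m))) at_top sequentially"
      using Dm[OF that] by (simp add: filterlim_uminus_at_top)
    moreover have "(\<lambda>m. (d \<bullet> P (v (r m)))) \<longlonglongrightarrow> (d \<bullet> b)" by (intro tendsto_intros Pb)
    ultimately have "filterlim (\<lambda>m. d \<bullet> P (v (r m)) + - (d \<bullet> v (r m))) at_top sequentially"
      by (rule filterlim_tendsto_add_at_top[rotated])
    then have "\<forall>\<^sub>F m in sequentially. 0 < d \<bullet> P (v (r m)) + - (d \<bullet> v (r m))"
      unfolding filterlim_at_top_dense by blast
    then show ?thesis by (simp add: l_def inner_diff_right)
  qed
  \<comment> \<open>Elements of \<open>Dm\<close> enter with reversed sign, so that all inequalities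
    to be approximated are of the form > 0.\<close>
  have "eventually (\<lambda>m. \<forall>d\<in>Dp \<union> uminus ` Dm. d \<bullet> l m > 0) sequentially"
  proof (rule eventually_ball_finite)
    show "finite (Dp \<union> uminus ` Dm)" using fin by (simp add: Dp_def Dm_def)
    show "\<forall>d\<in>Dp \<union> uminus ` Dm. \<forall>\<^sub>F m in sequentially. 0 < d \<bullet> l m" using lp lm by blast
  qed
  from eventually_happens'[OF sequentially_bot this]
  obtain m where m: "\<forall>d\<in>Dp \<union> uminus ` Dm. d \<bullet> l m > 0" ..
  have "\<exists>w::int^'n. (\<forall>\<delta>\<in>D0. \<delta> \<bullet> (\<chi> i. of_int (w$i)) = 0) \<and>
      (\<forall>\<delta>\<in>Dp \<union> uminus ` Dm. \<delta> \<bullet> (\<chi> i. of_int (w$i)) > 0)"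
  proof (rule integral_weight[of _ _ "l m"])
    show "\<delta> \<bullet> l m = 0" if "\<delta> \<in> D0" for \<delta>
      using P[OF span_base[OF that], of "v (r m)"] by (simp add: l_def inner_commute)
    show "\<delta>$i \<in> \<int>" if "\<delta> \<in> D0 \<union> (Dp \<union> uminus ` Dm)" for \<delta> i
      using that int by (auto simp: D0_def Dp_def Dm_def)
    show "finite D0" "finite (Dp \<union> uminus ` Dm)" using fin by (simp_all add: D0_def Dp_def Dm_def)
  qed (use m in blast)
  then obtain w :: "int^'n" where w: "\<And>\<delta>. \<delta>\<in>D0 \<Longrightarrow> \<delta> \<bullet> (\<chi> i. of_int (w$i)) = 0"
      "\<And>\<delta>. \<delta>\<in>Dp \<union> uminus ` Dm \<Longrightarrow> \<delta> \<bullet> (\<chi> i. of_int (w$i)) > 0" by blast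
  show ?thesis
  proof (intro exI[of _ r] exI[of _ w] exI[of _ b] conjI r ballI)
    fix d assume "d \<in> D"
    then consider "d \<in> D0" | "d \<in> Dp" | "d \<in> Dm" by (auto simp: D0_def Dp_def Dm_def)
    then show "(d \<bullet> (\<chi> i. of_int (w$i)) = 0 \<and> (\<lambda>m. d \<bullet> v (r m)) \<longlonglongrightarrow> d \<bullet> b) \<or>
     (d \<bullet> (\<chi> i. of_int (w$i)) > 0 \<and> filterlim (\<lambda>m. d \<bullet> v (r m)) at_top sequentially) \<or>
     (d \<bullet> (\<chi> i. of_int (w$i)) < 0 \<and> filterlim (\<lambda>m. d \<bullet> v (r m)) at_bot sequentially)"
    proof cases
      case 3
      then have "(-d) \<bullet> (\<chi> i. of_int (w$i)) > 0" using w(2) by blast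
      then show ?thesis using Dm[OF 3] by simp
    next
      case 1
      show ?thesis using w(1)[OF 1] d0[OF 1] by blast
    next
      case 2
      then show ?thesis using w(2) Dp by blast
    qed
  qed
qed

section \<open>Quotients of monomials along sequences\<close>

definition mdot :: "nat^'n \<Rightarrow> nat^'n \<Rightarrow> nat" where
  "mdot w \<alpha> = (\<Sum>i\<in>UNIV. w$i * \<alpha>$i)"

lemma monom_nonzero_iff: "monom \<alpha> z \<noteq> 0 \<longleftrightarrow> (\<forall>i. \<alpha>$i \<noteq> 0 \<longrightarrow> z$i \<noteq> 0)"
  by (auto simp: monom_def)

lemma monom_0 [simp]: "monom 0 z = 1"
  by (simp add: monom_def)

lemma monom_axis [simp]: "monom (axis i (Suc 0)) z = z$i"
proof -
  have "monom (axis i (Suc 0)) z = (\<Prod>j\<in>UNIV. if j = i then z$i else 1)"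
    unfolding monom_def by (rule prod.cong) (auto simp: axis_def)
  then show ?thesis by simp
qed

lemma tendsto_monom:
  assumes "(z \<longlongrightarrow> z0) F"
  shows "((\<lambda>m. monom \<alpha> (z m)) \<longlongrightarrow> monom \<alpha> z0) F"
  unfolding monom_def by (intro tendsto_intros assms)

lemma monom_polar:
  "monom \<alpha> (\<chi> i. u$i * of_real (exp (- v$i))) = monom \<alpha> u * of_real (exp (- (\<Sum>i\<in>UNIV. real (\<alpha>$i) * v$i)))"
proof -
  have "(of_real (exp (- v$i)) :: complex) ^ (\<alpha>$i) = of_real (exp (- (real (\<alpha>$i) * v$i)))" for i
    by (metis exp_of_nat_mult mult_minus_right of_real_power)
  then have "(\<Prod>i\<in>UNIV. (of_real (exp (- v$i)) :: complex) ^ (\<alpha>$i)) = of_real (exp (\<Sum>i\<in>UNIV. - (real (\<alpha>$i) * v$i)))"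
    by (simp add: exp_sum)
  then show ?thesis
    by (simp add: monom_def power_mult_distrib prod.distrib sum_negf)
qed

text \<open>Writing each coordinate as a phase times exp(-v) turns a monomial quotient into a phase
  times the exponential of minus the pairing of \<open>v\<close> with an exponent difference. Phases
  converge on the unit circle along a subsequence, and \<open>weight_extraction\<close> handles the
  pairings. The coordinates themselves need not converge to those of \<open>a\<close>; only
  quotients of equal weight converge to their value at \<open>a\<close>.\<close>

lemma torus_weight_extraction:
  fixes z :: "nat \<Rightarrow> complex^'n"
  assumes nz: "\<And>m i. z m $ i \<noteq> 0" and fin: "finite A"
  shows "\<exists>r (w::int^'n) (a::complex^'n). strict_mono r \<and> (\<forall>i. a$i \<noteq> 0) \<and> (\<forall>\<alpha>\<in>A. \<forall>\<beta>\<in>A.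
    ((\<Sum>i\<in>UNIV. w$i * int (\<alpha>$i)) = (\<Sum>i\<in>UNIV. w$i * int (\<beta>$i)) \<longrightarrow>
       (\<lambda>m. monom \<alpha> (z (r m)) / monom \<beta> (z (r m))) \<longlonglongrightarrow> monom \<alpha> a / monom \<beta> a) \<and>
    ((\<Sum>i\<in>UNIV. w$i * int (\<alpha>$i)) > (\<Sum>i\<in>UNIV. w$i * int (\<beta>$i)) \<longrightarrow>
       (\<lambda>m. monom \<alpha> (z (r m)) / monom \<beta> (z (r m))) \<longlonglongrightarrow> 0))"
proof -
  have "\<exists>r::nat\<Rightarrow>nat. strict_mono r \<and> (\<forall>i\<in>(UNIV::'n set). \<exists>l\<in>sphere 0 1. (\<lambda>m. sgn (z (r m) $ i)) \<longlonglongrightarrow> l)"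
    by (rule finite_family_convergent_subseq)
      (use nz in \<open>auto simp: compact_imp_seq_compact norm_sgn\<close>)
  then obtain r1 where r1: "strict_mono r1" and "\<forall>i. \<exists>l\<in>sphere 0 1. (\<lambda>m. sgn (z (r1 m) $ i)) \<longlonglongrightarrow> l"
    by auto
  then obtain p where p: "\<And>i. norm (p i) = 1" "\<And>i. (\<lambda>m. sgn (z (r1 m) $ i)) \<longlonglongrightarrow> p i"
    by (metis dist_0_norm mem_sphere)
  define u :: "nat \<Rightarrow> complex^'n" where "u m = (\<chi> i. sgn (z (r1 m) $ i))" for m
  \<comment> \<open>With this sign, small coordinates have large \<open>v\<close>, and the heavier
    monomials become the negligible ones.\<close>
  define v :: "nat \<Rightarrow> real^'n" where "v m = (\<chi> i. - ln (cmod (z (r1 m) $ i)))" for m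
  have zuv: "z (r1 m) = (\<chi> i. u m $ i * of_real (exp (- v m $ i)))" for m
    using nz by (simp add: u_def v_def vec_eq_iff sgn_div_norm scaleR_conv_of_real)
  define D :: "(real^'n) set" where "D = (\<lambda>(\<alpha>,\<beta>). (\<chi> i. real (\<alpha>$i) - real (\<beta>$i))) ` (A \<times> A)"
  obtain r2 and w :: "int^'n" and b :: "real^'n" where r2: "strict_mono r2" and
    w: "\<And>\<delta>. \<delta>\<in>D \<Longrightarrow>
     (\<delta> \<bullet> (\<chi> i. of_int (w$i)) = 0 \<and> (\<lambda>m. \<delta> \<bullet> v (r2 m)) \<longlonglongrightarrow> \<delta> \<bullet> b) \<or>
     (\<delta> \<bullet> (\<chi> i. of_int (w$i)) > 0 \<and> filterlim (\<lambda>m. \<delta> \<bullet> v (r2 m)) at_top sequentially) \<or>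
     (\<delta> \<bullet> (\<chi> i. of_int (w$i)) < 0 \<and> filterlim (\<lambda>m. \<delta> \<bullet> v (r2 m)) at_bot sequentially)"
  proof -
    have "finite D" unfolding D_def using fin by simp
    moreover have "\<delta>$i \<in> \<int>" if "\<delta> \<in> D" for \<delta> i using that by (auto simp: D_def)
    ultimately show thesis using weight_extraction[of D v] that by blast
  qed
  define r where "r = r1 \<circ> r2"
  define U :: "complex^'n" where "U = (\<chi> i. p i)"
  define a :: "complex^'n" where "a = (\<chi> i. U$i * of_real (exp (- b$i)))"
  have U0: "U$i \<noteq> 0" for i using p(1)[of i] by (auto simp: U_def)
  have a0: "a$i \<noteq> 0" for i using U0 by (simp add: a_def)
  have uU: "(\<lambda>m. u (r2 m)) \<longlonglongrightarrow> U"
    by (rule vec_tendstoI)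
      (use LIMSEQ_subseq_LIMSEQ[OF p(2) r2] in \<open>simp add: u_def U_def o_def\<close>)
  show ?thesis
  proof (intro exI[of _ r] exI[of _ w] exI[of _ a] conjI ballI allI)
    show "strict_mono r" unfolding r_def using r1 r2 by (rule strict_mono_o)
    fix \<alpha> \<beta> assume ab: "\<alpha> \<in> A" "\<beta> \<in> A"
    define \<delta> :: "real^'n" where "\<delta> = (\<chi> i. real (\<alpha>$i) - real (\<beta>$i))"
    have \<delta>D: "\<delta> \<in> D" using ab by (auto simp: D_def \<delta>_def)
    have \<delta>w: "\<delta> \<bullet> (\<chi> i. of_int (w$i)) = of_int ((\<Sum>i\<in>UNIV. w$i * int (\<alpha>$i)) - (\<Sum>i\<in>UNIV. w$i * int (\<beta>$i)))"
      by (simp add: \<delta>_def inner_vec_def algebra_simps sum_subtractf)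
    have quot: "monom \<alpha> (\<chi> i. x$i * of_real (exp (- y$i))) / monom \<beta> (\<chi> i. x$i * of_real (exp (- y$i)))
        = monom \<alpha> x / monom \<beta> x * of_real (exp (- (\<delta> \<bullet> y)))" for x :: "complex^'n" and y
    proof -
      have "\<delta> \<bullet> y = (\<Sum>i\<in>UNIV. real (\<alpha>$i) * y$i) - (\<Sum>i\<in>UNIV. real (\<beta>$i) * y$i)"
        by (simp add: \<delta>_def inner_vec_def algebra_simps sum_subtractf)
      then have "exp (- (\<delta> \<bullet> y)) = exp (- (\<Sum>i\<in>UNIV. real (\<alpha>$i) * y$i)) / exp (- (\<Sum>i\<in>UNIV. real (\<beta>$i) * y$i))"
        by (simp flip: exp_diff)
      then show ?thesis unfolding monom_polar by simp
    qed
    have q: "monom \<alpha> (z (r m)) / monom \<beta> (z (r m)) = monom \<alpha> (u (r2 m)) / monom \<beta> (u (r2 m)) * of_real (exp (- (\<delta> \<bullet> v (r2 m))))" for m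
      unfolding r_def o_def by (subst (1 2) zuv) (rule quot)
    have qa: "monom \<alpha> a / monom \<beta> a = monom \<alpha> U / monom \<beta> U * of_real (exp (- (\<delta> \<bullet> b)))"
      unfolding a_def by (rule quot)
    have ul: "(\<lambda>m. monom \<alpha> (u (r2 m)) / monom \<beta> (u (r2 m))) \<longlonglongrightarrow> monom \<alpha> U / monom \<beta> U"
      by (intro tendsto_intros tendsto_monom uU) (simp add: monom_nonzero_iff U0)
    show "(\<Sum>i\<in>UNIV. w$i * int (\<alpha>$i)) = (\<Sum>i\<in>UNIV. w$i * int (\<beta>$i)) \<longrightarrow>
       (\<lambda>m. monom \<alpha> (z (r m)) / monom \<beta> (z (r m))) \<longlonglongrightarrow> monom \<alpha> a / monom \<beta> a"
    proof
      assume "(\<Sum>i\<in>UNIV. w$i * int (\<alpha>$i)) = (\<Sum>i\<in>UNIV. w$i * int (\<beta>$i))"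
      then have "(\<lambda>m. \<delta> \<bullet> v (r2 m)) \<longlonglongrightarrow> \<delta> \<bullet> b" using w[OF \<delta>D] \<delta>w by auto
      then show "(\<lambda>m. monom \<alpha> (z (r m)) / monom \<beta> (z (r m))) \<longlonglongrightarrow> monom \<alpha> a / monom \<beta> a"
        unfolding q qa by (intro tendsto_mult ul tendsto_of_real tendsto_exp tendsto_minus)
    qed
    show "(\<Sum>i\<in>UNIV. w$i * int (\<beta>$i)) < (\<Sum>i\<in>UNIV. w$i * int (\<alpha>$i)) \<longrightarrow>
       (\<lambda>m. monom \<alpha> (z (r m)) / monom \<beta> (z (r m))) \<longlonglongrightarrow> 0"
    proof
      assume "(\<Sum>i\<in>UNIV. w$i * int (\<beta>$i)) < (\<Sum>i\<in>UNIV. w$i * int (\<alpha>$i))"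
      then have "\<delta> \<bullet> (\<chi> i. of_int (w$i)) > 0" unfolding \<delta>w of_int_0_less_iff by linarith
      then have "filterlim (\<lambda>m. \<delta> \<bullet> v (r2 m)) at_top sequentially" using w[OF \<delta>D] by auto
      then have "(\<lambda>m. exp (- (\<delta> \<bullet> v (r2 m)))) \<longlonglongrightarrow> 0"
        by (intro filterlim_compose[OF exp_at_bot]) (simp add: filterlim_uminus_at_bot)
      from tendsto_mult[OF ul tendsto_of_real[OF this]]
      show "(\<lambda>m. monom \<alpha> (z (r m)) / monom \<beta> (z (r m))) \<longlonglongrightarrow> 0" unfolding q by simp
    qed
  qed (rule a0)
qed

text \<open>Coordinates outside \<open>I\<close> are replaced by 1 to reach the torus. Adjoining the
  exponent 0 and the unit vectors to \<open>A\<close> lets the weights on \<open>I\<close> be read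
  off from the coordinates: convergence of a coordinate excludes a negative weight, and its limit is
  nonzero exactly when the weight is zero.\<close>

lemma stratum_weight_extraction:
  fixes z :: "nat \<Rightarrow> complex^'n"
  assumes zI: "\<And>m i. z m $ i \<noteq> 0 \<longleftrightarrow> i \<in> I" and lim: "z \<longlonglongrightarrow> z0" and z0J: "\<And>i. z0$i \<noteq> 0 \<longleftrightarrow> i \<in> J"
    and fin: "finite A"
  obtains r w a where "strict_mono r" "\<And>i. a$i \<noteq> 0" "I_w w = J" "\<And>i. i \<in> J \<Longrightarrow> a$i = z0$i"
    "\<And>\<alpha> \<beta>. \<alpha> \<in> A \<Longrightarrow> \<beta> \<in> A \<Longrightarrow> (\<forall>i. \<beta>$i \<noteq> 0 \<longrightarrow> i \<in> I) \<Longrightarrow> mdot w \<alpha> \<le> mdot w \<beta> \<Longrightarrow> (\<forall>i. \<alpha>$i \<noteq> 0 \<longrightarrow> i \<in> I)"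
    "\<And>\<alpha> \<beta>. \<alpha> \<in> A \<Longrightarrow> \<beta> \<in> A \<Longrightarrow> (\<forall>i. \<beta>$i \<noteq> 0 \<longrightarrow> i \<in> I) \<Longrightarrow> mdot w \<alpha> = mdot w \<beta> \<Longrightarrow>
       (\<lambda>m. monom \<alpha> (z (r m)) / monom \<beta> (z (r m))) \<longlonglongrightarrow> monom \<alpha> a / monom \<beta> a"
    "\<And>\<alpha> \<beta>. \<alpha> \<in> A \<Longrightarrow> \<beta> \<in> A \<Longrightarrow> (\<forall>i. \<beta>$i \<noteq> 0 \<longrightarrow> i \<in> I) \<Longrightarrow> mdot w \<beta> < mdot w \<alpha> \<Longrightarrow>
       (\<lambda>m. monom \<alpha> (z (r m)) / monom \<beta> (z (r m))) \<longlonglongrightarrow> 0"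
    "\<And>i j. i \<in> I \<Longrightarrow> j \<in> I \<Longrightarrow> w$j < w$i \<Longrightarrow> (\<lambda>m. z (r m) $ i / z (r m) $ j) \<longlonglongrightarrow> 0"
proof -
  define Z :: "nat \<Rightarrow> complex^'n" where "Z m = (\<chi> i. if i \<in> I then z m $ i else 1)" for m
  define A' where "A' = {\<alpha>\<in>A. \<forall>i. \<alpha>$i \<noteq> 0 \<longrightarrow> i \<in> I} \<union> {0} \<union> range (\<lambda>i. axis i 1)"
  obtain r and w :: "int^'n" and a :: "complex^'n" where r: "strict_mono r" and a0: "\<And>i. a$i \<noteq> 0" and
    eq: "\<And>\<alpha> \<beta>. \<alpha>\<in>A' \<Longrightarrow> \<beta>\<in>A' \<Longrightarrow> (\<Sum>i\<in>UNIV. w$i * int (\<alpha>$i)) = (\<Sum>i\<in>UNIV. w$i * int (\<beta>$i)) \<Longrightarrow>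
       (\<lambda>m. monom \<alpha> (Z (r m)) / monom \<beta> (Z (r m))) \<longlonglongrightarrow> monom \<alpha> a / monom \<beta> a" and
    gt: "\<And>\<alpha> \<beta>. \<alpha>\<in>A' \<Longrightarrow> \<beta>\<in>A' \<Longrightarrow> (\<Sum>i\<in>UNIV. w$i * int (\<alpha>$i)) > (\<Sum>i\<in>UNIV. w$i * int (\<beta>$i)) \<Longrightarrow>
       (\<lambda>m. monom \<alpha> (Z (r m)) / monom \<beta> (Z (r m))) \<longlonglongrightarrow> 0"
  proof -
    have "finite A'" unfolding A'_def using fin by auto
    moreover have "\<And>m i. Z m $ i \<noteq> 0" using zI by (auto simp: Z_def)
    ultimately show thesis using torus_weight_extraction[of Z A'] that by blast
  qed
  have ZZ: "monom \<alpha> (Z m) = monom \<alpha> (z m)" if "\<forall>i. \<alpha>$i \<noteq> 0 \<longrightarrow> i \<in> I" for \<alpha> m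
  proof -
    have "Z m $ i ^ (\<alpha>$i) = z m $ i ^ (\<alpha>$i)" for i
      using that by (cases "i \<in> I"; cases "\<alpha>$i = 0") (auto simp: Z_def)
    then show ?thesis by (simp add: monom_def)
  qed
  have dax: "(\<Sum>j\<in>UNIV. w$j * int (axis i 1 $ j)) = w$i" for i
  proof -
    have "(\<Sum>j\<in>UNIV. w$j * int (axis i 1 $ j)) = (\<Sum>j\<in>UNIV. if j = i then w$i else 0)"
      by (rule sum.cong) (auto simp: axis_def)
    then show ?thesis by simp
  qed
  have axA: "axis i 1 \<in> A'" "0 \<in> A'" for i by (auto simp: A'_def)
  have Zi: "Z m $ i = z m $ i" if "i \<in> I" for i m using that by (simp add: Z_def)
  have limi: "(\<lambda>m. z (r m) $ i) \<longlonglongrightarrow> z0 $ i" for i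
    using LIMSEQ_subseq_LIMSEQ[OF tendsto_vec_nth[OF lim, of i] r] by (simp add: o_def)
  have wneg: "\<not> w$i < 0" if "i \<in> I" for i
  proof
    assume "w$i < 0"
    then have "(\<lambda>m. 1 / z (r m) $ i) \<longlonglongrightarrow> 0"
      using gt[of 0 "axis i 1"] axA dax that by (simp add: Zi)
    moreover have "z (r m) $ i \<noteq> 0" for m using zI that by blast
    ultimately have "(\<lambda>m. 1::complex) \<longlonglongrightarrow> 0"
      using tendsto_mult[OF _ limi[of i], of "\<lambda>m. 1 / z (r m) $ i" 0] by simp
    then show False by (simp add: LIMSEQ_const_iff)
  qed
  have JI: "J \<subseteq> I"
  proof
    fix i assume "i \<in> J"
    then have "z0$i \<noteq> 0" using z0J by blast
    from eventually_happens'[OF sequentially_bot tendsto_imp_eventually_ne[OF limi[of i] this]]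
    obtain m where "z (r m) $ i \<noteq> 0" ..
    then show "i \<in> I" using zI by blast
  qed
  have wJ: "w$i = 0 \<and> a$i = z0$i" if "i \<in> J" for i
  proof -
    have iI: "i \<in> I" using that JI by blast
    have "\<not> w$i > 0"
    proof
      assume "w$i > 0"
      then have "(\<lambda>m. z (r m) $ i) \<longlonglongrightarrow> 0" using gt[of "axis i 1" 0] axA dax iI by (simp add: Zi)
      then show False using limi[of i] LIMSEQ_unique z0J that by blast
    qed
    then have w0: "w$i = 0" using wneg[OF iI] by linarith
    then have "(\<lambda>m. z (r m) $ i) \<longlonglongrightarrow> a$i" using eq[of "axis i 1" 0] axA dax iI by (simp add: Zi)
    then show ?thesis using w0 limi[of i] LIMSEQ_unique by blast
  qed
  have wpos: "w$i > 0" if "i \<in> I" "i \<notin> J" for i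
  proof (rule ccontr)
    assume "\<not> w$i > 0"
    then have "w$i = 0" using wneg[OF that(1)] by linarith
    then have "(\<lambda>m. z (r m) $ i) \<longlonglongrightarrow> a$i" using eq[of "axis i 1" 0] axA dax that by (simp add: Zi)
    then show False using limi[of i] LIMSEQ_unique z0J that(2) a0 by metis
  qed
  \<comment> \<open>\<open>N\<close> exceeds the weight of every exponent in \<open>A\<close>
    supported in \<open>I\<close>, so an exponent involving a variable outside \<open>I\<close> is
    strictly heavier than all of these. The summand 1 also keeps the new weights positive, as
    \<open>I_w W = J\<close> requires.\<close>
  define N where "N = 1 + (\<Sum>\<beta>\<in>A. \<Sum>i\<in>UNIV. nat (w$i) * \<beta>$i)"
  define W :: "nat^'n" where "W = (\<chi> i. if i \<in> I then nat (w$i) else N)"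
  have Wdot: "int (mdot W \<alpha>) = (\<Sum>i\<in>UNIV. w$i * int (\<alpha>$i))" if "\<forall>i. \<alpha>$i \<noteq> 0 \<longrightarrow> i \<in> I" for \<alpha>
    unfolding mdot_def of_nat_sum W_def
    by (rule sum.cong) (use that wneg in \<open>auto simp: not_less\<close>)
  have sup: "\<forall>i. \<alpha>$i \<noteq> 0 \<longrightarrow> i \<in> I"
    if "\<alpha> \<in> A" "\<beta> \<in> A" "\<forall>i. \<beta>$i \<noteq> 0 \<longrightarrow> i \<in> I" "mdot W \<alpha> \<le> mdot W \<beta>" for \<alpha> \<beta>
  proof (intro allI impI, rule ccontr)
    fix i assume i: "\<alpha>$i \<noteq> 0" "i \<notin> I"
    have "N \<le> W$i * \<alpha>$i" using i by (simp add: W_def)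
    also have "\<dots> \<le> mdot W \<alpha>" unfolding mdot_def by (rule member_le_sum) auto
    also have "\<dots> \<le> mdot W \<beta>" by fact
    also have "\<dots> = (\<Sum>i\<in>UNIV. nat (w$i) * \<beta>$i)" unfolding mdot_def
      by (rule sum.cong) (use that(3) in \<open>auto simp: W_def\<close>)
    also have "\<dots> \<le> (\<Sum>\<beta>\<in>A. \<Sum>i\<in>UNIV. nat (w$i) * \<beta>$i)"
      by (rule member_le_sum) (use that fin in auto)
    finally show False unfolding N_def by simp
  qed
  show thesis
  proof (rule that[of r a W])
    show "I_w W = J"
    proof -
      have "W$i = 0 \<longleftrightarrow> i \<in> J" for i
        using wJ[of i] wpos[of i] JI by (cases "i \<in> J") (auto simp: W_def N_def)
      then show ?thesis by (simp add: I_w_def)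
    qed
  next
    fix \<alpha> \<beta> assume *: "\<alpha> \<in> A" "\<beta> \<in> A" "\<forall>i. \<beta>$i \<noteq> 0 \<longrightarrow> i \<in> I" "mdot W \<alpha> \<le> mdot W \<beta>"
    show "\<forall>i. \<alpha>$i \<noteq> 0 \<longrightarrow> i \<in> I" by (rule sup[OF *])
  next
    fix \<alpha> \<beta> assume *: "\<alpha> \<in> A" "\<beta> \<in> A" "\<forall>i. \<beta>$i \<noteq> 0 \<longrightarrow> i \<in> I" "mdot W \<alpha> = mdot W \<beta>"
    have s: "\<forall>i. \<alpha>$i \<noteq> 0 \<longrightarrow> i \<in> I" by (rule sup[OF *(1-3)]) (use * in simp)
    show "(\<lambda>m. monom \<alpha> (z (r m)) / monom \<beta> (z (r m))) \<longlonglongrightarrow> monom \<alpha> a / monom \<beta> a"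
      using eq[of \<alpha> \<beta>] Wdot[OF s] Wdot[OF *(3)] * s ZZ[OF s] ZZ[OF *(3)] by (simp add: A'_def)
  next
    fix \<alpha> \<beta> assume *: "\<alpha> \<in> A" "\<beta> \<in> A" "\<forall>i. \<beta>$i \<noteq> 0 \<longrightarrow> i \<in> I" "mdot W \<beta> < mdot W \<alpha>"
    show "(\<lambda>m. monom \<alpha> (z (r m)) / monom \<beta> (z (r m))) \<longlonglongrightarrow> 0"
    proof (cases "\<forall>i. \<alpha>$i \<noteq> 0 \<longrightarrow> i \<in> I")
      case s: True
      show ?thesis
        using gt[of \<alpha> \<beta>] Wdot[OF s] Wdot[OF *(3)] * s ZZ[OF s] ZZ[OF *(3)]
        by (simp add: A'_def)
    next
      case False
      then have "monom \<alpha> (z m) = 0" for m using zI monom_nonzero_iff by blast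
      then show ?thesis by simp
    qed
  next
    fix i j assume *: "i \<in> I" "j \<in> I" "W$j < W$i"
    then have "w$j < w$i" by (simp add: W_def) 
    then show "(\<lambda>m. z (r m) $ i / z (r m) $ j) \<longlonglongrightarrow> 0"
      using gt[of "axis i 1" "axis j 1"] axA dax * by (simp add: Zi)
  qed (use r a0 wJ in auto)
qed

section \<open>Newton data\<close>

abbreviation realvec :: "nat^'n \<Rightarrow> real^'n" where
  "realvec \<alpha> \<equiv> (\<chi> i. real (\<alpha>$i))"

lemma wdot_realvec: "wdot w (realvec \<alpha>) = real (mdot w \<alpha>)"
  by (simp add: wdot_def mdot_def)

lemma wdot_inner: "wdot w x = realvec w \<bullet> x"
  by (simp add: wdot_def inner_vec_def)

lemma wdot_mono: "(\<And>i. x$i \<le> y$i) \<Longrightarrow> wdot w x \<le> wdot w y"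
  unfolding wdot_def by (intro sum_mono mult_left_mono) auto

lemma realvec_in_Gamma_plus: "c \<alpha> \<noteq> 0 \<Longrightarrow> realvec \<alpha> \<in> Gamma_plus c"
  unfolding Gamma_plus_def by (rule hull_inc) auto

lemma Gamma_plus_empty_iff: "Gamma_plus c = {} \<longleftrightarrow> (\<forall>\<alpha>. c \<alpha> = 0)"
proof
  assume "Gamma_plus c = {}" then show "\<forall>\<alpha>. c \<alpha> = 0" using realvec_in_Gamma_plus by blast
qed (simp add: Gamma_plus_def)

lemma wdot_Gamma_plus_ge:
  assumes "\<And>\<alpha>. c \<alpha> \<noteq> 0 \<Longrightarrow> d \<le> real (mdot w \<alpha>)" and "x \<in> Gamma_plus c"
  shows "d \<le> wdot w x"
proof -
  have "Gamma_plus c \<subseteq> {x. realvec w \<bullet> x \<ge> d}"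
    unfolding Gamma_plus_def
  proof (rule hull_minimal)
    show "convex {x. realvec w \<bullet> x \<ge> d}" by (rule convex_halfspace_ge)
    show "(\<Union>\<alpha>\<in>{\<alpha>. c \<alpha> \<noteq> 0}. {x. \<forall>i. real (\<alpha>$i) \<le> x$i}) \<subseteq> {x. realvec w \<bullet> x \<ge> d}"
    proof clarify
      fix \<alpha> :: "nat^'a" and x :: "real^'a"
      assume a: "c \<alpha> \<noteq> 0" "\<forall>i. real (\<alpha>$i) \<le> x$i"
      then have "wdot w (realvec \<alpha>) \<le> wdot w x" by (intro wdot_mono) auto
      then show "realvec w \<bullet> x \<ge> d" using assms(1)[OF a(1)]
        unfolding wdot_realvec unfolding wdot_inner by linarith
    qed
  qed
  then show ?thesis using assms(2) by (auto simp: wdot_inner)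
qed

lemma d_weight_eqI:
  assumes "c \<beta> \<noteq> 0" and "\<And>\<alpha>. c \<alpha> \<noteq> 0 \<Longrightarrow> mdot w \<beta> \<le> mdot w \<alpha>"
  shows "d_weight w c = real (mdot w \<beta>)"
  unfolding d_weight_def
proof (rule cInf_eq_minimum)
  show "real (mdot w \<beta>) \<in> wdot w ` Gamma_plus c"
    using realvec_in_Gamma_plus[of c \<beta>] assms(1) by (auto simp: wdot_realvec[symmetric])
  show "real (mdot w \<beta>) \<le> x" if "x \<in> wdot w ` Gamma_plus c" for x
    using that wdot_Gamma_plus_ge[of c "real (mdot w \<beta>)" w] assms(2) by auto
qed

lemma exists_min_weight:
  assumes "c \<alpha>0 \<noteq> (0::complex)"
  obtains \<beta> where "c \<beta> \<noteq> 0" "\<And>\<alpha>. c \<alpha> \<noteq> 0 \<Longrightarrow> mdot w \<beta> \<le> mdot w \<alpha>"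
  using ex_has_least_nat[of "\<lambda>\<alpha>. c \<alpha> \<noteq> 0" \<alpha>0 "mdot w"] assms by blast

text \<open>For a positive weight the minimal face is the hull of finitely many exponents, hence compact,
  hence part of the Newton boundary.\<close>

lemma positive_weight_min_in_newton_boundary:
  assumes pos: "positive_weight w" and fin: "finite {\<alpha>. c \<alpha> \<noteq> 0}"
    and \<beta>: "c \<beta> \<noteq> 0" "\<And>\<alpha>. c \<alpha> \<noteq> 0 \<Longrightarrow> mdot w \<beta> \<le> mdot w \<alpha>"
  shows "realvec \<beta> \<in> newton_boundary c"
proof -
  define d where "d = real (mdot w \<beta>)"
  define E where "E = realvec ` {\<alpha>. c \<alpha> \<noteq> 0 \<and> mdot w \<alpha> = mdot w \<beta>}"
  have fE: "finite E" unfolding E_def by (rule finite_imageI, rule finite_subset[OF _ fin]) auto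
  have EG: "convex hull E \<subseteq> Gamma_plus c"
    by (rule hull_minimal) (auto simp: E_def realvec_in_Gamma_plus, simp add: Gamma_plus_def)
  have Ew: "convex hull E \<subseteq> {x. realvec w \<bullet> x = d}"
  proof (rule hull_minimal)
    show "E \<subseteq> {x. realvec w \<bullet> x = d}"
      by (auto simp: E_def d_def wdot_realvec[symmetric] wdot_inner)
         (metis wdot_inner wdot_realvec)
    show "convex {x. realvec w \<bullet> x = d}" by (rule convex_hyperplane)
  qed
  \<comment> \<open>\<open>Q\<close> replaces a description of the whole Newton polyhedron: it is
    convex, contains all generating orthants, and meets the supporting hyperplane exactly in the
    hull of \<open>E\<close>.\<close>
  define Q where "Q = {x. realvec w \<bullet> x > d} \<union> convex hull E"
  have cQ: "convex Q"
    unfolding convex_alt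
  proof (intro ballI allI impI)
    fix x y and u :: real assume xy: "x \<in> Q" "y \<in> Q" and u: "0 \<le> u \<and> u \<le> 1"
    have ge: "realvec w \<bullet> x \<ge> d" "realvec w \<bullet> y \<ge> d" using xy Ew by (auto simp: Q_def)
    show "(1 - u) *\<^sub>R x + u *\<^sub>R y \<in> Q"
    proof (cases "x \<in> convex hull E \<and> y \<in> convex hull E \<or> u = 0 \<or> u = 1")
      case True
      then show ?thesis using xy u convexD_alt[OF convex_convex_hull, of x E y u]
        by (auto simp: Q_def)
    next
      case False
      then have gt: "realvec w \<bullet> x > d \<or> realvec w \<bullet> y > d" and u1: "0 < u" "u < 1"
        using xy u by (auto simp: Q_def)
      have "0 \<le> (1-u) * (realvec w \<bullet> x - d)" "0 \<le> u * (realvec w \<bullet> y - d)"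
        using ge u1 by auto
      moreover have "0 < (1-u) * (realvec w \<bullet> x - d) \<or> 0 < u * (realvec w \<bullet> y - d)"
        using gt u1 by auto
      ultimately have "0 < (1-u) * (realvec w \<bullet> x - d) + u * (realvec w \<bullet> y - d)" by linarith
      also have "\<dots> = realvec w \<bullet> ((1 - u) *\<^sub>R x + u *\<^sub>R y) - d"
        by (simp add: inner_add_right algebra_simps)
      finally show ?thesis by (simp add: Q_def)
    qed
  qed
  have GQ: "Gamma_plus c \<subseteq> Q"
    unfolding Gamma_plus_def
  proof (rule hull_minimal[where S=convex, OF _ cQ], clarify)
    fix \<alpha> x assume a: "c \<alpha> \<noteq> 0" "\<forall>i. real (\<alpha>$i) \<le> x$i"
    show "x \<in> Q"
    proof (cases "mdot w \<alpha> = mdot w \<beta> \<and> x = realvec \<alpha>")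
      case True
      then show ?thesis using a(1) by (auto simp: Q_def E_def intro!: hull_inc)
    next
      case False
      have le: "wdot w (realvec \<alpha>) \<le> wdot w x" using a(2) by (intro wdot_mono) auto
      have "wdot w x > d"
      proof (cases "mdot w \<alpha> = mdot w \<beta>")
        case True
        with False obtain i where i: "x$i \<noteq> real (\<alpha>$i)" by (auto simp: vec_eq_iff)
        \<comment> \<open>Positivity of all weights enters here: any proper increase of a coordinate
          raises the weight, so no unbounded direction of the polyhedron stays in the face.\<close>
        have "wdot w (realvec \<alpha>) < wdot w x"
          unfolding wdot_def
        proof (rule sum_strict_mono_ex1)
          show "\<exists>a\<in>UNIV. real (w $ a) * realvec \<alpha> $ a < real (w $ a) * x $ a"
            using i a(2) pos by (intro bexI[of _ i]) (auto simp: positive_weight_def order.order_iff_strict)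
        qed (use a(2) in \<open>auto intro: mult_left_mono\<close>)
        then show ?thesis using True by (simp add: d_def wdot_realvec)
      next
        case False
        then have "mdot w \<beta> < mdot w \<alpha>" using \<beta>(2)[OF a(1)] by linarith
        then show ?thesis using le by (simp add: d_def wdot_realvec)
      qed
      then show ?thesis by (simp add: Q_def wdot_inner)
    qed
  qed
  have face: "convex hull E = Gamma_plus c \<inter> {x. realvec w \<bullet> x = d}"
    using EG Ew GQ by (auto simp: Q_def)
  have "(Gamma_plus c \<inter> {x. realvec w \<bullet> x = d}) face_of Gamma_plus c"
  proof (rule face_of_Int_supporting_hyperplane_ge)
    show "convex (Gamma_plus c)" by (simp add: Gamma_plus_def)
    show "\<And>x. x \<in> Gamma_plus c \<Longrightarrow> realvec w \<bullet> x \<ge> d"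
      using GQ Ew by (auto simp: Q_def)
  qed
  moreover have "compact (convex hull E)" using fE by (rule finite_imp_compact_convex_hull)
  moreover have "realvec \<beta> \<in> convex hull E" using \<beta>(1) by (auto simp: E_def intro!: hull_inc)
  ultimately show ?thesis unfolding newton_boundary_def face[symmetric] by blast
qed

lemma newton_boundary_subset: "newton_boundary c \<subseteq> Gamma_plus c"
  by (auto simp: newton_boundary_def dest: face_of_imp_subset)

text \<open>Compact faces test positive weights, while tameness calls for zero entries.
  \<open>W\<close> is a positive perturbation of a large multiple of \<open>w\<close>; since
  \<open>N\<close> exceeds the degree of \<open>\<alpha>\<close>, the perturbation cannot bridge a
  unit step of \<open>mdot w\<close>. The \<open>W\<close>-minimal exponent of \<open>c\<close> lies
  on the boundary for \<open>c'\<close> as well and therefore bounds the \<open>W\<close>-minimum of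
  \<open>c'\<close>.\<close>

lemma newton_boundary_le_min_weight:
  assumes nb: "newton_boundary c \<subseteq> newton_boundary c'" and fin: "finite {\<alpha>. c \<alpha> \<noteq> 0}"
    and \<alpha>: "c \<alpha> \<noteq> 0"
  shows "\<exists>\<alpha>'. c' \<alpha>' \<noteq> 0 \<and> mdot w \<alpha>' \<le> mdot w \<alpha>"
proof -
  define N where "N = Suc (\<Sum>i\<in>UNIV. \<alpha>$i)"
  define W :: "nat^'a" where "W = (\<chi> i. N * w$i + 1)"
  have W: "mdot W \<gamma> = N * mdot w \<gamma> + (\<Sum>i\<in>UNIV. \<gamma>$i)" for \<gamma>
    by (simp add: mdot_def W_def algebra_simps sum.distrib sum_distrib_left)
  have pos: "positive_weight W" by (simp add: positive_weight_def W_def)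
  obtain \<beta> where \<beta>: "c \<beta> \<noteq> 0" "\<And>\<gamma>. c \<gamma> \<noteq> 0 \<Longrightarrow> mdot W \<beta> \<le> mdot W \<gamma>"
    using exists_min_weight[of c \<alpha> W] \<alpha> by metis
  have "realvec \<beta> \<in> Gamma_plus c'"
    using positive_weight_min_in_newton_boundary[OF pos fin \<beta>] nb newton_boundary_subset by blast
  then obtain \<gamma>0 where "c' \<gamma>0 \<noteq> 0" using Gamma_plus_empty_iff[of c'] by auto
  then obtain \<alpha>' where \<alpha>': "c' \<alpha>' \<noteq> 0" "\<And>\<gamma>. c' \<gamma> \<noteq> 0 \<Longrightarrow> mdot W \<alpha>' \<le> mdot W \<gamma>"
    using exists_min_weight[of c' \<gamma>0 W] by metis
  have "real (mdot W \<alpha>') \<le> wdot W (realvec \<beta>)"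
    by (rule wdot_Gamma_plus_ge[OF _ \<open>realvec \<beta> \<in> Gamma_plus c'\<close>]) (use \<alpha>' in auto)
  then have "mdot W \<alpha>' \<le> mdot W \<beta>" by (simp add: wdot_realvec)
  also have "\<dots> \<le> mdot W \<alpha>" using \<beta> \<alpha> by blast
  finally have "N * mdot w \<alpha>' < N * mdot w \<alpha> + N" unfolding W N_def by linarith
  then have "N * mdot w \<alpha>' < N * (mdot w \<alpha> + 1)" by simp
  then have "mdot w \<alpha>' < mdot w \<alpha> + 1" by (simp only: mult_less_cancel1)
  then show ?thesis using \<alpha>'(1) by auto
qed

lemma face_fun_eq:
  assumes "c \<beta> \<noteq> 0" and "\<And>\<alpha>. c \<alpha> \<noteq> 0 \<Longrightarrow> mdot w \<beta> \<le> mdot w \<alpha>"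
  shows "face_fun w c \<alpha> = (if mdot w \<alpha> = mdot w \<beta> then c \<alpha> else 0)"
proof (cases "c \<alpha> = 0")
  case False
  then show ?thesis
    using realvec_in_Gamma_plus[of c \<alpha>] d_weight_eqI[of c \<beta> w, OF assms(1)] assms(2)
    by (simp add: face_fun_def Delta_face_def wdot_realvec)
qed (simp add: face_fun_def)

section \<open>Derivatives of polynomial families\<close>

text \<open>A t-independent index set for all sums: an exponent is listed even if its coefficient
  vanishes at particular parameters.\<close>

definition expo :: "(nat \<times> (nat^'n) \<Rightarrow> complex) \<Rightarrow> (nat^'n) set" where
  "expo P = snd ` {m. P m \<noteq> 0}"

definition dzcoeff :: "(nat \<times> (nat^'n) \<Rightarrow> complex) \<Rightarrow> complex \<Rightarrow> nat^'n \<Rightarrow> complex" where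
  "dzcoeff P t \<alpha> = (\<Sum>j\<in>{j. P (j,\<alpha>) \<noteq> 0}. P (j,\<alpha>) * (of_nat j * t ^ (j - 1)))"

definition fderiv_t :: "(nat \<times> (nat^'n) \<Rightarrow> complex) \<Rightarrow> complex \<Rightarrow> complex^'n \<Rightarrow> complex" where
  "fderiv_t P t z = (\<Sum>\<alpha>\<in>expo P. dzcoeff P t \<alpha> * monom \<alpha> z)"

definition fderiv_z :: "(nat \<times> (nat^'n) \<Rightarrow> complex) \<Rightarrow> complex \<Rightarrow> complex^'n \<Rightarrow> 'n \<Rightarrow> complex" where
  "fderiv_z P t z i = pderiv_at (zcoeff P t) i z"

definition fderiv :: "(nat \<times> (nat^'n) \<Rightarrow> complex) \<Rightarrow> 'n amb \<Rightarrow> 'n amb \<Rightarrow> complex" where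
  "fderiv P p h = fderiv_t P (fst p) (snd p) * fst h + (\<Sum>i\<in>UNIV. fderiv_z P (fst p) (snd p) i * snd h $ i)"

lemma finite_expo: "finite_support P \<Longrightarrow> finite (expo P)"
  by (simp add: expo_def finite_support_def)

lemma finite_expo_fibre:
  assumes "finite_support P" shows "finite {j. P (j,\<alpha>) \<noteq> 0}"
  by (rule finite_subset[OF _ finite_imageI[OF assms[unfolded finite_support_def], of fst]]) force

lemma zcoeff_notin_expo: "\<alpha> \<notin> expo P \<Longrightarrow> zcoeff P t \<alpha> = 0"
  by (force simp: expo_def zcoeff_def intro: sum.neutral)

lemma zcoeff_support: "{\<alpha>. zcoeff P t \<alpha> \<noteq> 0} \<subseteq> expo P"
  using zcoeff_notin_expo by blast

lemma finite_zcoeff_support: "finite_support P \<Longrightarrow> finite {\<alpha>. zcoeff P t \<alpha> \<noteq> 0}"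
  using finite_subset[OF zcoeff_support finite_expo] .

lemma peval_superset:
  assumes "finite A" "{\<alpha>. c \<alpha> \<noteq> 0} \<subseteq> A"
  shows "peval c z = (\<Sum>\<alpha>\<in>A. c \<alpha> * monom \<alpha> z)"
  unfolding peval_def by (rule sum.mono_neutral_left) (use assms in auto)

lemma feval_eq_sum:
  assumes "finite_support P"
  shows "feval P t z = (\<Sum>\<alpha>\<in>expo P. zcoeff P t \<alpha> * monom \<alpha> z)"
proof -
  have "{m. P m \<noteq> 0} = (\<lambda>(\<alpha>,j). (j,\<alpha>)) ` (SIGMA \<alpha>:expo P. {j. P (j,\<alpha>) \<noteq> 0})"
    by (force simp: expo_def)
  then have "feval P t z = (\<Sum>x\<in>(SIGMA \<alpha>:expo P. {j. P (j,\<alpha>) \<noteq> 0}). P (snd x, fst x) * t ^ snd x * monom (fst x) z)"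
    unfolding feval_def by (subst sum.reindex_cong[of "\<lambda>(\<alpha>,j). (j,\<alpha>)"]) (auto simp: inj_on_def split_beta)
  also have "\<dots> = (\<Sum>\<alpha>\<in>expo P. \<Sum>j\<in>{j. P (j,\<alpha>) \<noteq> 0}. P (j,\<alpha>) * t ^ j * monom \<alpha> z)"
    by (subst sum.Sigma) (use assms finite_expo finite_expo_fibre in \<open>auto simp: split_beta\<close>)
  finally show ?thesis by (simp add: zcoeff_def sum_distrib_right)
qed

lemma feval_eq_peval: "finite_support P \<Longrightarrow> feval P t z = peval (zcoeff P t) z"
  using feval_eq_sum peval_superset[OF finite_expo zcoeff_support] by metis

text \<open>When \<open>\<alpha>$i = 0\<close> the truncated exponent is harmless, because the
  leading factor is then zero.\<close>

definition monom_deriv :: "nat^'n \<Rightarrow> 'n \<Rightarrow> complex^'n \<Rightarrow> complex" where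
  "monom_deriv \<alpha> i z = of_nat (\<alpha>$i) * (\<Prod>j\<in>UNIV. (z$j) ^ (if j = i then \<alpha>$j - 1 else \<alpha>$j))"

text \<open>Multiplication by the coordinate restores the lowered exponent. Logarithmic derivatives
  are thus combinations of the original monomials and can be compared with the same dominating
  monomial as the function.\<close>

lemma monom_deriv_mult: "z$i * monom_deriv \<alpha> i z = of_nat (\<alpha>$i) * monom \<alpha> z"
proof (cases "\<alpha>$i = 0")
  case False
  have "z$i * (\<Prod>j\<in>UNIV. (z$j) ^ (if j = i then \<alpha>$j - 1 else \<alpha>$j)) =
     (z$i * (z$i) ^ (\<alpha>$i - 1)) * (\<Prod>j\<in>UNIV - {i}. (z$j) ^ (\<alpha>$j))"
    by (subst prod.remove[of UNIV i]) (auto intro!: prod.cong)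
  also have "z$i * (z$i) ^ (\<alpha>$i - 1) = (z$i)^(\<alpha>$i)" using False by (simp add: power_eq_if)
  also have "(z$i)^(\<alpha>$i) * (\<Prod>j\<in>UNIV - {i}. (z$j) ^ (\<alpha>$j)) = monom \<alpha> z"
    unfolding monom_def by (rule prod.remove[symmetric]) auto
  finally show ?thesis by (simp add: monom_deriv_def algebra_simps)
qed (simp add: monom_deriv_def)

lemma has_derivative_monom:
  "((\<lambda>p. monom \<alpha> (snd p)) has_derivative (\<lambda>h. \<Sum>i\<in>UNIV. monom_deriv \<alpha> i (snd p) * snd h $ i))
    (at (p :: 'n::finite amb))"
proof -
  have "((\<lambda>p. \<Prod>i\<in>UNIV. (snd p $ i) ^ (\<alpha>$i)) has_derivative
     (\<lambda>h. \<Sum>i\<in>UNIV. (of_nat (\<alpha>$i) * (snd h $ i) * (snd p $ i) ^ (\<alpha>$i - 1)) * (\<Prod>j\<in>UNIV - {i}. (snd p $ j) ^ (\<alpha>$j)))) (at p)"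
    by (rule has_derivative_prod)
       (intro has_derivative_power bounded_linear_imp_has_derivative
          bounded_linear_compose[OF bounded_linear_vec_nth bounded_linear_snd])
  moreover have "(of_nat (\<alpha>$i) * (snd h $ i) * (snd p $ i) ^ (\<alpha>$i - 1)) * (\<Prod>j\<in>UNIV - {i}. (snd p $ j) ^ (\<alpha>$j))
      = monom_deriv \<alpha> i (snd p) * snd h $ i" for i and h :: "'n amb"
  proof -
    have "(\<Prod>j\<in>UNIV. (snd p$j) ^ (if j = i then \<alpha>$j - 1 else \<alpha>$j)) =
      (snd p$i) ^ (\<alpha>$i - 1) * (\<Prod>j\<in>UNIV - {i}. (snd p$j) ^ (\<alpha>$j))"
      by (subst prod.remove[of UNIV i]) (auto intro!: prod.cong)
    then show ?thesis by (simp add: monom_deriv_def)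
  qed
  ultimately show ?thesis by (simp only: monom_def)
qed

lemma pderiv_at_superset:
  assumes "finite A" "{\<alpha>. c \<alpha> \<noteq> 0} \<subseteq> A"
  shows "pderiv_at c i z = (\<Sum>\<alpha>\<in>A. c \<alpha> * monom_deriv \<alpha> i z)"
  unfolding pderiv_at_def monom_deriv_def mult.assoc by (rule sum.mono_neutral_left) (use assms in auto)

lemma pderiv_at_euler:
  assumes "finite A" "{\<alpha>. c \<alpha> \<noteq> 0} \<subseteq> A"
  shows "z$i * pderiv_at c i z = (\<Sum>\<alpha>\<in>A. c \<alpha> * of_nat (\<alpha>$i) * monom \<alpha> z)"
  unfolding pderiv_at_superset[OF assms] sum_distrib_left
proof (rule sum.cong)
  fix \<alpha>
  have "z $ i * (c \<alpha> * monom_deriv \<alpha> i z) = c \<alpha> * (z $ i * monom_deriv \<alpha> i z)" by simp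
  then show "z $ i * (c \<alpha> * monom_deriv \<alpha> i z) = c \<alpha> * of_nat (\<alpha> $ i) * monom \<alpha> z"
    by (simp add: monom_deriv_mult)
qed simp

lemma fderiv_z_eq:
  "finite_support P \<Longrightarrow> fderiv_z P t z i = (\<Sum>\<alpha>\<in>expo P. zcoeff P t \<alpha> * monom_deriv \<alpha> i z)"
  unfolding fderiv_z_def by (rule pderiv_at_superset[OF finite_expo zcoeff_support])

lemma fderiv_z_euler:
  "finite_support P \<Longrightarrow> z$i * fderiv_z P t z i = (\<Sum>\<alpha>\<in>expo P. zcoeff P t \<alpha> * of_nat (\<alpha>$i) * monom \<alpha> z)"
  unfolding fderiv_z_def by (rule pderiv_at_euler[OF finite_expo zcoeff_support])

lemma zcoeff_has_derivative:
  "((\<lambda>p. zcoeff P (fst p) \<alpha>) has_derivative (\<lambda>h. dzcoeff P (fst p) \<alpha> * fst h)) (at (p :: 'n::finite amb))"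
proof -
  have "((\<lambda>p. P (j,\<alpha>) * fst p ^ j) has_derivative (\<lambda>h. P (j,\<alpha>) * (of_nat j * fst h * fst p ^ (j-1)))) (at p)" for j
    by (intro has_derivative_mult_right has_derivative_power bounded_linear_imp_has_derivative bounded_linear_fst)
  then have "((\<lambda>p. zcoeff P (fst p) \<alpha>) has_derivative (\<lambda>h. \<Sum>j\<in>{j. P (j,\<alpha>) \<noteq> 0}. P (j,\<alpha>) * (of_nat j * fst h * fst p ^ (j-1)))) (at p)"
    unfolding zcoeff_def by (rule has_derivative_sum)
  moreover have "(\<Sum>j\<in>{j. P (j,\<alpha>) \<noteq> 0}. P (j,\<alpha>) * (of_nat j * fst h * fst p ^ (j-1))) = dzcoeff P (fst p) \<alpha> * fst h"
    for h :: "'n amb"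
    unfolding dzcoeff_def sum_distrib_right by (rule sum.cong) (simp_all add: mult_ac)
  ultimately show ?thesis by (simp only:)
qed

lemma feval_has_derivative:
  assumes "finite_support P"
  shows "((\<lambda>p. feval P (fst p) (snd p)) has_derivative fderiv P p) (at p)"
proof -
  have "((\<lambda>p. zcoeff P (fst p) \<alpha> * monom \<alpha> (snd p)) has_derivative
     (\<lambda>h. zcoeff P (fst p) \<alpha> * (\<Sum>i\<in>UNIV. monom_deriv \<alpha> i (snd p) * snd h $ i) + dzcoeff P (fst p) \<alpha> * fst h * monom \<alpha> (snd p))) (at p)" for \<alpha>
    by (intro has_derivative_mult zcoeff_has_derivative has_derivative_monom)
  then have "((\<lambda>p. feval P (fst p) (snd p)) has_derivative
     (\<lambda>h. \<Sum>\<alpha>\<in>expo P. zcoeff P (fst p) \<alpha> * (\<Sum>i\<in>UNIV. monom_deriv \<alpha> i (snd p) * snd h $ i) + dzcoeff P (fst p) \<alpha> * fst h * monom \<alpha> (snd p))) (at p)"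
    unfolding feval_eq_sum[OF assms] by (rule has_derivative_sum)
  moreover have "(\<Sum>\<alpha>\<in>expo P. zcoeff P (fst p) \<alpha> * (\<Sum>i\<in>UNIV. monom_deriv \<alpha> i (snd p) * snd h $ i) + dzcoeff P (fst p) \<alpha> * fst h * monom \<alpha> (snd p))
     = fderiv P p h" for h
  proof -
    have "(\<Sum>\<alpha>\<in>expo P. zcoeff P (fst p) \<alpha> * (\<Sum>i\<in>UNIV. monom_deriv \<alpha> i (snd p) * snd h $ i))
       = (\<Sum>\<alpha>\<in>expo P. \<Sum>i\<in>UNIV. zcoeff P (fst p) \<alpha> * monom_deriv \<alpha> i (snd p) * snd h $ i)"
      by (simp add: sum_distrib_left mult_ac)
    also have "\<dots> = (\<Sum>i\<in>UNIV. \<Sum>\<alpha>\<in>expo P. zcoeff P (fst p) \<alpha> * monom_deriv \<alpha> i (snd p) * snd h $ i)"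
      by (rule sum.swap)
    finally have 1: "(\<Sum>\<alpha>\<in>expo P. zcoeff P (fst p) \<alpha> * (\<Sum>i\<in>UNIV. monom_deriv \<alpha> i (snd p) * snd h $ i))
       = (\<Sum>i\<in>UNIV. fderiv_z P (fst p) (snd p) i * snd h $ i)"
      by (simp only: fderiv_z_eq[OF assms] sum_distrib_right)
    have 2: "(\<Sum>\<alpha>\<in>expo P. dzcoeff P (fst p) \<alpha> * fst h * monom \<alpha> (snd p)) = fderiv_t P (fst p) (snd p) * fst h"
      unfolding fderiv_t_def sum_distrib_right by (rule sum.cong) (simp_all add: mult_ac)
    show ?thesis unfolding fderiv_def sum.distrib 1 2 by simp
  qed
  ultimately show ?thesis by simp
qed

lemma tendsto_zcoeff: "(t \<longlongrightarrow> t0) F \<Longrightarrow> ((\<lambda>m. zcoeff P (t m) \<alpha>) \<longlongrightarrow> zcoeff P t0 \<alpha>) F"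
  unfolding zcoeff_def by (intro tendsto_intros)

lemma tendsto_dzcoeff: "(t \<longlongrightarrow> t0) F \<Longrightarrow> ((\<lambda>m. dzcoeff P (t m) \<alpha>) \<longlongrightarrow> dzcoeff P t0 \<alpha>) F"
  unfolding dzcoeff_def by (intro tendsto_intros)

lemma tendsto_monom_deriv: "(z \<longlongrightarrow> z0) F \<Longrightarrow> ((\<lambda>m. monom_deriv \<alpha> i (z m)) \<longlongrightarrow> monom_deriv \<alpha> i z0) F"
  unfolding monom_deriv_def by (intro tendsto_intros)

lemma tendsto_fderiv_t:
  "(t \<longlongrightarrow> t0) F \<Longrightarrow> (z \<longlongrightarrow> z0) F \<Longrightarrow> ((\<lambda>m. fderiv_t P (t m) (z m)) \<longlongrightarrow> fderiv_t P t0 z0) F"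
  unfolding fderiv_t_def by (intro tendsto_intros tendsto_dzcoeff tendsto_monom)

lemma tendsto_fderiv_z:
  "finite_support P \<Longrightarrow> (t \<longlongrightarrow> t0) F \<Longrightarrow> (z \<longlongrightarrow> z0) F \<Longrightarrow>
    ((\<lambda>m. fderiv_z P (t m) (z m) i) \<longlongrightarrow> fderiv_z P t0 z0 i) F"
  unfolding fderiv_z_eq by (intro tendsto_intros tendsto_zcoeff tendsto_monom_deriv)

lemma tendsto_fderiv:
  "finite_support P \<Longrightarrow> (p \<longlongrightarrow> p0) F \<Longrightarrow> (h \<longlongrightarrow> h0) F \<Longrightarrow> ((\<lambda>m. fderiv P (p m) (h m)) \<longlongrightarrow> fderiv P p0 h0) F"
  unfolding fderiv_def by (intro tendsto_intros tendsto_fderiv_t tendsto_fderiv_z)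

text \<open>The coefficient is a polynomial in t, and a nonzero one cannot vanish on a disc. Hence
  every exponent of \<open>P\<close> is alive at some parameter in any given disc about 0, from
  which information on Newton boundaries can be transported to other parameters.\<close>

lemma zcoeff_vanishing:
  assumes "finite_support P" "e > 0" "\<And>t. cmod t < e \<Longrightarrow> zcoeff P t \<alpha> = 0"
  shows "\<alpha> \<notin> expo P"
proof
  assume "\<alpha> \<in> expo P"
  then obtain j0 where j0: "P (j0,\<alpha>) \<noteq> 0" by (auto simp: expo_def)
  obtain n where n: "\<And>j. P (j,\<alpha>) \<noteq> 0 \<Longrightarrow> j \<le> n"
    using finite_expo_fibre[OF assms(1), of \<alpha>] by (auto simp: finite_nat_set_iff_bounded_le)
  have z: "zcoeff P t \<alpha> = (\<Sum>j\<le>n. P (j,\<alpha>) * t ^ j)" for t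
    unfolding zcoeff_def by (rule sum.mono_neutral_left) (use n in auto)
  have "finite {t. (\<Sum>j\<le>n. P (j,\<alpha>) * t ^ j) = 0}"
    using polyfun_finite_roots[of "\<lambda>j. P (j,\<alpha>)" n] j0 n by auto
  moreover have "ball 0 e \<subseteq> {t. (\<Sum>j\<le>n. P (j,\<alpha>) * t ^ j) = 0}"
    using assms(3) z by (auto simp: dist_norm)
  ultimately have "finite (ball (0::complex) e)" using finite_subset by blast
  then show False using uncountable_ball[OF assms(2), of "0::complex"] countable_finite by blast
qed

section \<open>Leading terms along sequences\<close>

text \<open>Linear independence is an open condition, with a lower bound uniform in the multipliers.
  A failure would yield multipliers of total modulus 1 along a sequence of indices, and a limit of
  these would be a nontrivial relation among the limit rows \<open>V\<close>.\<close>

lemma uniform_independence: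
  fixes V :: "'k \<Rightarrow> 'i \<Rightarrow> complex" and Vm :: "nat \<Rightarrow> 'k \<Rightarrow> 'i \<Rightarrow> complex"
  assumes fin: "finite K" "finite S"
    and lim: "\<And>k i. k \<in> K \<Longrightarrow> i \<in> S \<Longrightarrow> (\<lambda>m. Vm m k i) \<longlonglongrightarrow> V k i"
    and indep: "\<And>a. (\<forall>i\<in>S. (\<Sum>k\<in>K. a k * V k i) = 0) \<Longrightarrow> \<forall>k\<in>K. a k = 0"
  shows "\<exists>c>0. \<forall>\<^sub>F m in sequentially. \<forall>a. c * (\<Sum>k\<in>K. cmod (a k)) \<le> (\<Sum>i\<in>S. cmod (\<Sum>k\<in>K. a k * Vm m k i))"
proof (rule ccontr)
  define L where "L m a = (\<Sum>i\<in>S. cmod (\<Sum>k\<in>K. a k * Vm m k i))" for m a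
  define s where "s a = (\<Sum>k\<in>K. cmod (a k))" for a :: "'k \<Rightarrow> complex"
  assume "\<not> ?thesis"
  then have neg: "\<not> (\<exists>c>0. \<forall>\<^sub>F m in sequentially. \<forall>a. c * s a \<le> L m a)"
    unfolding L_def s_def .
  have "\<exists>m a. n \<le> m \<and> L m a < inverse (real (Suc n)) * s a" for n
  proof -
    have "inverse (real (Suc n)) > 0" by simp
    then have "\<not> (\<forall>\<^sub>F m in sequentially. \<forall>a. inverse (real (Suc n)) * s a \<le> L m a)"
      using neg by blast
    then have "\<exists>m\<ge>n. \<exists>a. \<not> inverse (real (Suc n)) * s a \<le> L m a"
      unfolding eventually_sequentially by blast
    then show ?thesis by (auto simp only: not_le)
  qed
  then obtain M a where M: "\<And>n. n \<le> M n" and aL: "\<And>n. L (M n) (a n) < inverse (real (Suc n)) * s (a n)"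
    by metis
  note a = aL[unfolded L_def s_def]
  define \<sigma> where "\<sigma> n = (\<Sum>k\<in>K. cmod (a n k))" for n
  have \<sigma>: "\<sigma> n > 0" for n
  proof -
    have "0 \<le> (\<Sum>i\<in>S. cmod (\<Sum>k\<in>K. a n k * Vm (M n) k i))" by (simp add: sum_nonneg)
    then have "0 < inverse (real (Suc n)) * \<sigma> n" using a[of n] unfolding \<sigma>_def by linarith
    then show ?thesis by (simp add: zero_less_mult_iff)
  qed
  define b where "b n k = a n k / of_real (\<sigma> n)" for n k
  have b1: "(\<Sum>k\<in>K. cmod (b n k)) = 1" for n
  proof -
    have "(\<Sum>k\<in>K. cmod (b n k)) = (\<Sum>k\<in>K. cmod (a n k)) / \<sigma> n"
      using \<sigma>[of n] by (simp add: b_def norm_divide sum_divide_distrib[symmetric])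
    then show ?thesis using \<sigma>[of n] by (simp flip: \<sigma>_def)
  qed
  have bb: "(\<Sum>i\<in>S. cmod (\<Sum>k\<in>K. b n k * Vm (M n) k i)) < inverse (real (Suc n))" for n
  proof -
    have "(\<Sum>i\<in>S. cmod (\<Sum>k\<in>K. b n k * Vm (M n) k i)) = (\<Sum>i\<in>S. cmod (\<Sum>k\<in>K. a n k * Vm (M n) k i)) / \<sigma> n"
      using \<sigma>[of n] by (simp add: b_def sum_divide_distrib[symmetric] norm_divide)
    also have "\<dots> < inverse (real (Suc n))"
      using a[of n] \<sigma>[of n] by (simp add: \<sigma>_def divide_less_eq)
    finally show ?thesis .
  qed
  have "\<exists>r::nat\<Rightarrow>nat. strict_mono r \<and> (\<forall>k\<in>K. \<exists>l\<in>cball 0 1. (\<lambda>n. b (r n) k) \<longlonglongrightarrow> l)"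
  proof (rule finite_family_convergent_subseq[OF fin(1)])
    show "seq_compact (cball (0::complex) 1)" by (simp add: compact_imp_seq_compact)
    show "b n k \<in> cball 0 1" if "k \<in> K" for k n
      using member_le_sum[of k K "\<lambda>k. cmod (b n k)"] that fin b1[of n] by simp
  qed
  then obtain r where r: "strict_mono r" and "\<forall>k\<in>K. \<exists>l\<in>cball 0 1. (\<lambda>n. b (r n) k) \<longlonglongrightarrow> l" by blast
  then obtain l where l: "\<And>k. k \<in> K \<Longrightarrow> (\<lambda>n. b (r n) k) \<longlonglongrightarrow> l k" by metis
  have Mr: "filterlim (\<lambda>n. M (r n)) at_top sequentially"
    unfolding filterlim_at_top
    by (metis (mono_tags, lifting) M eventually_sequentiallyI le_trans r seq_suble)
  have "(\<lambda>n. Vm (M (r n)) k i) \<longlonglongrightarrow> V k i" if "k \<in> K" "i \<in> S" for k i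
    using filterlim_compose[OF lim[OF that] Mr] .
  then have L: "(\<lambda>n. \<Sum>i\<in>S. cmod (\<Sum>k\<in>K. b (r n) k * Vm (M (r n)) k i)) \<longlonglongrightarrow> (\<Sum>i\<in>S. cmod (\<Sum>k\<in>K. l k * V k i))"
    by (intro tendsto_sum tendsto_norm tendsto_mult l)
  have "(\<lambda>n. inverse (real (Suc (r n)))) \<longlonglongrightarrow> 0"
    using LIMSEQ_subseq_LIMSEQ[OF LIMSEQ_inverse_real_of_nat r] by (simp add: o_def)
  then have "(\<Sum>i\<in>S. cmod (\<Sum>k\<in>K. l k * V k i)) \<le> 0"
    by (rule LIMSEQ_le[OF L]) (use bb less_imp_le in blast)
  then have "\<forall>i\<in>S. (\<Sum>k\<in>K. l k * V k i) = 0"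
    using fin(2) by (metis (no_types, lifting) norm_ge_zero norm_zero order_antisym sum_nonneg sum_nonneg_eq_0_iff norm_eq_zero)
  then have "\<forall>k\<in>K. l k = 0" by (rule indep)
  moreover have "(\<lambda>n. \<Sum>k\<in>K. cmod (b (r n) k)) \<longlonglongrightarrow> (\<Sum>k\<in>K. cmod (l k))"
    by (intro tendsto_sum tendsto_norm l)
  then have "(\<Sum>k\<in>K. cmod (l k)) = 1" by (simp add: b1 LIMSEQ_const_iff)
  ultimately show False by simp
qed

lemma not_eventually_nhds_sequence:
  fixes x :: "'a::first_countable_topology"
  assumes "\<not> eventually P (nhds x)"
  obtains f where "f \<longlonglongrightarrow> x" "\<And>n::nat. \<not> P (f n)"
proof -
  have "\<exists>f. (\<forall>n::nat. \<not> P (f n)) \<and> f \<longlonglongrightarrow> x"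
  proof (rule ccontr)
    assume "\<not> ?thesis"
    then have "eventually P (inf (nhds x) (principal {x. \<not> P x}))"
      by (intro sequentially_imp_eventually_nhds_within) blast
    then have "eventually (\<lambda>x. \<not> P x \<longrightarrow> P x) (nhds x)" by (simp add: eventually_inf_principal)
    then show False using assms by (auto elim: eventually_mono)
  qed
  then show thesis using that by blast
qed

lemma fderiv_bounded_linear: "finite_support P \<Longrightarrow> bounded_linear (fderiv P p)"
  using feval_has_derivative has_derivative_bounded_linear by blast

definition fderivL :: "(nat \<times> (nat^'n) \<Rightarrow> complex) \<Rightarrow> 'n::finite amb \<Rightarrow> 'n amb \<Rightarrow>\<^sub>L complex" where
  "fderivL P p = Blinfun (fderiv P p)"

lemma fderivL_apply: "finite_support P \<Longrightarrow> blinfun_apply (fderivL P p) = fderiv P p"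
  by (simp add: fderivL_def bounded_linear_Blinfun_apply fderiv_bounded_linear)

lemma continuous_fderivL: "finite_support P \<Longrightarrow> continuous_on UNIV (fderivL P)"
  by (intro continuous_on_blinfun_componentwise)
     (auto simp: fderivL_apply continuous_on_def intro!: tendsto_fderiv)

text \<open>A C1 function is strictly differentiable: by the mean value inequality the derivative
  near \<open>p\<close> predicts the difference of values at any two nearby points, and here that
  difference is zero.\<close>

lemma feval_strict_derivative:
  fixes p :: "'n::finite amb"
  assumes fs: "finite_support P" and x: "x \<longlonglongrightarrow> p" and y: "y \<longlonglongrightarrow> p"
    and fx: "\<And>m. feval P (fst (x m)) (snd (x m)) = 0" and fy: "\<And>m. feval P (fst (y m)) (snd (y m)) = 0"
  shows "(\<lambda>m. fderiv P (x m) (x m - y m) / norm (x m - y m)) \<longlonglongrightarrow> 0"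
proof (rule LIMSEQ_I)
  fix e :: real assume e: "e > 0"
  have "isCont (fderivL P) p"
    using continuous_fderivL[OF fs] continuous_on_eq_continuous_at[OF open_UNIV] by blast
  then obtain d where d: "d > 0" "\<And>q. dist q p < d \<Longrightarrow> dist (fderivL P q) (fderivL P p) < e/3"
    unfolding continuous_at_eps_delta using e by (metis divide_pos_pos zero_less_numeral)
  have "\<forall>\<^sub>F m in sequentially. dist (x m) p < d \<and> dist (y m) p < d"
    using tendstoD[OF x d(1)] tendstoD[OF y d(1)] by (rule eventually_conj)
  moreover have "norm (fderiv P (x m) (x m - y m) / norm (x m - y m) - 0) < e"
    if "dist (x m) p < d \<and> dist (y m) p < d" for m
  proof -
    let ?h = "x m - y m"
    have "norm ((feval P (fst (x m)) (snd (x m)) - feval P (fst (y m)) (snd (y m))) - fderiv P p (x m - y m)) \<le> norm (x m - y m) * (e/3)"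
    proof (rule differentiable_bound_linearization[of _ _ "ball p d" "\<lambda>p. feval P (fst p) (snd p)" "\<lambda>p. fderiv P p"])
      fix s :: real assume "s \<in> {0..1}"
      then have "(1 - s) *\<^sub>R y m + s *\<^sub>R x m \<in> ball p d"
        using that by (intro convexD_alt[OF convex_ball]) (auto simp: dist_commute)
      then show "y m + s *\<^sub>R (x m - y m) \<in> ball p d" by (simp add: algebra_simps)
    next
      fix q assume "q \<in> ball p d"
      then have "dist q p < d" by (simp add: dist_commute)
      then have "norm (fderivL P q - fderivL P p) < e/3" using d(2)[of q] by (simp only: dist_norm)
      then have "onorm (blinfun_apply (fderivL P q - fderivL P p)) \<le> e/3" by (simp add: norm_blinfun.rep_eq)
      moreover have "blinfun_apply (fderivL P q - fderivL P p) = fderiv P q - fderiv P p"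
        by (rule ext) (simp add: fderivL_apply[OF fs] blinfun.diff_left)
      ultimately show "onorm (fderiv P q - fderiv P p) \<le> e/3" by simp
    qed (use d(1) feval_has_derivative[OF fs] in \<open>auto intro: has_derivative_at_withinI\<close>)
    then have 1: "norm (fderiv P p ?h) \<le> norm ?h * (e/3)" by (simp add: fx fy)
    have "norm (fderiv P (x m) ?h - fderiv P p ?h) = norm ((fderivL P (x m) - fderivL P p) ?h)"
      by (simp add: fderivL_apply[OF fs] blinfun.diff_left)
    also have "\<dots> \<le> norm (fderivL P (x m) - fderivL P p) * norm ?h" by (rule norm_blinfun)
    also have "\<dots> \<le> (e/3) * norm ?h"
      using d(2)[of "x m"] that by (intro mult_right_mono) (auto simp: dist_norm)
    finally have "norm (fderiv P (x m) ?h) \<le> norm ?h * (2 * e/3)"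
      using 1 norm_triangle_ineq2[of "fderiv P (x m) ?h" "fderiv P p ?h"] by (simp add: algebra_simps)
    \<comment> \<open>Coinciding points are covered by the convention that division by zero gives
      0.\<close>
    then have "norm (fderiv P (x m) ?h) / norm ?h \<le> 2 * e/3"
      by (cases "norm ?h = 0") (use e in \<open>auto simp: divide_le_eq mult.commute\<close>)
    also have "\<dots> < e" using e by simp
    finally show ?thesis by (simp add: norm_divide)
  qed
  ultimately show "\<exists>no. \<forall>m\<ge>no. norm (fderiv P (x m) (x m - y m) / norm (x m - y m) - 0) < e"
    unfolding eventually_sequentially by blast
qed

text \<open>The coefficients are arbitrary convergent sequences, so that one statement yields the
  limits of values, of logarithmic derivatives and of t-derivatives.\<close>

lemma face_limit:
  assumes "finite A" "\<And>\<alpha>. \<alpha> \<in> A \<Longrightarrow> mdot w \<beta> \<le> mdot w \<alpha>"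
    and eq: "\<And>\<alpha>. \<alpha> \<in> A \<Longrightarrow> mdot w \<alpha> = mdot w \<beta> \<Longrightarrow> (\<lambda>m. monom \<alpha> (z m) / monom \<beta> (z m)) \<longlonglongrightarrow> monom \<alpha> a / monom \<beta> a"
    and gt: "\<And>\<alpha>. \<alpha> \<in> A \<Longrightarrow> mdot w \<beta> < mdot w \<alpha> \<Longrightarrow> (\<lambda>m. monom \<alpha> (z m) / monom \<beta> (z m)) \<longlonglongrightarrow> 0"
    and C: "\<And>\<alpha>. \<alpha> \<in> A \<Longrightarrow> (\<lambda>m. C m \<alpha>) \<longlonglongrightarrow> C0 \<alpha>"
  shows "(\<lambda>m. (\<Sum>\<alpha>\<in>A. C m \<alpha> * monom \<alpha> (z m)) / monom \<beta> (z m)) \<longlonglongrightarrow>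
    (\<Sum>\<alpha>\<in>A. (if mdot w \<alpha> = mdot w \<beta> then C0 \<alpha> else 0) * monom \<alpha> a) / monom \<beta> a"
  unfolding sum_divide_distrib
proof (rule tendsto_sum)
  fix \<alpha> assume \<alpha>: "\<alpha> \<in> A"
  have "(\<lambda>m. C m \<alpha> * (monom \<alpha> (z m) / monom \<beta> (z m))) \<longlonglongrightarrow> (if mdot w \<alpha> = mdot w \<beta> then C0 \<alpha> * (monom \<alpha> a / monom \<beta> a) else C0 \<alpha> * 0)"
    using assms(2)[OF \<alpha>] tendsto_mult[OF C[OF \<alpha>] eq[OF \<alpha>]] tendsto_mult[OF C[OF \<alpha>] gt[OF \<alpha>]] by auto
  then show "(\<lambda>m. C m \<alpha> * monom \<alpha> (z m) / monom \<beta> (z m)) \<longlonglongrightarrow>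
      (if mdot w \<alpha> = mdot w \<beta> then C0 \<alpha> else 0) * monom \<alpha> a / monom \<beta> a"
    by (auto split: if_splits)
qed

lemma face_fun_support: "{\<alpha>. face_fun w (zcoeff P t) \<alpha> \<noteq> 0} \<subseteq> expo P"
  using zcoeff_notin_expo by (auto simp: face_fun_def split: if_splits)

text \<open>Each monomial of the face contributes its weight as a factor, and these weights all
  equal \<open>d\<close>. At a zero of the face function the weighted sum of logarithmic derivatives
  therefore vanishes.\<close>

lemma face_fun_euler:
  assumes fs: "finite_support P" and G: "\<And>\<alpha>. face_fun w (zcoeff P t) \<alpha> \<noteq> 0 \<Longrightarrow> mdot w \<alpha> = d"
  shows "(\<Sum>i\<in>UNIV. of_nat (w$i) * (a$i * pderiv_at (face_fun w (zcoeff P t)) i a)) = of_nat d * peval (face_fun w (zcoeff P t)) a"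
proof -
  let ?G = "face_fun w (zcoeff P t)"
  have "(\<Sum>i\<in>UNIV. of_nat (w$i) * (a$i * pderiv_at ?G i a)) = (\<Sum>i\<in>UNIV. \<Sum>\<alpha>\<in>expo P. of_nat (w$i) * (?G \<alpha> * of_nat (\<alpha>$i) * monom \<alpha> a))"
    by (simp only: pderiv_at_euler[OF finite_expo[OF fs] face_fun_support] sum_distrib_left)
  also have "\<dots> = (\<Sum>\<alpha>\<in>expo P. \<Sum>i\<in>UNIV. of_nat (w$i) * (?G \<alpha> * of_nat (\<alpha>$i) * monom \<alpha> a))"
    by (rule sum.swap)
  also have "\<dots> = (\<Sum>\<alpha>\<in>expo P. of_nat d * (?G \<alpha> * monom \<alpha> a))"
  proof (rule sum.cong)
    fix \<alpha>
    have "(\<Sum>i\<in>UNIV. of_nat (w$i) * (?G \<alpha> * of_nat (\<alpha>$i) * monom \<alpha> a)) = of_nat (mdot w \<alpha>) * (?G \<alpha> * monom \<alpha> a)"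
      unfolding mdot_def of_nat_sum of_nat_mult sum_distrib_right by (rule sum.cong) (simp_all add: mult_ac)
    then show "(\<Sum>i\<in>UNIV. of_nat (w$i) * (?G \<alpha> * of_nat (\<alpha>$i) * monom \<alpha> a)) = of_nat d * (?G \<alpha> * monom \<alpha> a)"
      using G[of \<alpha>] by (cases "?G \<alpha> = 0") auto
  qed simp
  finally show ?thesis by (simp add: peval_superset[OF finite_expo[OF fs] face_fun_support] sum_distrib_left)
qed

section \<open>Restriction to coordinate subspaces and the working hypotheses\<close>

definition meets :: "(nat \<times> (nat^'n) \<Rightarrow> complex) \<Rightarrow> 'n set \<Rightarrow> bool" where
  "meets P I \<longleftrightarrow> (\<exists>\<alpha>\<in>expo P. \<forall>i. \<alpha>$i \<noteq> 0 \<longrightarrow> i \<in> I)"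

text \<open>Every monomial contains a variable outside \<open>I\<close>. So \<open>meets\<close>
  separates the functions that vanish identically on the coordinate subspace, for all t at once,
  from the others.\<close>

lemma not_meets_feval:
  assumes "finite_support P" "\<not> meets P I" "\<And>i. i \<notin> I \<Longrightarrow> z$i = 0"
  shows "feval P t z = 0"
  unfolding feval_eq_sum[OF assms(1)]
proof (rule sum.neutral, rule ballI)
  fix \<alpha> assume "\<alpha> \<in> expo P"
  then have "monom \<alpha> z = 0" using assms(2,3) unfolding meets_def by (metis monom_nonzero_iff)
  then show "zcoeff P t \<alpha> * monom \<alpha> z = 0" by simp
qed

lemma not_meets_V_set:
  "finite_support P \<Longrightarrow> \<not> meets P I \<Longrightarrow> I \<in> V_set (zcoeff P t)"
  unfolding V_set_def mem_Collect_eq using not_meets_feval[of P I _ t] by (simp add: feval_eq_peval)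

text \<open>Constancy of the Newton boundaries is kept in the form \<open>min_weight\<close>, which
  speaks of arbitrary weights and of all exponents of the family, not only of those alive at one
  parameter.\<close>

locale admissible_family =
  fixes k0 :: nat and F :: "nat \<Rightarrow> nat \<times> (nat^'n) \<Rightarrow> complex" and \<epsilon> R :: real
  assumes fs: "k \<in> {1..k0} \<Longrightarrow> finite_support (F k)"
    and \<epsilon>: "\<epsilon> > 0" and R: "R > 0"
    and nonempty: "k \<in> {1..k0} \<Longrightarrow> expo (F k) \<noteq> {}"
    and vanish0: "k \<in> {1..k0} \<Longrightarrow> feval (F k) t 0 = 0"
    and min_weight: "k \<in> {1..k0} \<Longrightarrow> cmod t < \<epsilon> \<Longrightarrow> \<alpha> \<in> expo (F k) \<Longrightarrow>
      \<exists>\<beta>. zcoeff (F k) t \<beta> \<noteq> 0 \<and> mdot w \<beta> \<le> mdot w \<alpha>"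
    and nondegenerate: "cmod t < \<epsilon> \<Longrightarrow> K \<subseteq> {1..k0} \<Longrightarrow> K \<noteq> {} \<Longrightarrow> nondegenerate_ci (\<lambda>k. zcoeff (F k) t) K"
    and tame: "cmod t < \<epsilon> \<Longrightarrow> K \<subseteq> {1..k0} \<Longrightarrow> K \<noteq> {} \<Longrightarrow> \<exists>R'>R. tameness_radius (\<lambda>k. zcoeff (F k) t) K R'"

lemma newton_admissible_imp_family:
  fixes F :: "nat \<Rightarrow> nat \<times> (nat^'n) \<Rightarrow> complex"
  assumes fs: "\<forall>k\<in>{1..k0}. finite_support (F k)"
    and nc: "\<forall>k\<in>{1..k0}. \<not> (\<exists>c. \<forall>t z. feval (F k) t z = c)"
    and z: "\<forall>k\<in>{1..k0}. \<forall>t. feval (F k) t 0 = 0"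
    and adm: "newton_admissible k0 F"
  obtains \<epsilon> R where "admissible_family k0 F \<epsilon> R"
proof -
  obtain R \<epsilon> where R: "R > 0" and e: "\<epsilon> > 0" and
    A: "\<And>t. cmod t < \<epsilon> \<Longrightarrow>
        (\<forall>k\<in>{1..k0}. newton_boundary (zcoeff (F k) t) = newton_boundary (zcoeff (F k) 0)) \<and>
        (\<forall>K. K \<subseteq> {1..k0} \<and> K \<noteq> {} \<longrightarrow>
            nondegenerate_ci (\<lambda>k. zcoeff (F k) t) K \<and>
            (\<exists>R'>R. tameness_radius (\<lambda>k. zcoeff (F k) t) K R'))"
    using adm unfolding newton_admissible_def by blast
  have "admissible_family k0 F \<epsilon> R"
  proof
    show "expo (F k) \<noteq> {}" if "k \<in> {1..k0}" for k
    proof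
      assume "expo (F k) = {}"
      then have "\<forall>t z. feval (F k) t z = 0" using feval_eq_sum[of "F k"] fs that by simp
      then show False using nc that by blast
    qed
    fix t assume t: "cmod t < \<epsilon>"
    show "nondegenerate_ci (\<lambda>k. zcoeff (F k) t) K" if "K \<subseteq> {1..k0}" "K \<noteq> {}" for K
      using A[OF t] that by blast
    show "\<exists>R'>R. tameness_radius (\<lambda>k. zcoeff (F k) t) K R'" if "K \<subseteq> {1..k0}" "K \<noteq> {}" for K
      using A[OF t] that by blast
    fix k \<alpha> and w :: "nat^'n" assume k: "k \<in> {1..k0}" and \<alpha>: "\<alpha> \<in> expo (F k)"
    \<comment> \<open>The exponent \<open>\<alpha>\<close> may be absent at \<open>t\<close>. It is
      present at some \<open>t'\<close>, and equality of the boundaries at \<open>t'\<close> and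
      \<open>t\<close> carries its weight bound over to \<open>t\<close>.\<close>
    obtain t' where t': "cmod t' < \<epsilon>" "zcoeff (F k) t' \<alpha> \<noteq> 0"
      using zcoeff_vanishing[OF _ e] fs k \<alpha> by blast
    have "newton_boundary (zcoeff (F k) t') \<subseteq> newton_boundary (zcoeff (F k) t)"
      using A[OF t] A[OF t'(1)] k by blast
    then show "\<exists>\<beta>. zcoeff (F k) t \<beta> \<noteq> 0 \<and> mdot w \<beta> \<le> mdot w \<alpha>"
      using newton_boundary_le_min_weight[OF _ finite_zcoeff_support t'(2)] fs k by blast
  qed (use fs R e z in blast)+
  then show thesis by (rule that)
qed

context admissible_family
begin

abbreviation face :: "nat^'n \<Rightarrow> complex \<Rightarrow> nat \<Rightarrow> nat^'n \<Rightarrow> complex" where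
  "face w t k \<equiv> face_fun w (zcoeff (F k) t)"

text \<open>The exponent \<open>\<beta>\<close> is minimal among all exponents of the family, and
  its own coefficient may vanish at \<open>t\<close>. By \<open>min_weight\<close> an exponent of
  the same weight is alive there, so the level of \<open>\<beta>\<close> still carries the minimal
  face.\<close>

lemma face_eq:
  assumes "k \<in> {1..k0}" "cmod t < \<epsilon>" "\<beta> \<in> expo (F k)" "\<And>\<alpha>. \<alpha> \<in> expo (F k) \<Longrightarrow> mdot w \<beta> \<le> mdot w \<alpha>"
  shows "face w t k \<alpha> = (if mdot w \<alpha> = mdot w \<beta> then zcoeff (F k) t \<alpha> else 0)"
proof -
  obtain \<gamma> where \<gamma>: "zcoeff (F k) t \<gamma> \<noteq> 0" "mdot w \<gamma> \<le> mdot w \<beta>"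
    using min_weight assms by blast
  have ex: "\<alpha> \<in> expo (F k)" if "zcoeff (F k) t \<alpha> \<noteq> 0" for \<alpha> using that zcoeff_notin_expo by blast
  have "mdot w \<gamma> = mdot w \<beta>" using \<gamma> ex assms(4) by (meson order_antisym)
  then show ?thesis using face_fun_eq[of "zcoeff (F k) t" \<gamma> w \<alpha>, OF \<gamma>(1)] ex assms(4) by auto
qed

text \<open>An empty \<open>J\<close> makes the weight positive, and non-degeneracy applies;
  otherwise this is tameness with the values of \<open>a\<close> on \<open>J\<close> as prescribed
  coordinates. The passage to logarithmic derivatives is harmless because no coordinate of
  \<open>a\<close> is zero.\<close>

lemma face_independent:
  assumes t: "cmod t < \<epsilon>" and K: "K \<subseteq> {1..k0}" and wJ: "I_w w = J" and a: "\<And>i. a$i \<noteq> 0"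
    and nm: "\<And>k. k \<in> K \<Longrightarrow> \<not> meets (F k) J" and zero: "\<And>k. k \<in> K \<Longrightarrow> peval (face w t k) a = 0"
    and aR: "(\<Sum>i\<in>J. (cmod (a$i))\<^sup>2) < R"
    and b: "\<forall>i\<in>-J. (\<Sum>k\<in>K. b k * (a$i * pderiv_at (face w t k) i a)) = 0"
  shows "\<forall>k\<in>K. b k = 0"
proof (cases "K = {}")
  case False
  have b': "\<forall>i\<in>-J. (\<Sum>k\<in>K. b k * pderiv_at (face w t k) i a) = 0"
  proof
    fix i assume "i \<in> -J"
    then have "a$i * (\<Sum>k\<in>K. b k * pderiv_at (face w t k) i a) = 0"
      using b by (simp add: sum_distrib_left mult_ac)
    then show "(\<Sum>k\<in>K. b k * pderiv_at (face w t k) i a) = 0" using a by simp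
  qed
  have aV: "a \<in> Vstar (face w t) K" using a zero by (simp add: Vstar_def)
  have "diffs_indep (face w t) K (-J) a"
  proof (cases "J = {}")
    case True
    then have "positive_weight w" using wJ by (auto simp: I_w_def positive_weight_def)
    then show ?thesis using nondegenerate[OF t K False] aV True by (auto simp: nondegenerate_ci_def)
  next
    case J: False
    obtain R' where R': "R' > R" "tameness_radius (\<lambda>k. zcoeff (F k) t) K R'" using tame[OF t K False] by blast
    \<comment> \<open>Tameness concerns nonzero weights. A zero weight would give
      \<open>J = UNIV\<close>, and a function that does not meet \<open>UNIV\<close> has no
      exponents at all.\<close>
    have "w \<noteq> 0"
    proof
      assume "w = 0"
      then have "J = UNIV" using wJ by (auto simp: I_w_def)
      moreover obtain k where "k \<in> K" using False by blast
      ultimately have "\<not> meets (F k) UNIV" using nm by blast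
      then show False using nonempty[of k] K \<open>k \<in> K\<close> by (auto simp: meets_def)
    qed
    moreover have "J \<in> V_set (zcoeff (F k) t)" if "k \<in> K" for k
      using not_meets_V_set fs nm that K by blast
    moreover have "(\<Sum>i\<in>J. (cmod (a$i))\<^sup>2) < R'" using aR R' by linarith
    ultimately show ?thesis using R'(2) J wJ a aV unfolding tameness_radius_def by blast
  qed
  then show ?thesis using b' by (auto simp: diffs_indep_def)
qed simp

text \<open>A constant term at any parameter would, by \<open>min_weight\<close> for the weight with
  all entries 1, force a nonzero constant term at t = 0, against vanishing at the origin. Over the
  parameter axis every function is thus governed by its face functions.\<close>

lemma not_meets_empty:
  assumes k: "k \<in> {1..k0}"
  shows "\<not> meets (F k) {}"
proof
  assume "meets (F k) {}"
  then obtain \<alpha> where \<alpha>: "\<alpha> \<in> expo (F k)" "\<forall>i. \<alpha>$i = 0" by (auto simp: meets_def)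
  then have "\<alpha> = 0" by (simp add: vec_eq_iff)
  then have in0: "0 \<in> expo (F k)" using \<alpha> by simp
  obtain \<gamma> where \<gamma>: "zcoeff (F k) 0 \<gamma> \<noteq> 0" "mdot (\<chi> i. 1) \<gamma> \<le> mdot (\<chi> i. 1) (0::nat^'n)"
  proof -
    have "cmod 0 < \<epsilon>" using \<epsilon> by simp
    from min_weight[OF k this in0, of "\<chi> i. 1"] show thesis using that by blast
  qed
  then have \<gamma>0: "\<gamma> = 0" by (auto simp: mdot_def vec_eq_iff)
  have "feval (F k) 0 0 = (\<Sum>\<alpha>\<in>expo (F k). if \<alpha> = 0 then zcoeff (F k) 0 0 else 0)"
    unfolding feval_eq_sum[OF fs[OF k]]
  proof (rule sum.cong)
    fix \<alpha> :: "nat^'n"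
    have "monom \<alpha> 0 = 0" if "\<alpha> \<noteq> 0" using that monom_nonzero_iff[of \<alpha> 0] by (auto simp: vec_eq_iff)
    then show "zcoeff (F k) 0 \<alpha> * monom \<alpha> 0 = (if \<alpha> = 0 then zcoeff (F k) 0 0 else 0)" by auto
  qed simp
  also have "\<dots> = zcoeff (F k) 0 0"
    using in0 finite_expo[OF fs[OF k]] by simp
  finally show False using vanish0[OF k, of 0] \<gamma>(1) \<gamma>0 by simp
qed

text \<open>The dominating exponent \<open>\<beta> k\<close> is minimal over all of
  \<open>expo (F k)\<close>, since values at nearby parameters and t-derivatives see exponents whose
  coefficient vanishes at \<open>t0\<close>. If some exponent is supported in \<open>I\<close>,
  those with other variables are heavier, so \<open>\<beta> k\<close> is supported in
  \<open>I\<close> and its monomial has no zero along the sequence.\<close>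

lemma sequence_data:
  assumes t: "t \<longlonglongrightarrow> t0" "cmod t0 < \<epsilon>" and z: "z \<longlonglongrightarrow> z0"
    and zI: "\<And>m i. z m $ i \<noteq> 0 \<longleftrightarrow> i \<in> I" and z0J: "\<And>i. z0$i \<noteq> 0 \<longleftrightarrow> i \<in> J"
  obtains r w a \<beta> where "strict_mono r" "\<And>i. a$i \<noteq> 0" "I_w w = J" "\<And>i. i \<in> J \<Longrightarrow> a$i = z0$i"
    "\<And>i j. i \<in> I \<Longrightarrow> j \<in> I \<Longrightarrow> w$j < w$i \<Longrightarrow> (\<lambda>m. z (r m) $ i / z (r m) $ j) \<longlonglongrightarrow> 0"
    "\<And>k m. k \<in> {1..k0} \<Longrightarrow> meets (F k) I \<Longrightarrow> monom (\<beta> k) (z m) \<noteq> 0"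
    "\<And>k. k \<in> {1..k0} \<Longrightarrow> meets (F k) I \<Longrightarrow> 
       (\<lambda>m. feval (F k) (t (r m)) (z (r m)) / monom (\<beta> k) (z (r m))) \<longlonglongrightarrow> peval (face w t0 k) a / monom (\<beta> k) a"
    "\<And>k i. k \<in> {1..k0} \<Longrightarrow> meets (F k) I \<Longrightarrow>
       (\<lambda>m. z (r m) $ i * fderiv_z (F k) (t (r m)) (z (r m)) i / monom (\<beta> k) (z (r m))) \<longlonglongrightarrow>
         a$i * pderiv_at (face w t0 k) i a / monom (\<beta> k) a"
    "\<And>k. k \<in> {1..k0} \<Longrightarrow> meets (F k) I \<Longrightarrow>
       convergent (\<lambda>m. fderiv_t (F k) (t (r m)) (z (r m)) / monom (\<beta> k) (z (r m)))"
    "\<And>k. k \<in> {1..k0} \<Longrightarrow> meets (F k) I \<Longrightarrow>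
       (\<Sum>i\<in>UNIV. of_nat (w$i) * (a$i * pderiv_at (face w t0 k) i a)) = of_nat (mdot w (\<beta> k)) * peval (face w t0 k) a"
proof -
  define A where "A = (\<Union>k\<in>{1..k0}. expo (F k))"
  have fA: "finite A" unfolding A_def by (intro finite_UN_I finite_expo fs) auto
  obtain r w a where r: "strict_mono r" and a: "\<And>i. a$i \<noteq> 0" and wJ: "I_w w = J" and aJ: "\<And>i. i \<in> J \<Longrightarrow> a$i = z0$i"
    and sup: "\<And>\<alpha> \<beta>. \<alpha> \<in> A \<Longrightarrow> \<beta> \<in> A \<Longrightarrow> (\<forall>i. \<beta>$i \<noteq> 0 \<longrightarrow> i \<in> I) \<Longrightarrow> mdot w \<alpha> \<le> mdot w \<beta> \<Longrightarrow> (\<forall>i. \<alpha>$i \<noteq> 0 \<longrightarrow> i \<in> I)"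
    and eq: "\<And>\<alpha> \<beta>. \<alpha> \<in> A \<Longrightarrow> \<beta> \<in> A \<Longrightarrow> (\<forall>i. \<beta>$i \<noteq> 0 \<longrightarrow> i \<in> I) \<Longrightarrow> mdot w \<alpha> = mdot w \<beta> \<Longrightarrow>
       (\<lambda>m. monom \<alpha> (z (r m)) / monom \<beta> (z (r m))) \<longlonglongrightarrow> monom \<alpha> a / monom \<beta> a"
    and gt: "\<And>\<alpha> \<beta>. \<alpha> \<in> A \<Longrightarrow> \<beta> \<in> A \<Longrightarrow> (\<forall>i. \<beta>$i \<noteq> 0 \<longrightarrow> i \<in> I) \<Longrightarrow> mdot w \<beta> < mdot w \<alpha> \<Longrightarrow>
       (\<lambda>m. monom \<alpha> (z (r m)) / monom \<beta> (z (r m))) \<longlonglongrightarrow> 0"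
    and ratio: "\<And>i j. i \<in> I \<Longrightarrow> j \<in> I \<Longrightarrow> w$j < w$i \<Longrightarrow> (\<lambda>m. z (r m) $ i / z (r m) $ j) \<longlonglongrightarrow> 0"
    by (rule stratum_weight_extraction[OF zI z z0J fA]) blast+
  have "\<exists>\<beta>. \<beta> \<in> expo (F k) \<and> (\<forall>\<alpha>\<in>expo (F k). mdot w \<beta> \<le> mdot w \<alpha>)" if "k \<in> {1..k0}" for k
    using ex_has_least_nat[of "\<lambda>\<alpha>. \<alpha> \<in> expo (F k)" _ "mdot w"] nonempty[OF that] by blast
  then obtain \<beta> where \<beta>: "\<And>k. k \<in> {1..k0} \<Longrightarrow> \<beta> k \<in> expo (F k)"
    "\<And>k \<alpha>. k \<in> {1..k0} \<Longrightarrow> \<alpha> \<in> expo (F k) \<Longrightarrow> mdot w (\<beta> k) \<le> mdot w \<alpha>" by metis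
  have inA: "\<alpha> \<in> A" if "k \<in> {1..k0}" "\<alpha> \<in> expo (F k)" for k \<alpha> using that by (auto simp: A_def)
  have \<beta>I: "\<forall>i. \<beta> k $ i \<noteq> 0 \<longrightarrow> i \<in> I" if k: "k \<in> {1..k0}" "meets (F k) I" for k
  proof -
    obtain \<alpha> where "\<alpha> \<in> expo (F k)" "\<forall>i. \<alpha>$i \<noteq> 0 \<longrightarrow> i \<in> I" using k(2) by (auto simp: meets_def)
    then show ?thesis using sup[of "\<beta> k" \<alpha>] \<beta> inA k by blast
  qed
  have tr: "(\<lambda>m. t (r m)) \<longlonglongrightarrow> t0" using LIMSEQ_subseq_LIMSEQ[OF t(1) r] by (simp add: o_def)
  have lim: "(\<lambda>m. (\<Sum>\<alpha>\<in>expo (F k). C m \<alpha> * monom \<alpha> (z (r m))) / monom (\<beta> k) (z (r m))) \<longlonglongrightarrow>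
      (\<Sum>\<alpha>\<in>expo (F k). (if mdot w \<alpha> = mdot w (\<beta> k) then C0 \<alpha> else 0) * monom \<alpha> a) / monom (\<beta> k) a"
    if k: "k \<in> {1..k0}" "meets (F k) I" and C: "\<And>\<alpha>. (\<lambda>m. C m \<alpha>) \<longlonglongrightarrow> C0 \<alpha>" for k C C0
    by (rule face_limit[OF finite_expo[OF fs[OF k(1)]]])
       (use \<beta> k inA \<beta>I eq gt C in auto)
  have G: "face w t0 k \<alpha> = (if mdot w \<alpha> = mdot w (\<beta> k) then zcoeff (F k) t0 \<alpha> else 0)" if "k \<in> {1..k0}" for k \<alpha>
    by (rule face_eq[OF that t(2)]) (use \<beta> that in auto)
  show thesis
  proof (rule that[of r a w \<beta>])
    fix k assume k: "k \<in> {1..k0}" "meets (F k) I"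
    show "monom (\<beta> k) (z m) \<noteq> 0" for m using \<beta>I[OF k] zI by (simp add: monom_nonzero_iff)
    show "(\<lambda>m. feval (F k) (t (r m)) (z (r m)) / monom (\<beta> k) (z (r m))) \<longlonglongrightarrow> peval (face w t0 k) a / monom (\<beta> k) a"
      using lim[OF k tendsto_zcoeff[OF tr]]
      by (simp add: feval_eq_sum[OF fs[OF k(1)]] peval_superset[OF finite_expo[OF fs[OF k(1)]] face_fun_support] G[OF k(1)])
    show "convergent (\<lambda>m. fderiv_t (F k) (t (r m)) (z (r m)) / monom (\<beta> k) (z (r m)))"
      unfolding fderiv_t_def using lim[OF k tendsto_dzcoeff[OF tr]] by (rule convergentI)
    show "(\<Sum>i\<in>UNIV. of_nat (w$i) * (a$i * pderiv_at (face w t0 k) i a)) = of_nat (mdot w (\<beta> k)) * peval (face w t0 k) a"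
      by (rule face_fun_euler[OF fs[OF k(1)]]) (simp add: G[OF k(1)] split: if_splits)
    fix i
    have e: "(if mdot w \<alpha> = mdot w (\<beta> k) then zcoeff (F k) t0 \<alpha> * of_nat (\<alpha>$i) else 0) = face w t0 k \<alpha> * of_nat (\<alpha>$i)" for \<alpha>
      by (simp add: G[OF k(1)])
    show "(\<lambda>m. z (r m) $ i * fderiv_z (F k) (t (r m)) (z (r m)) i / monom (\<beta> k) (z (r m))) \<longlonglongrightarrow>
         a$i * pderiv_at (face w t0 k) i a / monom (\<beta> k) a"
      using lim[OF k, of "\<lambda>m \<alpha>. zcoeff (F k) (t (r m)) \<alpha> * of_nat (\<alpha>$i)" "\<lambda>\<alpha>. zcoeff (F k) t0 \<alpha> * of_nat (\<alpha>$i)",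
          OF tendsto_mult[OF tendsto_zcoeff[OF tr] tendsto_const]]
      by (simp only: fderiv_z_euler[OF fs[OF k(1)]] pderiv_at_euler[OF finite_expo[OF fs[OF k(1)]] face_fun_support] e)
  qed (use r a wJ aJ ratio in auto)
qed

text \<open>A sequence of violations tending to the origin has \<open>J\<close> empty and limit
  parameter 0, so the extracted weight is positive and non-degeneracy contradicts the relations.
  Nothing bounds the multipliers, hence the appeal to \<open>uniform_independence\<close>, whose
  estimate is uniform in them.\<close>

lemma eventually_regular:
  "\<forall>\<^sub>F x in nhds (0::'n amb). \<forall>I K b. K \<subseteq> {1..k0} \<longrightarrow> (\<forall>i. snd x $ i \<noteq> 0 \<longleftrightarrow> i \<in> I) \<longrightarrow>
     (\<forall>k\<in>K. meets (F k) I \<and> feval (F k) (fst x) (snd x) = 0) \<longrightarrow>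
     (\<forall>i\<in>I. (\<Sum>k\<in>K. b k * fderiv_z (F k) (fst x) (snd x) i) = 0) \<longrightarrow> (\<forall>k\<in>K. b k = 0)"
proof -
  define Q where "Q I K x \<longleftrightarrow> (\<forall>b. (\<forall>i. snd x $ i \<noteq> 0 \<longleftrightarrow> i \<in> I) \<longrightarrow>
     (\<forall>k\<in>K. meets (F k) I \<and> feval (F k) (fst x) (snd x) = 0) \<longrightarrow>
     (\<forall>i\<in>I. (\<Sum>k\<in>K. b k * fderiv_z (F k) (fst x) (snd x) i) = 0) \<longrightarrow> (\<forall>k\<in>K. b k = 0))"
     for I K and x :: "'n amb"
  have Q: "eventually (Q I K) (nhds 0)" if K: "K \<subseteq> {1..k0}" for I K
  proof (rule ccontr)
    assume "\<not> eventually (Q I K) (nhds 0)"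
    then obtain x where x: "x \<longlonglongrightarrow> (0::'n amb)" and nQ: "\<And>n. \<not> Q I K (x n)"
      by (rule not_eventually_nhds_sequence) blast
    let ?D = "\<lambda>n k. fderiv_z (F k) (fst (x n)) (snd (x n))" and ?M = "\<lambda>\<beta> n k. monom (\<beta> k) (snd (x n))"
      and ?pd = "\<lambda>w a k i. a$i * pderiv_at (face w 0 k) i a"
    let ?V = "\<lambda>\<beta> r m k i. snd (x (r m)) $ i * ?D (r m) k i / ?M \<beta> (r m) k"
    have "\<forall>n. \<exists>b. \<exists>k\<in>K. (\<forall>i. snd (x n) $ i \<noteq> 0 \<longleftrightarrow> i \<in> I) \<and>
     (\<forall>k\<in>K. meets (F k) I \<and> feval (F k) (fst (x n)) (snd (x n)) = 0) \<and>
     (\<forall>i\<in>I. (\<Sum>k\<in>K. b k * ?D n k i) = 0) \<and> b k \<noteq> 0"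
      using nQ unfolding Q_def by blast
    from choice[OF this] obtain b where B: "\<And>n. \<exists>k\<in>K. (\<forall>i. snd (x n) $ i \<noteq> 0 \<longleftrightarrow> i \<in> I) \<and>
     (\<forall>k\<in>K. meets (F k) I \<and> feval (F k) (fst (x n)) (snd (x n)) = 0) \<and>
     (\<forall>i\<in>I. (\<Sum>k\<in>K. b n k * ?D n k i) = 0) \<and> b n k \<noteq> 0"
      by blast
    have xI: "snd (x n) $ i \<noteq> 0 \<longleftrightarrow> i \<in> I"
      and f0: "k\<in>K \<Longrightarrow> feval (F k) (fst (x n)) (snd (x n)) = 0"
      and bsum: "i\<in>I \<Longrightarrow> (\<Sum>k\<in>K. b n k * ?D n k i) = 0"
      and bnz: "\<exists>k\<in>K. b n k \<noteq> 0" for n i k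
      using B[of n] by blast+
    have mI: "meets (F k) I" if "k \<in> K" for k using B[of 0] that by blast
    have t: "(\<lambda>n. fst (x n)) \<longlonglongrightarrow> 0" and z: "(\<lambda>n. snd (x n)) \<longlonglongrightarrow> 0"
      using tendsto_fst[OF x] tendsto_snd[OF x] by simp_all
    obtain r w a \<beta> where r: "strict_mono r" and a: "\<And>i. a$i \<noteq> 0" and wJ: "I_w w = {}"
      and mz: "\<And>k m. k \<in> {1..k0} \<Longrightarrow> meets (F k) I \<Longrightarrow> monom (\<beta> k) (snd (x m)) \<noteq> 0"
      and L1: "\<And>k. k \<in> {1..k0} \<Longrightarrow> meets (F k) I \<Longrightarrow> 
       (\<lambda>m. feval (F k) (fst (x (r m))) (snd (x (r m))) / ?M \<beta> (r m) k) \<longlonglongrightarrow> peval (face w 0 k) a / monom (\<beta> k) a"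
      and L2: "\<And>k i. k \<in> {1..k0} \<Longrightarrow> meets (F k) I \<Longrightarrow>
       (\<lambda>m. ?V \<beta> r m k i) \<longlonglongrightarrow>
         ?pd w a k i / monom (\<beta> k) a"
      by (rule sequence_data[OF t _ z xI, of "{}"]) (use \<epsilon> in auto)
    have ma: "monom (\<beta> k) a \<noteq> 0" for k using a by (simp add: monom_nonzero_iff)
    have pz: "peval (face w 0 k) a = 0" if "k \<in> K" for k
      using L1[of k] f0 that mI K ma by (auto simp: LIMSEQ_const_iff subset_iff)
    have "\<exists>c>0. \<forall>\<^sub>F m in sequentially. \<forall>d. c * (\<Sum>k\<in>K. cmod (d k)) \<le>
       (\<Sum>i\<in>UNIV. cmod (\<Sum>k\<in>K. d k * (?V \<beta> r m k i)))"
    proof (rule uniform_independence[where V="\<lambda>k i. ?pd w a k i / monom (\<beta> k) a"])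
      fix d :: "nat \<Rightarrow> complex"
      assume d: "\<forall>i\<in>UNIV. (\<Sum>k\<in>K. d k * (?pd w a k i / monom (\<beta> k) a)) = 0"
      have "\<forall>k\<in>K. d k / monom (\<beta> k) a = 0"
      proof (rule face_independent[OF _ K wJ a])
        show "\<not> meets (F k) {}" if "k \<in> K" for k using not_meets_empty K that by blast
        show "\<forall>i\<in>- {}. (\<Sum>k\<in>K. d k / monom (\<beta> k) a * (?pd w a k i)) = 0"
          using d by simp
      qed (use pz \<epsilon> R in auto)
      then show "\<forall>k\<in>K. d k = 0" using ma by simp
    qed (use K finite_subset[OF K] L2 mI in auto)
    then obtain c where c: "c > 0" and "\<forall>\<^sub>F m in sequentially. \<forall>d. c * (\<Sum>k\<in>K. cmod (d k)) \<le>
       (\<Sum>i\<in>UNIV. cmod (\<Sum>k\<in>K. d k * (?V \<beta> r m k i)))"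
      by blast
    from eventually_happens'[OF sequentially_bot this(2)] obtain m where m: "\<And>d. c * (\<Sum>k\<in>K. cmod (d k)) \<le>
       (\<Sum>i\<in>UNIV. cmod (\<Sum>k\<in>K. d k * (?V \<beta> r m k i)))"
      by blast
    \<comment> \<open>Rescaling by the monomials turns the given relation into one among logarithmic
      derivatives. It was assumed for indices in \<open>I\<close>; for the others the coordinate
      factor is zero.\<close>
    define d where "d k = b (r m) k * ?M \<beta> (r m) k" for k
    have "(\<Sum>k\<in>K. d k * (?V \<beta> r m k i)) = 0" for i
    proof -
      have "(\<Sum>k\<in>K. d k * (?V \<beta> r m k i)) =
         (\<Sum>k\<in>K. snd (x (r m)) $ i * (b (r m) k * ?D (r m) k i))"
        by (rule sum.cong) (use mz mI K in \<open>auto simp: d_def\<close>)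
      also have "\<dots> = 0" unfolding sum_distrib_left[symmetric]
        using bsum[of i "r m"] xI[of "r m" i] by auto
      finally show ?thesis .
    qed
    then have "c * (\<Sum>k\<in>K. cmod (d k)) \<le> 0" using m[of d] by simp
    then have "(\<Sum>k\<in>K. cmod (d k)) \<le> 0" using c by (simp add: mult_le_0_iff)
    moreover obtain k where k: "k \<in> K" "b (r m) k \<noteq> 0" using bnz by blast
    moreover have "cmod (d k) \<le> (\<Sum>k\<in>K. cmod (d k))"
      by (rule member_le_sum) (use k finite_subset[OF K] in auto)
    ultimately have "cmod (d k) \<le> 0" by linarith
    then have "d k = 0" by simp
    then show False using k mz[of k "r m"] mI K by (auto simp: d_def)
  qed
  \<comment> \<open>There are finitely many pairs of index sets, so one neighbourhood serves them
    all.\<close>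
  have "eventually (\<lambda>x. \<forall>p\<in>UNIV \<times> Pow {1..k0}. Q (fst p) (snd p) x) (nhds 0)"
    by (rule eventually_ball_finite) (use Q in auto)
  then show ?thesis unfolding Q_def by (rule eventually_mono) auto
qed

end

section \<open>Asymptotics of conormal vectors\<close>

lemma sum_norm_le_card:
  fixes f :: "'i::finite \<Rightarrow> complex"
  assumes "\<And>i. i \<in> S \<Longrightarrow> cmod (f i) \<le> B" "B \<ge> 0"
  shows "(\<Sum>i\<in>S. cmod (f i)) \<le> real CARD('i) * B"
proof -
  have "(\<Sum>i\<in>S. cmod (f i)) \<le> (\<Sum>i\<in>S. B)" by (rule sum_mono) (rule assms)
  also have "\<dots> = real (card S) * B" by simp
  also have "\<dots> \<le> real CARD('i) * B"
    by (intro mult_right_mono) (auto simp: card_mono assms)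
  finally show ?thesis .
qed

lemma convergent_family_bounded:
  fixes X :: "nat \<Rightarrow> 'k \<Rightarrow> complex"
  assumes "finite K" "\<And>k. k \<in> K \<Longrightarrow> convergent (\<lambda>m. X m k)"
  shows "\<exists>C\<ge>0. \<forall>m. \<forall>k\<in>K. cmod (X m k) \<le> C"
  using assms
proof (induction K)
  case (insert k K)
  then obtain C where C: "C \<ge> 0" "\<forall>m. \<forall>k\<in>K. cmod (X m k) \<le> C" by auto
  have "Bseq (\<lambda>m. X m k)" using insert.prems by (intro convergent_imp_Bseq) auto
  then obtain C' where C': "C' > 0" "\<forall>m. cmod (X m k) \<le> C'" by (auto simp: Bseq_def)
  show ?case by (rule exI[of _ "max C C'"]) (use C C' in \<open>auto simp: le_max_iff_disj\<close>)
qed (auto intro: exI[of _ 0])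

text \<open>The numerical heart of the verification of condition (b). The functions indexed by
  \<^term>\<open>K2\<close> do not vanish on the coordinate space of the smaller stratum, and their multipliers stay
  bounded. Those indexed by \<^term>\<open>K1\<close> do vanish there; after normalisation by the dominating
  monomials \<^term>\<open>M\<close> their multipliers are of the order of the distance \<^term>\<open>\<rho>\<close>, and the leading term
  of their contribution is cancelled by the Euler identity, because only coordinates of minimal
  weight contribute.\<close>

lemma conormal_estimate:
  fixes z dz :: "nat \<Rightarrow> 'n::finite \<Rightarrow> complex" and D :: "nat \<Rightarrow> 'k \<Rightarrow> 'n \<Rightarrow> complex" and w :: "'n \<Rightarrow> nat"
  assumes fin: "finite K1" "finite K2"
    and \<rho>: "\<And>m. \<rho> m > 0" "\<rho> \<longlonglongrightarrow> 0"
    and zI: "\<And>m i. z m i \<noteq> 0 \<longleftrightarrow> i \<in> I"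
    and z\<rho>: "\<And>m i. i \<notin> J \<Longrightarrow> cmod (z m i) \<le> \<rho> m"
    and zJ: "\<And>i. i \<in> J \<Longrightarrow> (\<lambda>m. z m i) \<longlonglongrightarrow> z0 i" "\<And>i. i \<in> J \<Longrightarrow> z0 i \<noteq> 0"
    and M: "\<And>m k. k \<in> K1 \<Longrightarrow> M m k \<noteq> 0"
    and V: "\<And>k i. k \<in> K1 \<Longrightarrow> (\<lambda>m. z m i * D m k i / M m k) \<longlonglongrightarrow> V0 k i"
    and Td: "\<And>k. k \<in> K1 \<Longrightarrow> convergent (\<lambda>m. Td m k / M m k)"
    and D: "\<And>k i. k \<in> K2 \<Longrightarrow> (\<lambda>m. D m k i) \<longlonglongrightarrow> D0 k i"
    and indep1: "\<And>b. (\<forall>i\<in>-J. (\<Sum>k\<in>K1. b k * V0 k i) = 0) \<Longrightarrow> \<forall>k\<in>K1. b k = 0"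
    and indep2: "\<And>b. (\<forall>i\<in>J. (\<Sum>k\<in>K2. b k * D0 k i) = 0) \<Longrightarrow> \<forall>k\<in>K2. b k = 0"
    and ratio: "\<And>i j. i \<in> I \<Longrightarrow> j \<in> I \<Longrightarrow> w j < w i \<Longrightarrow> (\<lambda>m. z m i / z m j) \<longlonglongrightarrow> 0"
    and w: "\<And>i. w i = 0 \<longleftrightarrow> i \<in> J"
    and euler: "\<And>k. k \<in> K1 \<Longrightarrow> (\<Sum>i\<in>UNIV. of_nat (w i) * V0 k i) = 0"
    and lam: "\<And>m i. i \<in> I \<Longrightarrow> cmod ((\<Sum>k\<in>K1. lam m k * D m k i) + (\<Sum>k\<in>K2. lam m k * D m k i)) \<le> 1"
    and dt: "\<And>m. cmod (dt m) \<le> \<rho> m" and dz: "\<And>m i. cmod (dz m i) \<le> \<rho> m" "\<And>m i. i \<notin> J \<Longrightarrow> dz m i = z m i"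
    and JI: "J \<subseteq> I"
    and S: "\<And>m k. S m k = Td m k * dt m + (\<Sum>i\<in>UNIV. D m k i * dz m i)"
    and small: "\<And>k. k \<in> K2 \<Longrightarrow> (\<lambda>m. S m k / of_real (\<rho> m)) \<longlonglongrightarrow> 0"
  shows "\<exists>r. strict_mono r \<and>
    (\<lambda>m. ((\<Sum>k\<in>K1. lam (r m) k * S (r m) k) + (\<Sum>k\<in>K2. lam (r m) k * S (r m) k)) / of_real (\<rho> (r m))) \<longlonglongrightarrow> 0"
proof -
  define n where "n = real CARD('n)"
  have n: "n > 0" by (simp add: n_def)
  \<comment> \<open>\<open>\<mu>\<close> are the multipliers of the rescaled functions. The
    components of the conormal vector are split as \<open>e1\<close> + \<open>e2\<close> according
    to \<open>K1\<close> and \<open>K2\<close>, and \<open>h\<close> is the coordinate times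
    \<open>e1\<close>, written so that rescaled quantities with known limits appear.\<close>
  define \<mu> where "\<mu> m k = lam m k * M m k" for m k
  define h where "h m i = (\<Sum>k\<in>K1. \<mu> m k * (z m i * D m k i / M m k))" for m i
  define e2 where "e2 m i = (\<Sum>k\<in>K2. lam m k * D m k i)" for m i
  define e1 where "e1 m i = (\<Sum>k\<in>K1. lam m k * D m k i)" for m i
  define \<sigma>1 where "\<sigma>1 m = (\<Sum>k\<in>K1. cmod (\<mu> m k))" for m
  define \<sigma>2 where "\<sigma>2 m = (\<Sum>k\<in>K2. cmod (lam m k))" for m
  have \<sigma>0: "\<sigma>1 m \<ge> 0" "\<sigma>2 m \<ge> 0" for m by (simp_all add: \<sigma>1_def \<sigma>2_def sum_nonneg)
  have he: "h m i = z m i * e1 m i" for m i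
    unfolding h_def e1_def sum_distrib_left by (rule sum.cong) (use M in \<open>auto simp: \<mu>_def\<close>)
  obtain c1 where c1: "c1 > 0" and LB1: "\<forall>\<^sub>F m in sequentially. \<forall>a. c1 * (\<Sum>k\<in>K1. cmod (a k)) \<le> (\<Sum>i\<in>-J. cmod (\<Sum>k\<in>K1. a k * (z m i * D m k i / M m k)))"
    using uniform_independence[OF fin(1), of "-J" "\<lambda>m k i. z m i * D m k i / M m k" V0] V indep1 by auto
  obtain c2 where c2: "c2 > 0" and LB2: "\<forall>\<^sub>F m in sequentially. \<forall>a. c2 * (\<Sum>k\<in>K2. cmod (a k)) \<le> (\<Sum>i\<in>J. cmod (\<Sum>k\<in>K2. a k * D m k i))"
    using uniform_independence[OF fin(2), of J D D0] D indep2 by auto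
  have "\<exists>C\<ge>0. \<forall>m. \<forall>p\<in>K2\<times>(UNIV::'n set). cmod (D m (fst p) (snd p)) \<le> C"
  proof (rule convergent_family_bounded)
    show "convergent (\<lambda>m. D m (fst p) (snd p))" if "p \<in> K2 \<times> UNIV" for p
      using D[of "fst p" "snd p"] that by (auto intro: convergentI)
  qed (use fin in auto)
  then obtain C where C: "C \<ge> 0" "\<And>m k i. k \<in> K2 \<Longrightarrow> cmod (D m k i) \<le> C" by auto
  have conv: "convergent (\<lambda>m. (z m i * D m k i / M m k) / z m i)" if "k \<in> K1" "i \<in> J" for k i
    using tendsto_divide[OF V[OF that(1)] zJ(1)[OF that(2)] zJ(2)[OF that(2)]] by (rule convergentI)
  have "\<exists>C\<ge>0. \<forall>m. \<forall>p\<in>K1\<times>J. cmod ((z m (snd p) * D m (fst p) (snd p) / M m (fst p)) / z m (snd p)) \<le> C"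
  proof (rule convergent_family_bounded)
    show "convergent (\<lambda>m. (z m (snd p) * D m (fst p) (snd p) / M m (fst p)) / z m (snd p))" if "p \<in> K1 \<times> J" for p
      by (rule conv) (use that in auto)
  qed (use finite_cartesian_product[OF fin(1), of J] in simp)
  then obtain C' where C': "C' \<ge> 0" and C'0: "\<And>m k i. k \<in> K1 \<Longrightarrow> i \<in> J \<Longrightarrow> cmod ((z m i * D m k i / M m k) / z m i) \<le> C'"
    by (simp only: Ball_def mem_Times_iff fst_conv snd_conv split_paired_All) blast
  have C'D: "cmod (D m k i / M m k) \<le> C'" if "k \<in> K1" "i \<in> J" for m k i
  proof -
    have "z m i \<noteq> 0" using that JI zI by blast
    then have "(z m i * D m k i / M m k) / z m i = D m k i / M m k" by simp
    then show ?thesis using C'0[OF that, of m] by (simp only:)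
  qed
  obtain C'' where C'': "C'' \<ge> 0" "\<And>m k. k \<in> K1 \<Longrightarrow> cmod (Td m k / M m k) \<le> C''"
    using convergent_family_bounded[OF fin(1), of "\<lambda>m k. Td m k / M m k"] Td by auto
  have le2: "cmod (e2 m i) \<le> C * \<sigma>2 m" for m i
  proof -
    have "cmod (e2 m i) \<le> (\<Sum>k\<in>K2. cmod (lam m k) * C)"
      unfolding e2_def by (rule order_trans[OF norm_sum sum_mono]) (auto simp: norm_mult intro!: mult_left_mono C)
    then show ?thesis by (simp add: \<sigma>2_def sum_distrib_left mult.commute)
  qed
  have le1: "cmod (e1 m i) \<le> C' * \<sigma>1 m" if "i \<in> J" for m i
  proof -
    have "e1 m i = (\<Sum>k\<in>K1. \<mu> m k * (D m k i / M m k))"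
      unfolding e1_def by (rule sum.cong) (use M in \<open>auto simp: \<mu>_def\<close>)
    also have "cmod \<dots> \<le> (\<Sum>k\<in>K1. cmod (\<mu> m k) * C')"
      by (rule order_trans[OF norm_sum sum_mono]) (simp only: norm_mult, intro mult_left_mono C'D that, auto)
    finally show ?thesis by (simp add: \<sigma>1_def sum_distrib_left mult.commute)
  qed
  have e1': "cmod (e1 m i) \<le> 1 + C * \<sigma>2 m" if "i \<in> I" for m i
    using lam[OF that, of m] le2[of m i] norm_triangle_ineq4[of "e1 m i + e2 m i" "e2 m i"]
    by (simp add: e1_def e2_def)
  have e2': "cmod (e2 m i) \<le> 1 + C' * \<sigma>1 m" if "i \<in> J" for m i
  proof -
    have "cmod (e1 m i + e2 m i) \<le> 1" using lam[of i m] that JI by (auto simp: e1_def e2_def)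
    then show ?thesis using le1[OF that, of m] norm_triangle_ineq4[of "e1 m i + e2 m i" "e1 m i"] by simp
  qed
  have hz: "cmod (h m i) \<le> cmod (z m i) * (1 + C * \<sigma>2 m)" for m i
    unfolding he norm_mult using e1'[of i m] zI[of m i] by (cases "i \<in> I") (auto intro: mult_left_mono)
  \<comment> \<open>Outside \<open>J\<close> the coordinates are at most \<open>\<rho>\<close>,
    which gives the gain in this bound. The bounds for \<open>\<sigma>1\<close> and
    \<open>\<sigma>2\<close> refer to each other; the factor \<open>\<rho>\<close> is what breaks
    the circle.\<close>
  have S1: "\<forall>\<^sub>F m in sequentially. c1 * \<sigma>1 m \<le> n * (\<rho> m * (1 + C * \<sigma>2 m))"
    using LB1
  proof eventually_elim
    case (elim m)
    have "c1 * \<sigma>1 m \<le> (\<Sum>i\<in>-J. cmod (h m i))" using elim[rule_format, of "\<mu> m"] by (simp add: \<sigma>1_def h_def)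
    also have "\<dots> \<le> n * (\<rho> m * (1 + C * \<sigma>2 m))"
      unfolding n_def
    proof (rule sum_norm_le_card)
      show "cmod (h m i) \<le> \<rho> m * (1 + C * \<sigma>2 m)" if "i \<in> -J" for i
        by (rule order_trans[OF hz mult_right_mono]) (use that z\<rho> C \<sigma>0 in auto)
    qed (use \<rho>(1)[of m] C \<sigma>0 in auto)
    finally show ?case .
  qed
  have S2: "\<forall>\<^sub>F m in sequentially. c2 * \<sigma>2 m \<le> n * (1 + C' * \<sigma>1 m)"
    using LB2
  proof eventually_elim
    case (elim m)
    have "c2 * \<sigma>2 m \<le> (\<Sum>i\<in>J. cmod (e2 m i))" using elim[rule_format, of "lam m"] by (simp add: \<sigma>2_def e2_def)
    also have "\<dots> \<le> n * (1 + C' * \<sigma>1 m)"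
      unfolding n_def by (rule sum_norm_le_card) (use e2' C' \<sigma>0 in auto)
    finally show ?case .
  qed
  \<comment> \<open>Inserting the bound for \<open>\<sigma>2\<close> into that for
    \<open>\<sigma>1\<close> gives
    \<open>\<sigma>1 \<le> B1 * \<rho> / 2 + \<rho> * q * \<sigma>1\<close>. Once
    \<open>\<rho> * q \<le> 1/2\<close> the last term is absorbed on the left, hence the factor 2 in
    \<open>B1\<close>.\<close>
  define B1 where "B1 = 2 * (n / c1) * (1 + C * (n / c2))"
  define B2 where "B2 = (n / c2) * (1 + C' * B1)"
  define q where "q = (n / c1) * (C * ((n / c2) * C'))"
  have q: "q \<ge> 0" using n c1 c2 C C' by (simp add: q_def)
  have B1: "B1 \<ge> 0" using n c1 c2 C by (simp add: B1_def)
  have "\<forall>\<^sub>F m in sequentially. \<rho> m < 1 / (2 * (q + 1))" using order_tendstoD(2)[OF \<rho>(2)] q by simp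
  moreover have "\<forall>\<^sub>F m in sequentially. \<rho> m < 1" using order_tendstoD(2)[OF \<rho>(2)] by simp
  ultimately have good: "\<forall>\<^sub>F m in sequentially. \<sigma>1 m \<le> B1 * \<rho> m \<and> \<sigma>2 m \<le> B2"
    using S1 S2
  proof eventually_elim
    case (elim m)
    have s1: "\<sigma>1 m \<le> (n / c1) * (\<rho> m * (1 + C * \<sigma>2 m))" using elim(3) c1 by (simp add: field_simps)
    have s2: "\<sigma>2 m \<le> (n / c2) * (1 + C' * \<sigma>1 m)" using elim(4) c2 by (simp add: field_simps)
    have "\<sigma>1 m \<le> (n / c1) * (\<rho> m * (1 + C * ((n / c2) * (1 + C' * \<sigma>1 m))))"
      by (rule order_trans[OF s1], intro mult_left_mono add_left_mono s2)
         (use n c1 C(1) \<rho>(1)[of m] in auto)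
    also have "\<dots> = (B1 * \<rho> m) / 2 + \<rho> m * q * \<sigma>1 m" using c1 c2 by (simp add: B1_def q_def field_simps)
    also have "\<rho> m * q * \<sigma>1 m \<le> (1/2) * \<sigma>1 m"
    proof (rule mult_right_mono[OF _ \<sigma>0(1)])
      have "\<rho> m * q \<le> \<rho> m * (q + 1)" using \<rho>(1)[of m] by simp
      also have "\<dots> \<le> 1 / (2 * (q + 1)) * (q + 1)" using elim(1) q by (intro mult_right_mono) auto
      also have "\<dots> = 1 / 2" using q by (simp add: field_simps)
      finally show "\<rho> m * q \<le> 1 / 2" .
    qed
    finally have a: "\<sigma>1 m \<le> B1 * \<rho> m" by simp
    also have "\<dots> \<le> B1 * 1" using elim(2) B1 by (intro mult_left_mono) auto
    finally have "\<sigma>1 m \<le> B1" by simp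
    then have "(n / c2) * (1 + C' * \<sigma>1 m) \<le> B2" unfolding B2_def
      using n c2 C' by (intro mult_left_mono add_left_mono) auto
    then show ?case using a s2 by linarith
  qed
  have B2: "B2 \<ge> 0" using n c2 C' B1 by (simp add: B2_def)
  define H where "H = 1 + C * B2"
  have H: "H \<ge> 0" using C B2 by (simp add: H_def)
  have hH: "\<forall>\<^sub>F m in sequentially. \<forall>i. cmod (h m i) \<le> cmod (z m i) * H"
    using good
  proof eventually_elim
    case (elim m)
    show ?case
    proof
      fix i show "cmod (h m i) \<le> cmod (z m i) * H"
        by (rule order_trans[OF hz mult_left_mono]) (use elim C in \<open>auto simp: H_def intro!: mult_left_mono\<close>)
    qed
  qed
  have s10: "\<sigma>1 \<longlonglongrightarrow> 0"
  proof (rule tendsto_sandwich[OF _ _ tendsto_const])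
    show "(\<lambda>m. B1 * \<rho> m) \<longlonglongrightarrow> 0" using tendsto_mult[OF tendsto_const \<rho>(2), of B1] by simp
    show "\<forall>\<^sub>F m in sequentially. \<sigma>1 m \<le> B1 * \<rho> m" using good by eventually_elim simp
  qed (simp add: \<sigma>0)
  define Q2 where "Q2 m = (\<Sum>k\<in>K2. lam m k * S m k)" for m
  define Q1 where "Q1 m = (\<Sum>k\<in>K1. lam m k * S m k)" for m
  have Q2: "(\<lambda>m. Q2 m / of_real (\<rho> m)) \<longlonglongrightarrow> 0"
  proof (rule Lim_null_comparison)
    let ?g = "\<lambda>m k. S m k / of_real (\<rho> m)"
    show "\<forall>\<^sub>F m in sequentially. norm (Q2 m / of_real (\<rho> m)) \<le> (\<Sum>k\<in>K2. B2 * cmod (?g m k))"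
      using good
    proof eventually_elim
      case (elim m)
      have "Q2 m / of_real (\<rho> m) = (\<Sum>k\<in>K2. lam m k * ?g m k)" by (simp add: Q2_def sum_divide_distrib)
      also have "cmod \<dots> \<le> (\<Sum>k\<in>K2. B2 * cmod (?g m k))"
      proof (rule order_trans[OF norm_sum sum_mono], unfold norm_mult, rule mult_right_mono)
        fix k assume "k \<in> K2"
        then have "cmod (lam m k) \<le> \<sigma>2 m" unfolding \<sigma>2_def by (intro member_le_sum) (auto simp: fin)
        then show "cmod (lam m k) \<le> B2" using elim by linarith
      qed simp
      finally show ?case .
    qed
    have "(\<lambda>m. \<Sum>k\<in>K2. B2 * cmod (?g m k)) \<longlonglongrightarrow> (\<Sum>k\<in>K2. B2 * cmod 0)"
      by (intro tendsto_intros small)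
    then show "(\<lambda>m. \<Sum>k\<in>K2. B2 * cmod (?g m k)) \<longlonglongrightarrow> 0" by simp
  qed
  \<comment> \<open>Outside \<open>J\<close> the secant has the coordinates of the point itself, so
    the pairing there is the sum of the \<open>h\<close> terms. The t-part and the
    \<open>J\<close>-part pair multipliers of order \<open>\<rho>\<close> with increments of order
    \<open>\<rho>\<close> and are negligible; the \<open>h\<close> terms can be of order
    \<open>\<rho>\<close> and need a cancellation.\<close>
  have Q1: "Q1 m = (\<Sum>k\<in>K1. \<mu> m k * (Td m k / M m k) * dt m) + (\<Sum>i\<in>J. e1 m i * dz m i) + (\<Sum>i\<in>-J. h m i)" for m
  proof -
    have "Q1 m = (\<Sum>k\<in>K1. lam m k * Td m k * dt m) + (\<Sum>k\<in>K1. \<Sum>i\<in>UNIV. lam m k * D m k i * dz m i)"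
      by (simp add: Q1_def S algebra_simps sum.distrib sum_distrib_left)
    also have "(\<Sum>k\<in>K1. lam m k * Td m k * dt m) = (\<Sum>k\<in>K1. \<mu> m k * (Td m k / M m k) * dt m)"
      by (rule sum.cong) (use M in \<open>auto simp: \<mu>_def\<close>)
    also have "(\<Sum>k\<in>K1. \<Sum>i\<in>UNIV. lam m k * D m k i * dz m i) = (\<Sum>i\<in>UNIV. e1 m i * dz m i)"
      unfolding e1_def sum_distrib_right by (rule sum.swap)
    also have "\<dots> = (\<Sum>i\<in>J. e1 m i * dz m i) + (\<Sum>i\<in>-J. e1 m i * dz m i)"
      by (subst sum.union_disjoint[symmetric]) auto
    also have "(\<Sum>i\<in>-J. e1 m i * dz m i) = (\<Sum>i\<in>-J. h m i)"
      by (rule sum.cong) (auto simp: he dz(2))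
    finally show ?thesis by simp
  qed
  have Q1a: "(\<lambda>m. ((\<Sum>k\<in>K1. \<mu> m k * (Td m k / M m k) * dt m) + (\<Sum>i\<in>J. e1 m i * dz m i)) / of_real (\<rho> m)) \<longlonglongrightarrow> 0"
  proof (rule Lim_null_comparison)
    show "\<forall>\<^sub>F m in sequentially. norm (((\<Sum>k\<in>K1. \<mu> m k * (Td m k / M m k) * dt m) + (\<Sum>i\<in>J. e1 m i * dz m i)) / of_real (\<rho> m)) \<le> (C'' + n * C') * \<sigma>1 m"
    proof (rule always_eventually, rule allI)
      fix m
      have "cmod (\<Sum>k\<in>K1. \<mu> m k * (Td m k / M m k) * dt m) \<le> (\<Sum>k\<in>K1. cmod (\<mu> m k) * C'' * \<rho> m)"
        by (rule order_trans[OF norm_sum sum_mono], unfold norm_mult, intro mult_mono)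
           (use C'' dt in \<open>auto simp flip: norm_divide\<close>)
      also have "\<dots> = C'' * \<sigma>1 m * \<rho> m" by (simp add: \<sigma>1_def sum_distrib_left sum_distrib_right mult_ac)
      finally have 1: "cmod (\<Sum>k\<in>K1. \<mu> m k * (Td m k / M m k) * dt m) \<le> C'' * \<sigma>1 m * \<rho> m" .
      have "cmod (\<Sum>i\<in>J. e1 m i * dz m i) \<le> (\<Sum>i\<in>J. cmod (e1 m i * dz m i))" by (rule norm_sum)
      also have "\<dots> \<le> n * (C' * \<sigma>1 m * \<rho> m)"
        unfolding n_def
      proof (rule sum_norm_le_card)
        show "cmod (e1 m i * dz m i) \<le> C' * \<sigma>1 m * \<rho> m" if "i \<in> J" for i
          unfolding norm_mult by (rule mult_mono) (use le1[OF that] dz(1) C' \<sigma>0 in auto)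
      qed (use C' \<sigma>0 \<rho>(1)[of m] in auto)
      finally have 2: "cmod (\<Sum>i\<in>J. e1 m i * dz m i) \<le> n * (C' * \<sigma>1 m * \<rho> m)" .
      have "cmod ((\<Sum>k\<in>K1. \<mu> m k * (Td m k / M m k) * dt m) + (\<Sum>i\<in>J. e1 m i * dz m i)) \<le> ((C'' + n * C') * \<sigma>1 m) * \<rho> m"
        by (rule order_trans[OF norm_triangle_ineq]) (use 1 2 in \<open>simp add: algebra_simps\<close>)
      then show "norm (((\<Sum>k\<in>K1. \<mu> m k * (Td m k / M m k) * dt m) + (\<Sum>i\<in>J. e1 m i * dz m i)) / of_real (\<rho> m)) \<le> (C'' + n * C') * \<sigma>1 m"
        using \<rho>(1)[of m] by (simp add: norm_divide divide_le_eq)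
    qed
    show "(\<lambda>m. (C'' + n * C') * \<sigma>1 m) \<longlonglongrightarrow> 0" using tendsto_mult[OF tendsto_const s10] by simp
  qed
  \<comment> \<open>The bound on \<open>\<sigma>1\<close> holds only eventually; the default 0 makes
    \<open>g\<close> bounded at every index, as the extraction of a subsequence requires.\<close>
  define g where "g m k = (if \<sigma>1 m \<le> B1 * \<rho> m then \<mu> m k / of_real (\<rho> m) else 0)" for m k
  have "\<exists>r::nat\<Rightarrow>nat. strict_mono r \<and> (\<forall>k\<in>K1. \<exists>l\<in>cball 0 B1. (\<lambda>m. g (r m) k) \<longlonglongrightarrow> l)"
  proof (rule finite_family_convergent_subseq[OF fin(1)])
    show "seq_compact (cball (0::complex) B1)" by (simp add: compact_imp_seq_compact)
    show "g m k \<in> cball 0 B1" if "k \<in> K1" for k m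
    proof -
      have "cmod (\<mu> m k) \<le> \<sigma>1 m" unfolding \<sigma>1_def using that fin by (intro member_le_sum) auto
      then show ?thesis using \<rho>(1)[of m] B1 by (auto simp: g_def norm_divide divide_le_eq)
    qed
  qed
  then obtain r where r: "strict_mono r" and "\<forall>k\<in>K1. \<exists>l\<in>cball 0 B1. (\<lambda>m. g (r m) k) \<longlonglongrightarrow> l" by blast
  then obtain \<nu> where \<nu>: "\<And>k. k \<in> K1 \<Longrightarrow> (\<lambda>m. g (r m) k) \<longlonglongrightarrow> \<nu> k" by metis
  have evr: "\<forall>\<^sub>F m in sequentially. P (r m)" if "eventually P sequentially" for P
    using eventually_subseq[OF r that] .
  define L where "L i = (\<Sum>k\<in>K1. \<nu> k * V0 k i)" for i
  have hL: "(\<lambda>m. h (r m) i / of_real (\<rho> (r m))) \<longlonglongrightarrow> L i" for i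
  proof -
    have "(\<lambda>m. \<Sum>k\<in>K1. g (r m) k * (z (r m) i * D (r m) k i / M (r m) k)) \<longlonglongrightarrow> L i"
      unfolding L_def
      by (intro tendsto_sum tendsto_mult \<nu>) (use LIMSEQ_subseq_LIMSEQ[OF V r] in \<open>auto simp: o_def\<close>)
    moreover have "\<forall>\<^sub>F m in sequentially. (\<Sum>k\<in>K1. g (r m) k * (z (r m) i * D (r m) k i / M (r m) k)) = h (r m) i / of_real (\<rho> (r m))"
      using evr[OF good] by eventually_elim (simp add: g_def h_def sum_divide_distrib mult.commute)
    ultimately show ?thesis by (rule Lim_transform_eventually)
  qed
  have Lsum: "(\<Sum>i\<in>-J. L i) = 0"
  proof (cases "I \<subseteq> J")
    case True
    then have "h m i = 0" if "i \<in> -J" for m i using zI[of m i] that by (auto simp: he)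
    then have "L i = 0" if "i \<in> -J" for i using hL[of i] that by (simp add: LIMSEQ_const_iff)
    then show ?thesis by simp
  next
    case False
    define W where "W = Min (w ` (I - J))"
    have fn: "finite (w ` (I - J))" "w ` (I - J) \<noteq> {}" using False by auto
    obtain j where j: "j \<in> I" "j \<notin> J" "w j = W" using Min_in[OF fn] unfolding W_def by fastforce
    have Wpos: "W \<noteq> 0" using j w by blast
    \<comment> \<open>A coordinate \<open>j\<close> of the minimal weight \<open>W\<close> satisfies
      |z_j| \<le> \<rho>, so dividing by \<open>\<rho>\<close> costs no more than dividing by |z_j|,
      and heavier coordinates are negligible against z_j.\<close>
    have L0: "L i = 0" if i: "i \<notin> J" "w i \<noteq> W" for i
    proof (cases "i \<in> I")
      case False
      then have "h m i = 0" for m using zI[of m i] by (auto simp: he)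
      then show ?thesis using hL[of i] by (simp add: LIMSEQ_const_iff)
    next
      case True
      have "W \<le> w i" unfolding W_def using True i fn by (intro Min_le) auto
      then have "w j < w i" using i j by simp
      have "(\<lambda>m. h (r m) i / of_real (\<rho> (r m))) \<longlonglongrightarrow> 0"
      proof (rule Lim_null_comparison)
        show "\<forall>\<^sub>F m in sequentially. norm (h (r m) i / of_real (\<rho> (r m))) \<le> H * cmod (z (r m) i / z (r m) j)"
          using evr[OF hH]
        proof eventually_elim
          case (elim m)
          have zj: "0 < cmod (z (r m) j)" "cmod (z (r m) j) \<le> \<rho> (r m)" using zI z\<rho> j by auto
          have "cmod (h (r m) i) / \<rho> (r m) \<le> (cmod (z (r m) i) * H) / cmod (z (r m) j)"
            by (rule frac_le) (use elim zj H in auto)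
          then show ?case using \<rho>(1)[of "r m"] by (simp add: norm_divide mult.commute)
        qed
        have "(\<lambda>m. H * cmod (z m i / z m j)) \<longlonglongrightarrow> H * cmod 0"
          by (intro tendsto_intros ratio True j \<open>w j < w i\<close>)
        from LIMSEQ_subseq_LIMSEQ[OF this r]
        show "(\<lambda>m. H * cmod (z (r m) i / z (r m) j)) \<longlonglongrightarrow> 0" by (simp add: o_def)
      qed
      then show ?thesis using hL[of i] LIMSEQ_unique by blast
    qed
    \<comment> \<open>All surviving terms carry the same weight \<open>W\<close>, so the Euler
      identity is \<open>W\<close> times the wanted sum; \<open>W\<close> is nonzero because
      \<open>j\<close> lies outside \<open>J\<close>.\<close>
    have "0 = (\<Sum>k\<in>K1. \<nu> k * (\<Sum>i\<in>UNIV. of_nat (w i) * V0 k i))" using euler by simp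
    also have "\<dots> = (\<Sum>k\<in>K1. \<Sum>i\<in>UNIV. of_nat (w i) * (\<nu> k * V0 k i))" by (simp add: sum_distrib_left mult_ac)
    also have "\<dots> = (\<Sum>i\<in>UNIV. \<Sum>k\<in>K1. of_nat (w i) * (\<nu> k * V0 k i))" by (rule sum.swap)
    also have "\<dots> = (\<Sum>i\<in>UNIV. of_nat (w i) * L i)" by (simp add: L_def sum_distrib_left)
    also have "\<dots> = (\<Sum>i\<in>-J. of_nat (w i) * L i)"
      by (rule sum.mono_neutral_right) (use w in auto)
    also have "\<dots> = (\<Sum>i\<in>-J. of_nat W * L i)"
      by (rule sum.cong) (use L0 in auto)
    also have "\<dots> = of_nat W * (\<Sum>i\<in>-J. L i)" by (simp add: sum_distrib_left)
    finally show ?thesis using Wpos by simp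
  qed
  have "(\<lambda>m. ((\<Sum>k\<in>K1. \<mu> (r m) k * (Td (r m) k / M (r m) k) * dt (r m)) + (\<Sum>i\<in>J. e1 (r m) i * dz (r m) i)) / of_real (\<rho> (r m))
       + (\<Sum>i\<in>-J. h (r m) i / of_real (\<rho> (r m))) + Q2 (r m) / of_real (\<rho> (r m))) \<longlonglongrightarrow> 0 + (\<Sum>i\<in>-J. L i) + 0"
    using LIMSEQ_subseq_LIMSEQ[OF Q1a r] LIMSEQ_subseq_LIMSEQ[OF Q2 r] unfolding o_def
    by (intro tendsto_add tendsto_sum hL)
  then have "(\<lambda>m. (Q1 (r m) + Q2 (r m)) / of_real (\<rho> (r m))) \<longlonglongrightarrow> 0"
    unfolding Q1 Lsum by (simp add: add_divide_distrib sum_divide_distrib)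
  then show ?thesis using r unfolding Q1_def Q2_def by blast
qed

context admissible_family
begin

text \<open>Functions that vanish on the coordinate space of \<open>p\<close> are controlled through
  their face functions; the remaining ones through their own differentials at \<open>p\<close>,
  independent by \<open>reg\<close>, and through strict differentiability along the secants.\<close>

lemma conormal_limit:
  fixes x y :: "nat \<Rightarrow> 'n amb" and lam :: "nat \<Rightarrow> nat \<Rightarrow> complex"
  assumes x: "x \<longlonglongrightarrow> p" and y: "y \<longlonglongrightarrow> p" and ne: "\<And>m. x m \<noteq> y m"
    and p\<epsilon>: "cmod (fst p) < \<epsilon>" and pR: "(\<Sum>i\<in>J. (cmod (snd p $ i))\<^sup>2) < R"
    and xI: "\<And>m i. snd (x m) $ i \<noteq> 0 \<longleftrightarrow> i \<in> I" and pJ: "\<And>i. snd p $ i \<noteq> 0 \<longleftrightarrow> i \<in> J"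
    and yJ: "\<And>m i. i \<notin> J \<Longrightarrow> snd (y m) $ i = 0" and JI: "J \<subseteq> I"
    and K: "K \<subseteq> {1..k0}" and mI: "\<And>k. k \<in> K \<Longrightarrow> meets (F k) I"
    and fx: "\<And>k m. k \<in> K \<Longrightarrow> feval (F k) (fst (x m)) (snd (x m)) = 0"
    and fy: "\<And>k m. k \<in> K \<Longrightarrow> feval (F k) (fst (y m)) (snd (y m)) = 0"
    and reg: "\<And>b. (\<forall>i\<in>J. (\<Sum>k\<in>{k\<in>K. meets (F k) J}. b k * fderiv_z (F k) (fst p) (snd p) i) = 0) \<Longrightarrow>
        \<forall>k\<in>{k\<in>K. meets (F k) J}. b k = 0"
    and lam: "\<And>m i. i \<in> I \<Longrightarrow> cmod (\<Sum>k\<in>K. lam m k * fderiv_z (F k) (fst (x m)) (snd (x m)) i) \<le> 1"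
  shows "\<exists>r. strict_mono r \<and>
    (\<lambda>m. (\<Sum>k\<in>K. lam (r m) k * fderiv (F k) (x (r m)) (x (r m) - y (r m))) / of_real (norm (x (r m) - y (r m)))) \<longlonglongrightarrow> 0"
proof -
  let ?D = "\<lambda>m k. fderiv_z (F k) (fst (x m)) (snd (x m))" and ?E = "\<lambda>m k. fderiv_t (F k) (fst (x m)) (snd (x m))"
    and ?\<rho> = "\<lambda>m. norm (x m - y m)" and ?dt = "\<lambda>m. fst (x m) - fst (y m)"
    and ?dz = "\<lambda>m i. snd (x m) $ i - snd (y m) $ i" and ?pd = "\<lambda>w k. pderiv_at (face w (fst p) k)" and ?pe = "\<lambda>w k. peval (face w (fst p) k)"
    and ?S = "\<lambda>m k. fderiv (F k) (x m) (x m - y m)" and ?M = "\<lambda>\<beta> m k. monom (\<beta> k) (snd (x m))"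
  have t: "(\<lambda>n. fst (x n)) \<longlonglongrightarrow> fst p" and z: "(\<lambda>n. snd (x n)) \<longlonglongrightarrow> snd p"
    using tendsto_fst[OF x] tendsto_snd[OF x] by simp_all
  obtain r w a \<beta> where r: "strict_mono r" and a: "\<And>i. a$i \<noteq> 0" and wJ: "I_w w = J"
    and aJ: "\<And>i. i \<in> J \<Longrightarrow> a$i = snd p $ i"
    and ratio: "\<And>i j. i \<in> I \<Longrightarrow> j \<in> I \<Longrightarrow> w$j < w$i \<Longrightarrow> (\<lambda>m. snd (x (r m)) $ i / snd (x (r m)) $ j) \<longlonglongrightarrow> 0"
    and mz: "\<And>k m. k \<in> {1..k0} \<Longrightarrow> meets (F k) I \<Longrightarrow> monom (\<beta> k) (snd (x m)) \<noteq> 0"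
    and L1: "\<And>k. k \<in> {1..k0} \<Longrightarrow> meets (F k) I \<Longrightarrow>
       (\<lambda>m. feval (F k) (fst (x (r m))) (snd (x (r m))) / ?M \<beta> (r m) k) \<longlonglongrightarrow> ?pe w k a / monom (\<beta> k) a"
    and L2: "\<And>k i. k \<in> {1..k0} \<Longrightarrow> meets (F k) I \<Longrightarrow>
       (\<lambda>m. snd (x (r m)) $ i * ?D (r m) k i / ?M \<beta> (r m) k) \<longlonglongrightarrow>
         a$i * ?pd w k i a / monom (\<beta> k) a"
    and L3: "\<And>k. k \<in> {1..k0} \<Longrightarrow> meets (F k) I \<Longrightarrow>
       convergent (\<lambda>m. ?E (r m) k / ?M \<beta> (r m) k)"
    and eul: "\<And>k. k \<in> {1..k0} \<Longrightarrow> meets (F k) I \<Longrightarrow>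
       (\<Sum>i\<in>UNIV. of_nat (w$i) * (a$i * ?pd w k i a)) = of_nat (mdot w (\<beta> k)) * ?pe w k a"
    by (rule sequence_data[OF t p\<epsilon> z xI pJ]) blast+
  have K0: "k \<in> {1..k0}" if "k \<in> K" for k using that K by blast
  have fK: "finite K" using K finite_subset by blast
  have ma: "monom (\<beta> k) a \<noteq> 0" for k using a by (simp add: monom_nonzero_iff)
  \<comment> \<open>The rescaled functions vanish along the sequence, hence in the limit. This puts
    \<open>a\<close> on the zero set of the face functions and later annihilates the right-hand side
    of the Euler identity.\<close>
  have pz: "?pe w k a = 0" if "k \<in> K" for k
    using L1[OF K0[OF that] mI[OF that]] fx that ma by (auto simp: LIMSEQ_const_iff)
  define K1 where "K1 = {k\<in>K. \<not> meets (F k) J}"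
  define K2 where "K2 = {k\<in>K. meets (F k) J}"
  have K12: "K = K1 \<union> K2" "K1 \<inter> K2 = {}" by (auto simp: K1_def K2_def)
  have fK12: "finite K1" "finite K2" using fK by (auto simp: K1_def K2_def)
  have spl: "(\<Sum>k\<in>K. h k) = (\<Sum>k\<in>K1. h k) + (\<Sum>k\<in>K2. h k)" for h :: "nat \<Rightarrow> complex"
    unfolding K12(1) by (rule sum.union_disjoint[OF fK12 K12(2)])
  have xr: "(\<lambda>m. x (r m)) \<longlonglongrightarrow> p" and yr: "(\<lambda>m. y (r m)) \<longlonglongrightarrow> p"
    using LIMSEQ_subseq_LIMSEQ[OF x r] LIMSEQ_subseq_LIMSEQ[OF y r] by (simp_all add: o_def)
  have ncoord: "cmod (snd v $ i) \<le> norm v" for v :: "'n amb" and i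
    using order_trans[OF Finite_Cartesian_Product.norm_nth_le[of "snd v" i] norm_snd_le[of "snd v" "fst v"]] by simp
  have nfst: "cmod (fst v) \<le> norm v" for v :: "'n amb"
    using norm_fst_le[of "fst v" "snd v"] by simp
  have fd: "fderiv (F k) (x m) (x m - y m) = fderiv_t (F k) (fst (x m)) (snd (x m)) * (fst (x m) - fst (y m)) +
     (\<Sum>i\<in>UNIV. fderiv_z (F k) (fst (x m)) (snd (x m)) i * (snd (x m) $ i - snd (y m) $ i))" for k m
    by (simp add: fderiv_def)
  have "\<exists>s. strict_mono s \<and> (\<lambda>m. ((\<Sum>k\<in>K1. lam (r (s m)) k * ?S (r (s m)) k) +
      (\<Sum>k\<in>K2. lam (r (s m)) k * ?S (r (s m)) k)) / of_real (?\<rho> (r (s m)))) \<longlonglongrightarrow> 0"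
  proof (rule conormal_estimate[where z="\<lambda>m i. snd (x (r m)) $ i" and I=I and J=J and \<rho>="\<lambda>m. ?\<rho> (r m)"
        and dz="\<lambda>m i. ?dz (r m) i" and S="\<lambda>m. ?S (r m)" and dt="\<lambda>m. ?dt (r m)"
        and D="\<lambda>m k i. ?D (r m) k i"
        and Td="\<lambda>m k. ?E (r m) k"
        and M="\<lambda>m k. ?M \<beta> (r m) k" and w="\<lambda>i. w$i" and ?z0.0="\<lambda>i. snd p $ i"
        and ?V0.0="\<lambda>k i. a$i * ?pd w k i a / monom (\<beta> k) a"
        and ?D0.0="\<lambda>k i. fderiv_z (F k) (fst p) (snd p) i" and lam="\<lambda>m. lam (r m)"])
    show "finite K1" "finite K2" by (rule fK12)+
    show "?\<rho> (r m) > 0" for m using ne by simp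
    show "(\<lambda>m. ?\<rho> (r m)) \<longlonglongrightarrow> 0"
      using tendsto_norm[OF tendsto_diff[OF xr yr]] by simp
    show "cmod (snd (x (r m)) $ i) \<le> ?\<rho> (r m)" if "i \<notin> J" for m i
      using ncoord[of "x (r m) - y (r m)" i] yJ[OF that] by simp
    show "(\<lambda>m. snd (x (r m)) $ i) \<longlonglongrightarrow> snd p $ i" for i
      by (intro tendsto_intros xr)
    show "?M \<beta> (r m) k \<noteq> 0" if "k \<in> K1" for m k
      using mz mI K0 that by (auto simp: K1_def)
    show "(\<lambda>m. snd (x (r m)) $ i * ?D (r m) k i / ?M \<beta> (r m) k) \<longlonglongrightarrow>
         a$i * ?pd w k i a / monom (\<beta> k) a" if "k \<in> K1" for k i
      by (rule L2) (use mI K0 that in \<open>auto simp: K1_def\<close>)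
    show "convergent (\<lambda>m. ?E (r m) k / ?M \<beta> (r m) k)" if "k \<in> K1" for k
      by (rule L3) (use mI K0 that in \<open>auto simp: K1_def\<close>)
    show "(\<lambda>m. ?D (r m) k i) \<longlonglongrightarrow> fderiv_z (F k) (fst p) (snd p) i" if "k \<in> K2" for k i
      by (intro tendsto_fderiv_z tendsto_fst tendsto_snd xr fs K0) (use that in \<open>auto simp: K2_def\<close>)
    show "\<forall>k\<in>K1. b k = 0" if b: "\<forall>i\<in>-J. (\<Sum>k\<in>K1. b k * (a$i * ?pd w k i a / monom (\<beta> k) a)) = 0" for b
    proof -
      have "\<forall>k\<in>K1. b k / monom (\<beta> k) a = 0"
      proof (rule face_independent[OF p\<epsilon> _ wJ a])
        show "(\<Sum>i\<in>J. (cmod (a $ i))\<^sup>2) < R" using pR aJ by simp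
        show "\<forall>i\<in>- J. (\<Sum>k\<in>K1. b k / monom (\<beta> k) a * (a $ i * ?pd w k i a)) = 0"
          using b by simp
      qed (use K pz in \<open>auto simp: K1_def\<close>)
      then show ?thesis using ma by simp
    qed
    show "\<forall>k\<in>K2. b k = 0" if "\<forall>i\<in>J. (\<Sum>k\<in>K2. b k * fderiv_z (F k) (fst p) (snd p) i) = 0" for b
      using reg[of b] that unfolding K2_def by blast
    show "w$i = 0 \<longleftrightarrow> i \<in> J" for i using wJ by (auto simp: I_w_def)
    show "(\<Sum>i\<in>UNIV. of_nat (w$i) * (a$i * ?pd w k i a / monom (\<beta> k) a)) = 0" if "k \<in> K1" for k
    proof -
      have k: "k \<in> K" using that by (simp add: K1_def)
      have "(\<Sum>i\<in>UNIV. of_nat (w$i) * (a$i * ?pd w k i a / monom (\<beta> k) a)) =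
         (\<Sum>i\<in>UNIV. of_nat (w$i) * (a$i * ?pd w k i a)) / monom (\<beta> k) a"
        by (simp add: sum_divide_distrib)
      then show ?thesis by (simp add: eul[OF K0[OF k] mI[OF k]] pz[OF k])
    qed
    show "cmod ((\<Sum>k\<in>K1. lam (r m) k * ?D (r m) k i) +
        (\<Sum>k\<in>K2. lam (r m) k * ?D (r m) k i)) \<le> 1" if "i \<in> I" for m i
      using lam[OF that, of "r m"] by (simp add: spl)
    show "cmod (?dt (r m)) \<le> ?\<rho> (r m)" for m
      using nfst[of "x (r m) - y (r m)"] by simp
    show "cmod (?dz (r m) i) \<le> ?\<rho> (r m)" for m i
      using ncoord[of "x (r m) - y (r m)" i] by simp
    show "(\<lambda>m. ?S (r m) k / of_real (?\<rho> (r m))) \<longlonglongrightarrow> 0" if "k \<in> K2" for k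
    proof -
      have k: "k \<in> K" using that by (simp add: K2_def)
      show ?thesis by (rule feval_strict_derivative[OF fs[OF K0[OF k]] xr yr]) (use fx fy k in auto)
    qed
  qed (use xI pJ yJ JI ratio fd in auto)
  then obtain s where s: "strict_mono s"
    and "(\<lambda>m. (\<Sum>k\<in>K. lam (r (s m)) k * ?S (r (s m)) k) / of_real (?\<rho> (r (s m)))) \<longlonglongrightarrow> 0"
    unfolding spl by blast
  then show ?thesis
    by (intro exI[of _ "r \<circ> s"]) (simp add: strict_mono_o[OF r s])
qed

end

section \<open>Level sets as graphs\<close>

text \<open>The derivative of a local inverse is given pointwise as an inverse map; this supplies
  its continuity. If y(q) solves the equation at q, then A(q0)(y(q) - y(q0)) = (A(q0) - A(q)) y(q),
  and half of the lower bound of A(q0) absorbs the unknown part of y(q).\<close>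

lemma continuous_inv_blinfun:
  fixes A :: "'b::topological_space \<Rightarrow> 'a::euclidean_space \<Rightarrow>\<^sub>L 'a"
  assumes A: "continuous_on V A" and bij: "\<And>q. q \<in> V \<Longrightarrow> bij (blinfun_apply (A q))"
  shows "continuous_on V (\<lambda>q. inv (blinfun_apply (A q)) v)"
  unfolding continuous_on_def
proof
  fix q0 assume q0: "q0 \<in> V"
  have lin: "linear (blinfun_apply (A q0))" by (simp add: blinfun.bounded_linear_right bounded_linear.linear)
  obtain B where B: "B > 0" "\<And>x. B * norm x \<le> norm (A q0 x)"
    using linear_inj_bounded_below_pos[OF lin bij_is_inj[OF bij[OF q0]]] by blast
  define y where "y q = inv (blinfun_apply (A q)) v" for q
  have Ay: "A q (y q) = v" if "q \<in> V" for q
    unfolding y_def using bij[OF that] by (simp add: bij_is_surj surj_f_inv_f)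
  have lim: "((\<lambda>q. norm (A q0 - A q)) \<longlongrightarrow> 0) (at q0 within V)"
    using A q0 by (auto simp: continuous_on_def intro!: tendsto_eq_intros)
  have "((\<lambda>q. y q - y q0) \<longlongrightarrow> 0) (at q0 within V)"
  proof (rule Lim_null_comparison)
    have "\<forall>\<^sub>F q in at q0 within V. norm (A q0 - A q) < B / 2"
      by (rule order_tendstoD(2)[OF lim]) (use B(1) in simp)
    moreover have "\<forall>\<^sub>F q in at q0 within V. q \<in> V" by (simp add: eventually_at_filter)
    ultimately show "\<forall>\<^sub>F q in at q0 within V. norm (y q - y q0) \<le> (2 / B * norm (y q0)) * norm (A q0 - A q)"
    proof eventually_elim
      case (elim q)
      have "A q0 (y q - y q0) = (A q0 - A q) (y q)"
        using Ay[OF q0] Ay[OF elim(2)] by (simp add: blinfun.diff_left blinfun.diff_right)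
      then have "B * norm (y q - y q0) \<le> norm (A q0 - A q) * norm (y q)"
        using B(2)[of "y q - y q0"] norm_blinfun[of "A q0 - A q" "y q"] by simp
      also have "\<dots> \<le> norm (A q0 - A q) * (norm (y q - y q0) + norm (y q0))"
        using norm_triangle_ineq[of "y q - y q0" "y q0"] by (intro mult_left_mono) auto
      also have "\<dots> \<le> B / 2 * norm (y q - y q0) + norm (A q0 - A q) * norm (y q0)"
        using mult_right_mono[OF less_imp_le[OF elim(1)], of "norm (y q - y q0)"] by (simp add: algebra_simps)
      finally have "B / 2 * norm (y q - y q0) \<le> norm (A q0 - A q) * norm (y q0)" by simp
      then show ?case using B(1) by (simp add: field_simps)
    qed
    show "((\<lambda>q. (2 / B * norm (y q0)) * norm (A q0 - A q)) \<longlongrightarrow> 0) (at q0 within V)"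
      using tendsto_mult[OF tendsto_const lim, of "2 / B * norm (y q0)"] by (simp only: mult_zero_right)
  qed
  then have "(y \<longlongrightarrow> y q0) (at q0 within V)" by (rule LIM_zero_cancel)
  then show "((\<lambda>q. inv (blinfun_apply (A q)) v) \<longlongrightarrow> inv (blinfun_apply (A q0)) v) (at q0 within V)"
    unfolding y_def .
qed

text \<open>In finite dimension, continuity in each direction gives continuity in operator
  norm.\<close>

lemma has_derivative_imp_blinfun:
  fixes H :: "'a::euclidean_space \<Rightarrow> 'b::euclidean_space"
  assumes "\<And>q. (H has_derivative H' q) (at q)" and "\<And>v. continuous_on UNIV (\<lambda>q. H' q v)"
  shows "\<exists>g'. (\<forall>q. (H has_derivative blinfun_apply (g' q)) (at q)) \<and> continuous_on UNIV g'"
proof (intro exI conjI allI)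
  have ap: "blinfun_apply (Blinfun (H' q)) = H' q" for q
    using has_derivative_bounded_linear[OF assms(1)] by (rule bounded_linear_Blinfun_apply)
  show "(H has_derivative blinfun_apply (Blinfun (H' q))) (at q)" for q using assms(1) by (simp add: ap)
  show "continuous_on UNIV (\<lambda>q. Blinfun (H' q))"
    by (rule continuous_on_blinfun_componentwise) (simp add: ap assms(2))
qed

section \<open>A continuously differentiable cutoff\<close>

lemma DERIV_max_zero_square: "((\<lambda>s::real. (max 0 s)\<^sup>2) has_field_derivative 2 * max 0 s) (at s)"
proof -
  consider "s > 0" | "s < 0" | "s = 0" by linarith
  then show ?thesis
  proof cases
    case 1
    have "((\<lambda>s::real. s\<^sup>2) has_field_derivative 2 * max 0 s) (at s)"
      using 1 by (auto intro!: derivative_eq_intros)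
    then show ?thesis by (rule has_field_derivative_transform_within_open[of _ _ _ "{0<..}"]) (use 1 in auto)
  next
    case 2
    have "((\<lambda>s::real. 0) has_field_derivative 2 * max 0 s) (at s)" using 2 by auto
    then show ?thesis by (rule has_field_derivative_transform_within_open[of _ _ _ "{..<0}"]) (use 2 in auto)
  next
    case 3
    have "((\<lambda>h::real. (max 0 h)\<^sup>2 / h) \<longlongrightarrow> 0) (at 0)"
    proof (rule Lim_null_comparison)
      show "\<forall>\<^sub>F h in at 0. norm ((max 0 h)\<^sup>2 / h) \<le> \<bar>h\<bar>"
        by (rule always_eventually) (auto simp: max_def power2_eq_square abs_mult)
      show "((\<lambda>h::real. \<bar>h\<bar>) \<longlongrightarrow> 0) (at 0)" by (auto intro!: tendsto_eq_intros)
    qed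
    then show ?thesis using 3 by (simp add: DERIV_def)
  qed
qed

text \<open>Graph functions are asked to be C1, so squared positive parts are smooth enough. With
  \<open>N\<close> the squared distance in units of \<open>d\<close>, the inner term
  \<open>m2 (N q - 1)\<close> is 0 on the ball of radius \<open>d\<close> and at least 1 from radius
  \<open>2 * d\<close> on.\<close>

lemma cutoff_exists:
  fixes q0 :: "'a::euclidean_space"
  assumes "d > 0"
  obtains bmp :: "'a \<Rightarrow> real" and bmp' where "\<And>q. (bmp has_derivative bmp' q) (at q)" "\<And>v. continuous_on UNIV (\<lambda>q. bmp' q v)"
    "\<And>q. dist q q0 \<le> d \<Longrightarrow> bmp q = 1" "\<And>q. dist q q0 \<ge> 2 * d \<Longrightarrow> bmp q = 0"
proof -
  define m2 where "m2 s = (max 0 s)\<^sup>2" for s :: real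
  define N where "N q = (q - q0) \<bullet> (q - q0) / d\<^sup>2" for q
  define bmp where "bmp q = m2 (1 - m2 (N q - 1))" for q
  define c' where "c' q = 2 * max 0 (1 - m2 (N q - 1)) * - (2 * max 0 (N q - 1))" for q
  define bmp' where "bmp' q v = c' q * (2 * ((q - q0) \<bullet> v) / d\<^sup>2)" for q v
  have N': "(N has_derivative (\<lambda>v. 2 * ((q - q0) \<bullet> v) / d\<^sup>2)) (at q)" for q
    unfolding N_def using assms by (auto intro!: derivative_eq_intros simp: inner_commute divide_inverse)
  have "((\<lambda>s. m2 (1 - m2 (s - 1))) has_field_derivative c' q) (at (N q))" for q
    unfolding c'_def m2_def
    by (rule derivative_eq_intros DERIV_chain2[OF DERIV_max_zero_square] refl)+ simp
  then have 1: "(bmp has_derivative bmp' q) (at q)" for q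
    using has_derivative_compose[OF N'[of q], of "\<lambda>s. m2 (1 - m2 (s - 1))" "\<lambda>v. c' q * v"]
    unfolding bmp_def bmp'_def has_field_derivative_def by simp
  have 2: "continuous_on UNIV (\<lambda>q. bmp' q v)" for v
    unfolding bmp'_def c'_def m2_def N_def using assms by (intro continuous_intros) auto
  have N: "N q = (dist q q0 / d)\<^sup>2" for q
    by (simp add: N_def dist_norm power2_norm_eq_inner power_divide)
  have 3: "bmp q = 1" if "dist q q0 \<le> d" for q
  proof -
    have "N q \<le> 1" unfolding N using that assms by (simp add: power_le_one_iff)
    then show ?thesis by (simp add: bmp_def m2_def)
  qed
  have 4: "bmp q = 0" if "dist q q0 \<ge> 2 * d" for q
  proof -
    have "2 \<le> dist q q0 / d" using that assms by (simp add: le_divide_eq)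
    then have "2\<^sup>2 \<le> N q" unfolding N by (rule power_mono) simp
    then have "1 \<le> m2 (N q - 1)" by (simp add: m2_def)
    then show ?thesis by (simp add: bmp_def m2_def)
  qed
  show thesis by (rule that[OF 1 2 3 4])
qed


section \<open>Tangent spaces of level sets\<close>

lemma tangent_space_open_Int:
  assumes "open O'" "x \<in> O'"
  shows "tangent_space (X \<inter> O') x = tangent_space X x"
proof
  show "tangent_space (X \<inter> O') x \<subseteq> tangent_space X x" unfolding tangent_space_def by blast
  show "tangent_space X x \<subseteq> tangent_space (X \<inter> O') x"
  proof
    fix v assume "v \<in> tangent_space X x"
    then obtain \<gamma> e where g: "\<gamma> 0 = x" "e > 0" "\<And>s. \<bar>s\<bar> < e \<Longrightarrow> \<gamma> s \<in> X" "(\<gamma> has_vector_derivative v) (at (0::real))"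
      unfolding tangent_space_def by blast
    have "isCont \<gamma> 0" using g(4) has_vector_derivative_continuous by blast
    then have "(\<gamma> \<longlongrightarrow> x) (at 0)" using g(1) by (simp add: isCont_def)
    then have "\<forall>\<^sub>F s in at 0. \<gamma> s \<in> O'" using assms by (rule topological_tendstoD)
    then obtain d where d: "d > 0" "\<And>s. s \<noteq> 0 \<Longrightarrow> dist s 0 < d \<Longrightarrow> \<gamma> s \<in> O'"
      unfolding eventually_at by blast
    have "\<gamma> s \<in> X \<inter> O'" if "\<bar>s\<bar> < min e d" for s
      using d(2)[of s] g that assms(2) by (cases "s = 0") auto
    moreover have "min e d > 0" using g d by simp
    ultimately show "v \<in> tangent_space (X \<inter> O') x" using g(1,4) unfolding tangent_space_def by blast
  qed
qed

lemma tangent_space_level_set_subset: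
  assumes der: "(G has_derivative G') (at x)" and X: "\<And>p. p \<in> X \<Longrightarrow> G p = 0" and v: "v \<in> tangent_space X x"
  shows "G' v = 0"
proof -
  obtain \<gamma> e where g: "\<gamma> 0 = x" "e > 0" "\<And>s. \<bar>s\<bar> < e \<Longrightarrow> \<gamma> s \<in> X" "(\<gamma> has_vector_derivative v) (at (0::real))"
    using v unfolding tangent_space_def by blast
  have "((\<lambda>s. G (\<gamma> s)) has_derivative (\<lambda>h. G' (h *\<^sub>R v))) (at 0)"
    using has_derivative_compose[OF g(4)[unfolded has_vector_derivative_def], of G G'] der g(1) by simp
  moreover have "((\<lambda>s. G (\<gamma> s)) has_derivative (\<lambda>h. 0)) (at 0)"
    by (rule has_derivative_transform_within_open[of "\<lambda>_. 0" _ _ _ "{-e<..<e}"])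
       (use g X in \<open>auto simp: abs_less_iff\<close>)
  ultimately have "(\<lambda>h. G' (h *\<^sub>R v)) = (\<lambda>h. 0)" by (rule has_derivative_unique)
  from fun_cong[OF this, of 1] show ?thesis by simp
qed

text \<open>A C1 level set whose defining map takes values in the orthogonal complement of the kernel
  of its derivative is a global graph over that kernel near the point: the map
  \<^term>\<open>\<lambda>p. P p + G p\<close>, with \<^term>\<open>P\<close> the orthogonal projection to the kernel, is a local
  diffeomorphism, and the local graph function is extended by a cutoff.\<close>

lemma level_set_graph:
  fixes G :: "'a::euclidean_space \<Rightarrow> 'a"
  assumes der: "\<And>p. (G has_derivative blinfun_apply (G' p)) (at p)" and cont: "continuous_on UNIV G'"
    and N: "N = {v. blinfun_apply (G' x) v = 0}"
    and orth: "\<And>p v. v \<in> N \<Longrightarrow> G p \<bullet> v = 0" and Gx: "G x = 0"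
  shows "N \<subseteq> tangent_space {p. G p = 0} x" 
    and "\<exists>U g g'. open U \<and> x \<in> U \<and> (\<forall>p. (g has_derivative blinfun_apply (g' p)) (at p)) \<and> continuous_on UNIV g' \<and>
       (\<forall>p. \<forall>l\<in>N. g p \<bullet> l = 0) \<and> {p. G p = 0} \<inter> U = {p + g p | p. p \<in> N} \<inter> U"
proof -
  have sN: "subspace N" unfolding N
    by (auto simp: subspace_def blinfun.add_right blinfun.scaleR_right)
  obtain P where blP: "bounded_linear P" and PN: "\<And>v. P v \<in> N" and Porth: "\<And>v s. s \<in> N \<Longrightarrow> (v - P v) \<bullet> s = 0"
    and Pid: "\<And>v. v \<in> N \<Longrightarrow> P v = v"
    by (rule orthogonal_projection_onto_subspace[OF sN]) blast
  interpret P: bounded_linear P by (rule blP)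
  define \<Phi> where "\<Phi> p = P p + G p" for p
  define \<Phi>' where "\<Phi>' p = Blinfun P + G' p" for p
  have ap: "blinfun_apply (\<Phi>' p) v = P v + G' p v" for p v
    by (simp add: \<Phi>'_def blinfun.add_left bounded_linear_Blinfun_apply[OF blP])
  have der\<Phi>: "(\<Phi> has_derivative blinfun_apply (\<Phi>' p)) (at p)" for p
  proof -
    have "(\<Phi> has_derivative (\<lambda>v. P v + G' p v)) (at p)" unfolding \<Phi>_def
      by (intro has_derivative_add P.has_derivative has_derivative_ident der)
    moreover have "blinfun_apply (\<Phi>' p) = (\<lambda>v. P v + G' p v)" by (rule ext) (rule ap)
    ultimately show ?thesis by (simp only:)
  qed
  have cont\<Phi>: "continuous_on UNIV \<Phi>'" unfolding \<Phi>'_def by (intro continuous_intros cont)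
  have G'orth: "G' x v \<bullet> s = 0" if "s \<in> N" for v s
  proof -
    have "((\<lambda>p. G p \<bullet> s) has_derivative (\<lambda>v. G' x v \<bullet> s)) (at x)"
      by (intro has_derivative_inner_left der)
    then have "((\<lambda>p. 0) has_derivative (\<lambda>v. G' x v \<bullet> s)) (at x)" using orth[OF that] by simp
    from has_derivative_unique[OF this has_derivative_const] show ?thesis by (rule fun_cong)
  qed
  \<comment> \<open>\<open>P\<close> has values in the kernel and the derivative of \<open>G\<close>
    at \<open>x\<close> in its orthogonal complement, so a zero of the sum is a zero of both. The
    vector then lies in the kernel, where \<open>P\<close> is the identity.\<close>
  have inj: "inj (blinfun_apply (\<Phi>' x))"
  proof -
    have "v = 0" if "\<Phi>' x v = 0" for v
    proof -
      have "P v + G' x v = 0" using that by (simp add: ap)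
      then have "P v \<bullet> P v + G' x v \<bullet> P v = 0" by (metis inner_add_left inner_zero_left)
      then have P0: "P v = 0" using G'orth[OF PN] by simp
      then have "v \<in> N" using that by (simp add: ap N)
      then show ?thesis using Pid P0 by simp
    qed
    then show ?thesis
      by (simp add: linear_injective_0 blinfun.bounded_linear_right bounded_linear.linear)
  qed
  obtain L where L: "linear L" "L \<circ> blinfun_apply (\<Phi>' x) = id"
    using linear_injective_left_inverse[OF _ inj] blinfun.bounded_linear_right bounded_linear.linear by blast
  have invf: "Blinfun L o\<^sub>L \<Phi>' x = id_blinfun"
    by (rule blinfun_eqI)
       (use L in \<open>simp add: bounded_linear_Blinfun_apply linear_conv_bounded_linear fun_eq_iff\<close>)
  obtain U' V \<Psi> \<Psi>' where U': "open U'" "x \<in> U'" and V: "open V" "\<Phi> x \<in> V" and hom: "homeomorphism U' V \<Phi> \<Psi>"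
    and der\<Psi>: "\<And>q. q \<in> V \<Longrightarrow> (\<Psi> has_derivative \<Psi>' q) (at q)"
    and \<Psi>': "\<And>q. q \<in> V \<Longrightarrow> \<Psi>' q = inv (blinfun_apply (\<Phi>' (\<Psi> q)))"
    and bij: "\<And>q. q \<in> V \<Longrightarrow> bij (blinfun_apply (\<Phi>' (\<Psi> q)))"
    by (rule inverse_function_theorem[OF open_UNIV der\<Phi> cont\<Phi> UNIV_I invf]) blast
  have \<Psi>\<Phi>: "\<Psi> (\<Phi> p) = p" "\<Phi> p \<in> V" if "p \<in> U'" for p using hom that by (auto simp: homeomorphism_def)
  have \<Phi>\<Psi>: "\<Phi> (\<Psi> q) = q" "\<Psi> q \<in> U'" if "q \<in> V" for q using hom that by (auto simp: homeomorphism_def)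
  have c\<Psi>: "continuous_on V \<Psi>" using hom by (simp add: homeomorphism_def)
  \<comment> \<open>For \<open>q\<close> in \<open>N\<close>, the vector
    \<open>G (\<Psi> q) = q - P (\<Psi> q)\<close> lies in \<open>N\<close> and is orthogonal to
    \<open>N\<close>, hence zero: \<open>\<Psi>\<close> carries \<open>N\<close> near
    \<open>q0\<close> into the level set.\<close>
  have G\<Psi>: "G (\<Psi> q) = 0" "P (\<Psi> q) = q" if "q \<in> V" "q \<in> N" for q
  proof -
    have e: "P (\<Psi> q) + G (\<Psi> q) = q" using \<Phi>\<Psi>(1)[OF that(1)] by (simp add: \<Phi>_def)
    then have "G (\<Psi> q) = q - P (\<Psi> q)" by (simp add: algebra_simps)
    then have "G (\<Psi> q) \<in> N" using subspace_diff[OF sN that(2) PN] by simp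
    then show 0: "G (\<Psi> q) = 0" using orth[of "G (\<Psi> q)" "\<Psi> q"] by simp
    show "P (\<Psi> q) = q" using e 0 by simp
  qed
  define q0 where "q0 = P x"
  have \<Phi>x: "\<Phi> x = q0" by (simp add: \<Phi>_def q0_def Gx)
  have q0V: "q0 \<in> V" and q0N: "q0 \<in> N" using V(2) \<Phi>x PN q0_def by auto
  have \<Psi>q0: "\<Psi> q0 = x" using \<Psi>\<Phi>(1)[OF U'(2)] \<Phi>x by simp
  obtain d0 where d0: "d0 > 0" "ball q0 d0 \<subseteq> V" using V(1) q0V open_contains_ball by blast
  show "N \<subseteq> tangent_space {p. G p = 0} x"
  proof
    fix v assume v: "v \<in> N"
    define \<gamma> where "\<gamma> s = \<Psi> (q0 + s *\<^sub>R v)" for s :: real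
    define e where "e = d0 / (norm v + 1)"
    have e: "e > 0" using d0(1) unfolding e_def by (intro divide_pos_pos) (auto intro: add_nonneg_pos)
    have inV: "q0 + s *\<^sub>R v \<in> V" if "\<bar>s\<bar> < e" for s
    proof -
      have "\<bar>s\<bar> * norm v \<le> \<bar>s\<bar> * (norm v + 1)" by (simp add: mult_left_mono)
      also have "\<dots> < d0" using that by (simp add: e_def pos_less_divide_eq add_nonneg_pos)
      finally have "dist q0 (q0 + s *\<^sub>R v) < d0" by (simp add: dist_norm)
      then show ?thesis using d0(2) by auto
    qed
    have "\<gamma> s \<in> {p. G p = 0}" if "\<bar>s\<bar> < e" for s
      using G\<Psi>(1)[OF inV[OF that]] subspace_add[OF sN q0N subspace_scale[OF sN v]] by (simp add: \<gamma>_def)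
    moreover have "(\<gamma> has_vector_derivative v) (at 0)"
    proof -
      have "\<Phi>' x v = v" using v Pid by (simp add: ap N)
      then have "\<Psi>' q0 v = v"
        using \<Psi>'[OF q0V] bij[OF q0V] \<Psi>q0 by (metis bij_inv_eq_iff)
      moreover have "((\<lambda>s::real. q0 + s *\<^sub>R v) has_derivative (\<lambda>h. h *\<^sub>R v)) (at 0)"
        by (auto intro!: derivative_eq_intros)
      from has_derivative_compose[OF this, of \<Psi> "\<Psi>' q0"]
      have D: "(\<gamma> has_derivative (\<lambda>h. \<Psi>' q0 (h *\<^sub>R v))) (at 0)"
        using der\<Psi>[OF q0V] by (simp add: \<gamma>_def[abs_def])
      moreover have "linear (\<Psi>' q0)" using der\<Psi>[OF q0V] has_derivative_linear by blast
      ultimately show ?thesis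
        by (simp add: has_vector_derivative_def linear_cmul)
    qed
    moreover have "\<gamma> 0 = x" by (simp add: \<gamma>_def \<Psi>q0)
    ultimately show "v \<in> tangent_space {p. G p = 0} x" unfolding tangent_space_def using e by blast
  qed
  \<comment> \<open>The cutoff vanishes from radius \<open>2 * d < d0\<close> on, so the open sets
    \<open>V\<close> and \<open>W\<close> cover the space and \<open>H\<close> can be differentiated
    on each of them.\<close>
  define d where "d = d0 / 3"
  have d: "d > 0" using d0 by (simp add: d_def)
  obtain bmp :: "'a \<Rightarrow> real" and bmp' where bmp: "\<And>q. (bmp has_derivative bmp' q) (at q)" "\<And>v. continuous_on UNIV (\<lambda>q. bmp' q v)"
    "\<And>q. dist q q0 \<le> d \<Longrightarrow> bmp q = 1" "\<And>q. dist q q0 \<ge> 2 * d \<Longrightarrow> bmp q = 0"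
    by (rule cutoff_exists[OF d]) blast
  define W where "W = {q. dist q q0 > 2 * d}"
  have oW: "open W" unfolding W_def by (intro open_Collect_less continuous_intros)
  have VW: "q \<in> V \<or> q \<in> W" for q
    using d0 by (auto simp: W_def d_def subset_iff dist_commute not_less)
  define H where "H q = (if q \<in> V then bmp q *\<^sub>R (\<Psi> q - P (\<Psi> q)) else 0)" for q
  define HV where "HV q v = bmp q *\<^sub>R (\<Psi>' q v - P (\<Psi>' q v)) + bmp' q v *\<^sub>R (\<Psi> q - P (\<Psi> q))" for q v
  define H' where "H' q = (if q \<in> V then HV q else (\<lambda>v. 0))" for q
  have HW: "H q = 0" if "q \<in> W" for q using bmp(4)[of q] that by (simp add: H_def W_def)
  have derV: "(H has_derivative HV q) (at q)" if "q \<in> V" for q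
  proof -
    have "((\<lambda>q. bmp q *\<^sub>R (\<Psi> q - P (\<Psi> q))) has_derivative HV q) (at q)"
      unfolding HV_def
      by (intro has_derivative_scaleR bmp(1) has_derivative_diff der\<Psi>[OF that] P.has_derivative)
    then show ?thesis
      by (rule has_derivative_transform_within_open[OF _ V(1) that]) (simp add: H_def)
  qed
  have derW: "(H has_derivative (\<lambda>v. 0)) (at q)" if "q \<in> W" for q
    by (rule has_derivative_transform_within_open[of "\<lambda>_. 0", OF _ oW that]) (auto simp: HW)
  have H'W: "H' q = (\<lambda>v. 0)" if "q \<in> W" for q
    using derV[of q] derW[OF that] has_derivative_unique by (auto simp: H'_def)
  have derH: "(H has_derivative H' q) (at q)" for q
    using VW[of q] derV[of q] derW[of q] H'W[of q] by (auto simp: H'_def)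
  have cH: "continuous_on UNIV (\<lambda>q. H' q v)" for v
  proof -
    have c\<Psi>': "continuous_on V (\<lambda>q. \<Psi>' q v)"
    proof -
      have "continuous_on V (\<lambda>q. inv (blinfun_apply (\<Phi>' (\<Psi> q))) v)"
        by (rule continuous_inv_blinfun[OF continuous_on_compose2[OF cont\<Phi> c\<Psi>] bij]) auto
      then show ?thesis by (rule continuous_on_eq) (simp add: \<Psi>')
    qed
    have "continuous_on V (\<lambda>q. HV q v)" unfolding HV_def
      by (intro continuous_intros c\<Psi> c\<Psi>' P.continuous_on continuous_on_subset[OF bmp(2)] 
          has_derivative_continuous_on[OF has_derivative_at_withinI[OF bmp(1)]]) auto
    then have "continuous_on V (\<lambda>q. H' q v)" by (rule continuous_on_eq) (simp add: H'_def)
    moreover have "continuous_on W (\<lambda>q. H' q v)"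
      by (rule continuous_on_eq[OF continuous_on_const[of _ 0]]) (simp add: H'W)
    ultimately have "continuous_on (V \<union> W) (\<lambda>q. H' q v)" using V(1) oW by (intro continuous_on_open_Un)
    moreover have "V \<union> W = UNIV" using VW by auto
    ultimately show ?thesis by simp
  qed
  have Horth: "H q \<bullet> l = 0" if "l \<in> N" for q l using Porth[OF that] by (simp add: H_def)
  \<comment> \<open>Composition with \<open>P\<close> keeps the values on \<open>N\<close>, where
    \<open>P\<close> is the identity; in the equation z = p + g p the point p is then recovered as
    the projection of z.\<close>
  define g where "g p = H (P p)" for p
  have "\<exists>g'. (\<forall>q. (g has_derivative blinfun_apply (g' q)) (at q)) \<and> continuous_on UNIV g'"
  proof (rule has_derivative_imp_blinfun)
    show "(g has_derivative (\<lambda>v. H' (P q) (P v))) (at q)" for q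
      unfolding g_def by (rule has_derivative_compose[OF P.has_derivative[OF has_derivative_ident] derH])
    show "continuous_on UNIV (\<lambda>q. H' (P q) (P v))" for v
      by (rule continuous_on_compose2[OF cH P.continuous_on[OF continuous_on_id]]) auto
  qed
  then obtain g' where g': "\<forall>q. (g has_derivative blinfun_apply (g' q)) (at q)" "continuous_on UNIV g'" by blast
  define U where "U = U' \<inter> {z. dist (P z) q0 < d}"
  have oU: "open U" unfolding U_def
    by (intro open_Int U' open_Collect_less continuous_intros P.continuous_on)
  have xU: "x \<in> U" using U' d by (simp add: U_def q0_def)
  have near: "q \<in> V \<and> bmp q = 1" if "dist q q0 < d" for q
  proof -
    have "dist q0 q < d0" using that d0(1) by (simp add: d_def dist_commute)
    then show ?thesis using d0(2) bmp(3)[of q] that by auto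
  qed
  have "{p. G p = 0} \<inter> U = {p + g p | p. p \<in> N} \<inter> U"
  proof (intro equalityI subsetI)
    fix z assume z: "z \<in> {p. G p = 0} \<inter> U"
    then have zP: "\<Phi> z = P z" by (simp add: \<Phi>_def)
    have "z \<in> U'" "dist (P z) q0 < d" using z by (auto simp: U_def)
    then have "\<Psi> (P z) = z" using \<Psi>\<Phi>(1)[of z] zP by simp
    then have "g (P z) = z - P z" using near[OF \<open>dist (P z) q0 < d\<close>] Pid[OF PN] by (simp add: g_def H_def)
    then have "z = P z + g (P z)" by simp
    then show "z \<in> {p + g p | p. p \<in> N} \<inter> U" using PN z by blast
  next
    fix z assume z: "z \<in> {p + g p | p. p \<in> N} \<inter> U"
    then obtain p where p: "p \<in> N" "z = p + g p" by blast
    have "P (g p) = 0"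
      using Porth[OF PN[of "g p"], of "g p"] Horth[OF PN[of "g p"], of "P p"] by (simp add: g_def inner_diff_left)
    then have "P z = p" using p Pid by (simp add: P.add)
    then have dp: "dist p q0 < d" using z by (auto simp: U_def)
    have "g p = \<Psi> p - p" using near[OF dp] Pid[OF p(1)] G\<Psi>(2)[of p] p(1) by (simp add: g_def H_def)
    then have "z = \<Psi> p" using p by simp
    then show "z \<in> {p. G p = 0} \<inter> U" using G\<Psi>(1)[of p] near[OF dp] p(1) z by auto
  qed
  moreover have "\<forall>p. \<forall>l\<in>N. g p \<bullet> l = 0" using Horth by (simp add: g_def)
  ultimately show "\<exists>U g g'. open U \<and> x \<in> U \<and> (\<forall>p. (g has_derivative blinfun_apply (g' p)) (at p)) \<and> continuous_on UNIV g' \<and>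
       (\<forall>p. \<forall>l\<in>N. g p \<bullet> l = 0) \<and> {p. G p = 0} \<inter> U = {p + g p | p. p \<in> N} \<inter> U"
    using oU xU g' by blast
qed

section \<open>The strata\<close>

lemma has_derivative_vec_lambda:
  fixes f :: "'i::finite \<Rightarrow> 'a::real_normed_vector \<Rightarrow> 'b::euclidean_space"
  assumes "\<And>i. (f i has_derivative f' i) (at p)"
  shows "((\<lambda>p. \<chi> i. f i p) has_derivative (\<lambda>v. \<chi> i. f' i v)) (at p)"
proof -
  have bl: "bounded_linear (\<lambda>a. axis i a :: 'b^'i)" for i
    unfolding linear_conv_bounded_linear[symmetric] by (rule linearI) (simp_all add: vec_eq_iff axis_def)
  have "((\<lambda>p. \<Sum>i\<in>UNIV. axis i (f i p)) has_derivative (\<lambda>v. \<Sum>i\<in>UNIV. axis i (f' i v))) (at p)"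
    by (intro has_derivative_sum bounded_linear.has_derivative[OF bl] assms)
  moreover have "(\<Sum>i\<in>UNIV. axis i (h i)) = (\<chi> i. h i)" for h :: "'i \<Rightarrow> 'b"
    by (simp add: vec_eq_iff axis_def)
  ultimately show ?thesis by simp
qed

section \<open>Complex multiples and conormal vectors\<close>

definition cmul :: "complex \<Rightarrow> 'n::finite amb \<Rightarrow> 'n amb" where
  "cmul c v = (c * fst v, \<chi> i. c * snd v $ i)"

lemma cline_cmul:
  assumes "u \<in> cline v" obtains c where "u = cmul c v"
proof -
  obtain k where "u - k *\<^sub>R v \<in> span {cJ v}" using assms unfolding cline_def span_insert by blast
  then obtain l where "u - k *\<^sub>R v = l *\<^sub>R cJ v" unfolding span_singleton by blast
  then have "u = k *\<^sub>R v + l *\<^sub>R cJ v" by (simp add: algebra_simps)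
  then have "u = cmul (Complex k l) v"
    by (simp add: cmul_def cJ_def prod_eq_iff vec_eq_iff complex_eq_iff)
  then show thesis by (rule that)
qed

lemma norm_cmul: "norm (cmul c v) = cmod c * norm v"
proof -
  have "norm (\<chi> i. c * snd v $ i) = cmod c * norm (snd v)"
    unfolding norm_vec_def by (simp add: norm_mult L2_set_right_distrib)
  then show ?thesis
    by (simp add: cmul_def norm_prod_def norm_mult power_mult_distrib distrib_left[symmetric] real_sqrt_mult)
qed

lemma inner_amb: "(u::'n::finite amb) \<bullet> v = Re (cnj (fst u) * fst v + (\<Sum>i\<in>UNIV. cnj (snd u $ i) * snd v $ i))"
  by (simp add: inner_prod_def inner_vec_def inner_complex_def)

lemma fderiv_cmul: "fderiv P p (cmul c v) = c * fderiv P p v"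
  by (simp add: fderiv_def cmul_def algebra_simps sum_distrib_left)

lemma cJ_cmul: "cJ v = cmul \<i> v"
  by (simp add: cJ_def cmul_def)

text \<open>These vectors form the real orthogonal complement of the kernel of the differentials of the
  \<^term>\<open>F k\<close> on the coordinate space given by \<^term>\<open>I\<close>: complex multiples of conjugate gradients,
  with arbitrary entries outside \<^term>\<open>I\<close>.\<close>

definition conormal :: "(nat \<Rightarrow> nat \<times> (nat^'n) \<Rightarrow> complex) \<Rightarrow> nat set \<Rightarrow> 'n set \<Rightarrow> 'n amb \<Rightarrow> (nat \<Rightarrow> complex) \<Rightarrow> complex^'n \<Rightarrow> 'n::finite amb" where
  "conormal F K I x l c = ((\<Sum>k\<in>K. l k * cnj (fderiv_t (F k) (fst x) (snd x))),
     \<chi> i. if i \<in> I then \<Sum>k\<in>K. l k * cnj (fderiv_z (F k) (fst x) (snd x) i) else c $ i)"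

text \<open>The conjugates in \<open>conormal\<close> make the real inner product the real part of a
  complex linear pairing, and the free entries \<open>c\<close> meet only zero coordinates of
  \<open>v\<close>.\<close>

lemma conormal_inner:
  assumes "\<And>i. i \<notin> I \<Longrightarrow> snd v $ i = 0"
  shows "conormal F K I x l c \<bullet> v = Re (\<Sum>k\<in>K. cnj (l k) * fderiv (F k) x v)"
proof -
  have "(\<Sum>i\<in>UNIV. cnj (snd (conormal F K I x l c) $ i) * snd v $ i) =
     (\<Sum>i\<in>UNIV. \<Sum>k\<in>K. cnj (l k) * (fderiv_z (F k) (fst x) (snd x) i * snd v $ i))"
    by (rule sum.cong) (auto simp: conormal_def assms sum_distrib_right mult.assoc)
  also have "\<dots> = (\<Sum>k\<in>K. \<Sum>i\<in>UNIV. cnj (l k) * (fderiv_z (F k) (fst x) (snd x) i * snd v $ i))"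
    by (rule sum.swap)
  also have "\<dots> = (\<Sum>k\<in>K. cnj (l k) * (\<Sum>i\<in>UNIV. fderiv_z (F k) (fst x) (snd x) i * snd v $ i))"
    by (simp add: sum_distrib_left)
  finally have 1: "(\<Sum>i\<in>UNIV. cnj (snd (conormal F K I x l c) $ i) * snd v $ i) = \<dots>" .
  have 2: "cnj (fst (conormal F K I x l c)) * fst v = (\<Sum>k\<in>K. cnj (l k) * (fderiv_t (F k) (fst x) (snd x) * fst v))"
    by (simp add: conormal_def sum_distrib_right mult.assoc)
  show ?thesis unfolding inner_amb 1 2
    by (simp add: fderiv_def distrib_left sum.distrib)
qed

lemma conormal_linear:
  "conormal F K I x (\<lambda>k. l k + l' k) (c + c') = conormal F K I x l c + conormal F K I x l' c'"
  "conormal F K I x (\<lambda>k. of_real a * l k) (a *\<^sub>R c) = a *\<^sub>R conormal F K I x l c"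
  by (auto simp: conormal_def prod_eq_iff vec_eq_iff algebra_simps sum.distrib sum_distrib_left scaleR_conv_of_real[where 'a=complex])

lemma subspace_conormal: "subspace {conormal F K I x l c | l c. True}"
proof (rule subspaceI)
  show "0 \<in> {conormal F K I x l c | l c. True}"
    by (rule CollectI, intro exI[of _ "\<lambda>_. 0"] exI[of _ 0]) (simp add: conormal_def prod_eq_iff vec_eq_iff)
  show "u + v \<in> {conormal F K I x l c | l c. True}"
    if "u \<in> {conormal F K I x l c | l c. True}" "v \<in> {conormal F K I x l c | l c. True}" for u v
    using that conormal_linear(1)[symmetric] by (smt (verit) mem_Collect_eq)
  show "a *\<^sub>R u \<in> {conormal F K I x l c | l c. True}" if "u \<in> {conormal F K I x l c | l c. True}" for a u
    using that conormal_linear(2)[symmetric] by (smt (verit) mem_Collect_eq)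
qed

text \<open>At a regular point of a stratum, with \<open>K\<close> reduced to the functions that
  meet \<open>I\<close>, this is the tangent space; see \<open>stratum_local\<close>.\<close>

definition level_kernel :: "(nat \<Rightarrow> nat \<times> (nat^'n) \<Rightarrow> complex) \<Rightarrow> nat set \<Rightarrow> 'n set \<Rightarrow> 'n amb \<Rightarrow> 'n::finite amb set" where
  "level_kernel F K I x = {v. (\<forall>i. i \<notin> I \<longrightarrow> snd v $ i = 0) \<and> (\<forall>k\<in>K. fderiv (F k) x v = 0)}"

text \<open>Real orthogonality suffices because the multipliers are complex: taking the derivative
  of \<open>F k\<close> along \<open>p\<close> as multiplier makes the pairing the squared modulus
  of that derivative.\<close>

lemma orthogonal_conormal_in_kernel:
  assumes K: "finite K" and p: "\<And>l c. p \<bullet> conormal F K I x l c = 0"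
  shows "p \<in> level_kernel F K I x"
proof -
  have 0: "snd p $ i = 0" if "i \<notin> I" for i
  proof -
    have "conormal F K I x (\<lambda>_. 0) (axis i (snd p $ i)) = (0, axis i (snd p $ i))"
      using that by (auto simp: conormal_def prod_eq_iff vec_eq_iff axis_def)
    then have "snd p \<bullet> axis i (snd p $ i) = 0" using p[of "\<lambda>_. 0" "axis i (snd p $ i)"] by (simp add: inner_prod_def)
    then have "snd p $ i \<bullet> snd p $ i = 0" by (simp add: inner_axis)
    then show ?thesis by simp
  qed
  have "fderiv (F k) x p = 0" if k: "k \<in> K" for k
  proof -
    let ?l = "\<lambda>j. if j = k then fderiv (F k) x p else 0"
    have "Re (\<Sum>j\<in>K. cnj (?l j) * fderiv (F j) x p) = 0"
      using conormal_inner[of I p F K x ?l 0] 0 p[of ?l 0] by (simp add: inner_commute)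
    moreover have "(\<Sum>j\<in>K. cnj (?l j) * fderiv (F j) x p) = (\<Sum>j\<in>K. if j = k then cnj (fderiv (F k) x p) * fderiv (F k) x p else 0)"
      by (rule sum.cong) auto
    ultimately have "Re (cnj (fderiv (F k) x p) * fderiv (F k) x p) = 0" using k K by simp
    then have "(cmod (fderiv (F k) x p))\<^sup>2 = 0" unfolding cmod_power2 by (simp add: power2_eq_square)
    then show ?thesis by (simp only: power_eq_0_iff norm_eq_zero)
  qed
  then show ?thesis using 0 by (simp add: level_kernel_def)
qed

context admissible_family
begin

definition regular_at :: "'n amb \<Rightarrow> bool" where
  "regular_at x \<longleftrightarrow> (\<forall>I K b. K \<subseteq> {1..k0} \<longrightarrow> (\<forall>i. snd x $ i \<noteq> 0 \<longleftrightarrow> i \<in> I) \<longrightarrow>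
     (\<forall>k\<in>K. meets (F k) I \<and> feval (F k) (fst x) (snd x) = 0) \<longrightarrow>
     (\<forall>i\<in>I. (\<Sum>k\<in>K. b k * fderiv_z (F k) (fst x) (snd x) i) = 0) \<longrightarrow> (\<forall>k\<in>K. b k = 0))"

abbreviation active :: "nat set \<Rightarrow> 'n set \<Rightarrow> nat set" where
  "active K I \<equiv> {k\<in>K. meets (F k) I}"

text \<open>Regularity makes the parametrisation of conormal vectors injective in the entries that
  matter, so that a single vector equation can encode all equations of a stratum.\<close>

lemma conormal_eq_0:
  assumes reg: "regular_at x" and K: "K \<subseteq> {1..k0}" and xI: "\<And>i. snd x $ i \<noteq> 0 \<longleftrightarrow> i \<in> I"
    and m: "\<And>k. k \<in> K \<Longrightarrow> meets (F k) I" and f: "\<And>k. k \<in> K \<Longrightarrow> feval (F k) (fst x) (snd x) = 0"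
    and 0: "conormal F K I x l c = 0"
  shows "(\<forall>k\<in>K. l k = 0) \<and> (\<forall>i. i \<notin> I \<longrightarrow> c $ i = 0)"
proof
  have s: "snd (conormal F K I x l c) $ i = 0" for i using 0 by simp
  have "(\<Sum>k\<in>K. cnj (l k) * fderiv_z (F k) (fst x) (snd x) i) = 0" if "i \<in> I" for i
  proof -
    have "cnj (\<Sum>k\<in>K. cnj (l k) * fderiv_z (F k) (fst x) (snd x) i) = 0"
      using s[of i] that by (simp add: conormal_def)
    then show ?thesis by (simp only: complex_cnj_zero_iff)
  qed
  then have "\<forall>k\<in>K. cnj (l k) = 0"
    using reg[unfolded regular_at_def, rule_format, of K I "\<lambda>k. cnj (l k)"] K xI m f by blast
  then show "\<forall>k\<in>K. l k = 0" by simp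
  show "\<forall>i. i \<notin> I \<longrightarrow> c $ i = 0" 
  proof (intro allI impI)
    fix i assume "i \<notin> I" then show "c $ i = 0" using s[of i] by (simp add: conormal_def)
  qed
qed

text \<open>The map \<open>G\<close> takes the defining functions at \<open>p\<close> as multipliers
  of the conormal vectors frozen at \<open>x\<close>. Its values lie in the orthogonal complement of
  the kernel, as \<open>level_set_graph\<close> requires, and by injectivity it vanishes exactly
  where the active functions and the coordinates outside \<open>I\<close> do.\<close>

lemma stratum_local:
  assumes K: "K \<subseteq> {1..k0}" and x: "x \<in> toric_stratum k0 F I K" and reg: "regular_at x"
  shows "tangent_space (toric_stratum k0 F I K) x = level_kernel F (active K I) I x" (is "?T = ?N")
    and "\<exists>U L g g'. open U \<and> x \<in> U \<and> subspace L \<and>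
       (\<forall>p. (g has_derivative blinfun_apply (g' p)) (at p)) \<and> continuous_on UNIV g' \<and>
       (\<forall>p. \<forall>l\<in>L. g p \<bullet> l = 0) \<and>
       toric_stratum k0 F I K \<inter> U = {p + g p | p. p \<in> L} \<inter> U" (is ?C)
proof -
  let ?X = "toric_stratum k0 F I K"
  let ?z = "\<lambda>k i. cnj (fderiv_z (F k) (fst x) (snd x) i)" and ?t = "\<lambda>k. cnj (fderiv_t (F k) (fst x) (snd x))"
    and ?f = "\<lambda>k p. feval (F k) (fst p) (snd p)"
  define KA where "KA = active K I"
  have KA: "KA \<subseteq> {1..k0}" "KA \<subseteq> K" and mKA: "\<And>k. k \<in> KA \<Longrightarrow> meets (F k) I" using K by (auto simp: KA_def)
  have fKA: "finite KA" using KA finite_subset by blast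
  have xI: "\<And>i. snd x $ i \<noteq> 0 \<longleftrightarrow> i \<in> I" and xf: "\<And>k. k \<in> {1..k0} \<Longrightarrow> ?f k x = 0 \<longleftrightarrow> k \<in> K"
    using x by (auto simp: toric_stratum_def split_beta)
  have xKA: "?f k x = 0" if "k \<in> KA" for k using xf KA that by blast
  define G where "G p = conormal F KA I x (\<lambda>k. ?f k p) (snd p)" for p
  define G' where "G' p v = conormal F KA I x (\<lambda>k. fderiv (F k) p v) (snd v)" for p v
  have fsKA: "finite_support (F k)" if "k \<in> KA" for k using fs KA that by blast
  have dG: "(G has_derivative G' p) (at p)" for p
    unfolding G_def G'_def conormal_def
  proof (rule has_derivative_Pair)
    show "((\<lambda>p. \<Sum>k\<in>KA. ?f k p * ?t k) has_derivative
      (\<lambda>v. \<Sum>k\<in>KA. fderiv (F k) p v * ?t k)) (at p)"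
      by (intro has_derivative_sum has_derivative_mult_left feval_has_derivative fsKA)
    show "((\<lambda>p. \<chi> i. if i \<in> I then \<Sum>k\<in>KA. ?f k p * ?z k i else snd p $ i) has_derivative
      (\<lambda>v. \<chi> i. if i \<in> I then \<Sum>k\<in>KA. fderiv (F k) p v * ?z k i else snd v $ i)) (at p)"
    proof (rule has_derivative_vec_lambda)
      fix i
      have "((\<lambda>p. \<Sum>k\<in>KA. ?f k p * ?z k i) has_derivative
        (\<lambda>v. \<Sum>k\<in>KA. fderiv (F k) p v * ?z k i)) (at p)"
        by (intro has_derivative_sum has_derivative_mult_left feval_has_derivative fsKA)
      moreover have "((\<lambda>p. snd p $ i) has_derivative (\<lambda>v. snd v $ i)) (at p)"
        by (intro bounded_linear_imp_has_derivative bounded_linear_compose[OF bounded_linear_vec_nth bounded_linear_snd])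
      ultimately show "((\<lambda>p. if i \<in> I then \<Sum>k\<in>KA. ?f k p * ?z k i else snd p $ i) has_derivative
        (\<lambda>v. if i \<in> I then \<Sum>k\<in>KA. fderiv (F k) p v * ?z k i else snd v $ i)) (at p)"
        by (cases "i \<in> I") simp_all
    qed
  qed
  have cfd: "continuous_on UNIV (\<lambda>p. fderiv (F k) p v)" if "k \<in> KA" for k v
    unfolding continuous_on_def by (auto intro!: tendsto_fderiv fsKA that)
  have cG': "continuous_on UNIV (\<lambda>p. G' p v)" for v
    unfolding G'_def conormal_def
  proof (intro continuous_on_Pair continuous_on_vec_lambda)
    show "continuous_on UNIV (\<lambda>p. \<Sum>k\<in>KA. fderiv (F k) p v * ?t k)"
      by (intro continuous_on_sum continuous_on_mult_right cfd)
    fix i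
    have "continuous_on UNIV (\<lambda>p. \<Sum>k\<in>KA. fderiv (F k) p v * ?z k i)"
      by (intro continuous_on_sum continuous_on_mult_right cfd)
    then show "continuous_on UNIV (\<lambda>p. if i \<in> I then \<Sum>k\<in>KA. fderiv (F k) p v * ?z k i else snd v $ i)"
      by (cases "i \<in> I") simp_all
  qed
  obtain GL where GL: "\<And>p. (G has_derivative blinfun_apply (GL p)) (at p)" "continuous_on UNIV GL"
    using has_derivative_imp_blinfun[OF dG cG'] by blast
  have GLx: "blinfun_apply (GL x) = G' x" using has_derivative_unique[OF GL(1) dG] .
  have c0: "(\<forall>k\<in>KA. l k = 0) \<and> (\<forall>i. i \<notin> I \<longrightarrow> c $ i = 0)" if "conormal F KA I x l c = 0" for l c
    by (rule conormal_eq_0[OF reg KA(1) xI mKA xKA that])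
  have ker: "level_kernel F KA I x = {v. blinfun_apply (GL x) v = 0}"
  proof (intro equalityI subsetI)
    fix v assume "v \<in> level_kernel F KA I x"
    then have v: "\<And>i. i \<notin> I \<Longrightarrow> snd v $ i = 0" "\<And>k. k \<in> KA \<Longrightarrow> fderiv (F k) x v = 0" by (auto simp: level_kernel_def)
    have "G' x v = 0" unfolding G'_def conormal_def by (auto simp: prod_eq_iff vec_eq_iff v)
    then show "v \<in> {v. blinfun_apply (GL x) v = 0}" by (simp add: GLx)
  next
    fix v assume "v \<in> {v. blinfun_apply (GL x) v = 0}"
    then have "G' x v = 0" by (simp add: GLx)
    then show "v \<in> level_kernel F KA I x" using c0[of "\<lambda>k. fderiv (F k) x v" "snd v"]
      by (auto simp: level_kernel_def G'_def)
  qed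
  have orth: "G p \<bullet> v = 0" if "v \<in> level_kernel F KA I x" for p v
    unfolding G_def by (subst conormal_inner) (use that in \<open>auto simp: level_kernel_def\<close>)
  have G0: "G p = 0 \<longleftrightarrow> (\<forall>k\<in>KA. ?f k p = 0) \<and> (\<forall>i. i \<notin> I \<longrightarrow> snd p $ i = 0)" for p
  proof
    assume "G p = 0" then show "(\<forall>k\<in>KA. ?f k p = 0) \<and> (\<forall>i. i \<notin> I \<longrightarrow> snd p $ i = 0)"
      using c0[of "\<lambda>k. ?f k p" "snd p"] unfolding G_def by blast
  qed (auto simp: G_def conormal_def prod_eq_iff vec_eq_iff)
  have Gx: "G x = 0" using G0 xKA xI by blast
  \<comment> \<open>These are the open conditions of the stratum. Inside this set only equations
    remain, and those of inactive functions hold automatically on the coordinate space.\<close>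
  define O' where "O' = (\<Inter>i\<in>I. {p::'n amb. snd p $ i \<noteq> 0}) \<inter> (\<Inter>k\<in>{1..k0} - K. {p. ?f k p \<noteq> 0})"
  have oO: "open O'"
    unfolding O'_def
  proof (intro open_Int open_INT ballI)
    show "open {p::'n amb. snd p $ i \<noteq> 0}" for i
      by (intro open_Collect_neq continuous_intros)
    show "open {p. ?f k p \<noteq> 0}" if "k \<in> {1..k0} - K" for k
      by (intro open_Collect_neq continuous_on_const has_derivative_continuous_on[OF has_derivative_at_withinI[OF feval_has_derivative[OF fs]]])
         (use that in auto)
  qed auto
  have xO: "x \<in> O'" using xI xf by (auto simp: O'_def)
  have XO: "?X \<inter> O' = {p. G p = 0} \<inter> O'"
  proof (intro equalityI subsetI)
    fix p assume "p \<in> ?X \<inter> O'"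
    then show "p \<in> {p. G p = 0} \<inter> O'" using KA by (auto simp: toric_stratum_def split_beta G0 subset_iff)
  next
    fix p assume p: "p \<in> {p. G p = 0} \<inter> O'"
    then have 1: "\<And>k. k \<in> KA \<Longrightarrow> ?f k p = 0" and 2: "\<And>i. i \<notin> I \<Longrightarrow> snd p $ i = 0" by (auto simp: G0)
    have "?f k p = 0" if "k \<in> K" for k
    proof (cases "meets (F k) I")
      case False
      then show ?thesis using not_meets_feval fs 2 that K by blast
    qed (use 1 that in \<open>auto simp: KA_def\<close>)
    then show "p \<in> ?X \<inter> O'" using p 2 by (auto simp: toric_stratum_def split_beta O'_def)
  qed
  have tX: "?T = tangent_space {p. G p = 0} x"
    using tangent_space_open_Int[OF oO xO, of ?X] tangent_space_open_Int[OF oO xO, of "{p. G p = 0}"] XO by simp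
  show "?T = level_kernel F (active K I) I x"
    unfolding tX KA_def[symmetric]
  proof
    show "tangent_space {p. G p = 0} x \<subseteq> level_kernel F KA I x"
      unfolding ker using tangent_space_level_set_subset[OF GL(1)[of x], of "{p. G p = 0}"] by blast
    show "level_kernel F KA I x \<subseteq> tangent_space {p. G p = 0} x"
      by (rule level_set_graph(1)[OF GL ker orth Gx])
  qed
  obtain U g g' where U: "open U" "x \<in> U" and g: "\<forall>p. (g has_derivative blinfun_apply (g' p)) (at p)" "continuous_on UNIV g'"
    "\<forall>p. \<forall>l\<in>level_kernel F KA I x. g p \<bullet> l = 0" and XU: "{p. G p = 0} \<inter> U = {p + g p | p. p \<in> level_kernel F KA I x} \<inter> U"
    using level_set_graph(2)[OF GL ker orth Gx] by blast
  have "subspace (level_kernel F KA I x)" unfolding ker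
    by (auto simp: subspace_def blinfun.add_right blinfun.scaleR_right)
  moreover have "?X \<inter> (U \<inter> O') = {p + g p | p. p \<in> level_kernel F KA I x} \<inter> (U \<inter> O')"
    using XO XU by blast
  ultimately show ?C using U oO xO g by (intro exI[of _ "U \<inter> O'"] exI[of _ "level_kernel F KA I x"] exI[of _ g] exI[of _ g']) auto
qed

end

section \<open>Condition (b)\<close>

lemma subspace_projection_exists:
  fixes W :: "'a::euclidean_space set"
  assumes "subspace W"
  shows "\<exists>q\<in>W. \<forall>s\<in>W. (v - q) \<bullet> s = 0"
  by (rule orthogonal_projection_onto_subspace[OF assms]) blast

lemma subspace_lim_approx:
  assumes lim: "subspace_lim Ls L" and v: "v \<in> L" "norm v \<le> 1" and sub: "\<And>m. subspace (Ls m)"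
  obtains vs where "vs \<longlonglongrightarrow> v" "\<And>m. vs m \<in> Ls m" "\<And>m. norm (vs m) \<le> 1"
proof -
  have "\<exists>u\<in>Ls m \<inter> cball 0 1. infdist v (Ls m \<inter> cball 0 1) = dist v u" for m
  proof -
    have "closed (Ls m \<inter> cball 0 1)" using sub closed_subspace by blast
    moreover have "0 \<in> Ls m \<inter> cball 0 1" using sub subspace_0 by auto
    ultimately show ?thesis using infdist_attains_inf[of "Ls m \<inter> cball 0 1" v] by blast
  qed
  then have "\<forall>m. \<exists>u. u \<in> Ls m \<inter> cball 0 1 \<and> infdist v (Ls m \<inter> cball 0 1) = dist v u" by blast
  from choice[OF this] obtain vs where vs: "\<And>m. vs m \<in> Ls m \<inter> cball 0 1"
    "\<And>m. infdist v (Ls m \<inter> cball 0 1) = dist v (vs m)" by blast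
  have "vs \<longlonglongrightarrow> v"
  proof (rule tendstoI)
    fix e :: real assume "e > 0"
    from lim[unfolded subspace_lim_def, rule_format, OF this]
    have "\<forall>\<^sub>F m in sequentially. \<forall>v\<in>L \<inter> cball 0 1. infdist v (Ls m \<inter> cball 0 1) < e"
      by (rule eventually_mono) blast
    then show "\<forall>\<^sub>F m in sequentially. dist (vs m) v < e"
    proof eventually_elim
      case (elim m)
      have "infdist v (Ls m \<inter> cball 0 1) < e" using elim v by simp
      then show ?case by (simp only: vs(2) dist_commute)
    qed
  qed
  then show thesis by (rule that) (use vs(1) in auto)
qed

lemma subspace_lim_closed:
  assumes lim: "subspace_lim Ls L" and L: "subspace L" and r: "strict_mono r"
    and ps: "ps \<longlonglongrightarrow> v" "\<And>m. ps m \<in> Ls (r m)" "\<And>m. norm (ps m) \<le> 1"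
  shows "v \<in> L"
proof -
  let ?B = "L \<inter> cball 0 1"
  have ne: "?B \<noteq> {}" using subspace_0[OF L] by auto
  have "infdist v ?B \<le> e" if e: "e > 0" for e
  proof -
    have "\<forall>\<^sub>F m in sequentially. \<forall>u\<in>Ls m \<inter> cball 0 1. infdist u ?B < e / 2"
      by (rule eventually_mono[OF lim[unfolded subspace_lim_def, rule_format, OF half_gt_zero[OF e]]]) blast
    from eventually_subseq[OF r this] tendstoD[OF ps(1) half_gt_zero[OF e]]
    have "\<forall>\<^sub>F m in sequentially. infdist v ?B \<le> e"
    proof eventually_elim
      case (elim m)
      have "infdist (ps m) ?B < e / 2" using elim(1) ps(2,3)[of m] by auto
      then show ?case using infdist_triangle[of v ?B "ps m"] elim(2) by (simp add: dist_commute)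
    qed
    then show ?thesis by simp
  qed
  from this[of "infdist v ?B / 2"] have "infdist v ?B = 0" using infdist_nonneg[of v ?B] by linarith
  moreover have "closed ?B" using closed_subspace[OF L] by blast
  ultimately have "v \<in> ?B" using in_closed_iff_infdist_zero[OF _ ne] by blast
  then show ?thesis by simp
qed

context admissible_family
begin

lemma feval_continuous:
  assumes "k \<in> {1..k0}" "(x \<longlongrightarrow> p) A" shows "((\<lambda>m. feval (F k) (fst (x m)) (snd (x m))) \<longlongrightarrow> feval (F k) (fst p) (snd p)) A"
  unfolding feval_eq_sum[OF fs[OF assms(1)]]
  by (intro tendsto_intros tendsto_zcoeff tendsto_monom assms(2))

text \<open>A vector of \<open>l\<close> is approximated by vectors \<open>vs\<close> of the secant
  lines, each split orthogonally into a tangent part \<open>p\<close> and a conormal part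
  \<open>q\<close>. It suffices that \<open>q\<close> tends to 0 along a subsequence: the tangent
  parts then have the same limit, and \<open>T\<close> contains it.\<close>

lemma whitney_b_strata:
  assumes \<delta>: "\<delta> \<le> \<epsilon>" "\<delta>\<^sup>2 \<le> R" "\<And>x. x \<in> ball 0 \<delta> \<Longrightarrow> regular_at x"
    and K: "K \<subseteq> {1..k0}" "L \<subseteq> {1..k0}"
    and y: "y \<in> toric_stratum k0 F J L \<inter> ball 0 \<delta>"
  shows "whitney_b (toric_stratum k0 F I K \<inter> ball 0 \<delta>) (toric_stratum k0 F J L \<inter> ball 0 \<delta>) y"
  unfolding whitney_b_def
proof (intro allI impI subsetI, elim conjE)
  fix xs ys l T v
  assume *: "\<forall>i. xs i \<in> toric_stratum k0 F I K \<inter> ball 0 \<delta> \<and> ys i \<in> toric_stratum k0 F J L \<inter> ball 0 \<delta> \<and> xs i \<noteq> ys i"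
    and xs: "xs \<longlonglongrightarrow> y" and ys: "ys \<longlonglongrightarrow> y" and sl: "subspace l" and sT: "subspace T"
    and liml: "subspace_lim (\<lambda>i. cline (xs i - ys i)) l"
    and limT: "subspace_lim (\<lambda>i. tangent_space (toric_stratum k0 F I K \<inter> ball 0 \<delta>) (xs i)) T"
    and vl: "v \<in> l"
  have xI: "\<And>m i. snd (xs m) $ i \<noteq> 0 \<longleftrightarrow> i \<in> I" and xf: "\<And>m k. k \<in> {1..k0} \<Longrightarrow> feval (F k) (fst (xs m)) (snd (xs m)) = 0 \<longleftrightarrow> k \<in> K"
    and yI: "\<And>m i. snd (ys m) $ i \<noteq> 0 \<longleftrightarrow> i \<in> J" and yf: "\<And>m k. k \<in> {1..k0} \<Longrightarrow> feval (F k) (fst (ys m)) (snd (ys m)) = 0 \<longleftrightarrow> k \<in> L"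
    and xb: "\<And>m. xs m \<in> ball 0 \<delta>" and ne: "\<And>m. xs m \<noteq> ys m"
    using * by (auto simp: toric_stratum_def split_beta)
  have pJ: "\<And>i. snd y $ i \<noteq> 0 \<longleftrightarrow> i \<in> J" and yL: "\<And>k. k \<in> {1..k0} \<Longrightarrow> feval (F k) (fst y) (snd y) = 0 \<longleftrightarrow> k \<in> L"
    and yb: "y \<in> ball 0 \<delta>"
    using y by (auto simp: toric_stratum_def split_beta)
  \<comment> \<open>A coordinate nonzero at \<open>y\<close> is nonzero nearby, and a function zero
    along \<open>xs\<close> is zero at \<open>y\<close>; the mere existence of \<open>xs\<close>
    thus forces \<open>J \<subseteq> I\<close> and \<open>K \<subseteq> L\<close>.\<close>
  have JI: "J \<subseteq> I"
  proof
    fix i assume "i \<in> J"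
    then have "snd y $ i \<noteq> 0" using pJ by blast
    moreover have "(\<lambda>m. snd (xs m) $ i) \<longlonglongrightarrow> snd y $ i" by (intro tendsto_intros xs)
    ultimately have "\<forall>\<^sub>F m in sequentially. snd (xs m) $ i \<noteq> 0" by (intro tendsto_imp_eventually_ne)
    from eventually_happens'[OF sequentially_bot this] show "i \<in> I" using xI by blast
  qed
  have KL: "K \<subseteq> L"
  proof
    fix k assume k: "k \<in> K"
    then have k0: "k \<in> {1..k0}" using K by blast
    have "(\<lambda>m. feval (F k) (fst (xs m)) (snd (xs m))) \<longlonglongrightarrow> feval (F k) (fst y) (snd y)" by (rule feval_continuous[OF k0 xs])
    then have "feval (F k) (fst y) (snd y) = 0" using xf[OF k0] k by (simp add: LIMSEQ_const_iff)
    then show "k \<in> L" using yL[OF k0] by blast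
  qed
  define KA where "KA = active K I"
  have KA: "KA \<subseteq> {1..k0}" "KA \<subseteq> K" and fKA: "finite KA" using K(1) finite_subset[of KA "{1..k0}"] by (auto simp: KA_def)
  let ?N = "\<lambda>m. level_kernel F KA I (xs m)"
  have tan: "tangent_space (toric_stratum k0 F I K \<inter> ball 0 \<delta>) (xs m) = ?N m" for m
  proof -
    have "xs m \<in> toric_stratum k0 F I K" using * by blast
    then show ?thesis
      using tangent_space_open_Int[OF open_ball xb, of _ m] stratum_local(1)[OF K(1) _ \<delta>(3)[OF xb]] by (simp add: KA_def)
  qed
  show "v \<in> T"
  proof (cases "v = 0")
    case True then show ?thesis using subspace_0[OF sT] by simp
  next
    case False
    define u where "u = (1 / norm v) *\<^sub>R v"
    have u: "u \<in> l" "norm u \<le> 1" using subspace_scale[OF sl vl] False by (simp_all add: u_def)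
    have "subspace (cline (xs m - ys m))" for m by (simp add: cline_def subspace_span)
    then obtain vs where vs: "vs \<longlonglongrightarrow> u" "\<And>m. vs m \<in> cline (xs m - ys m)" "\<And>m. norm (vs m) \<le> 1"
      using subspace_lim_approx[OF liml u] by blast
    have "\<forall>m. \<exists>c. vs m = cmul c (xs m - ys m)" using cline_cmul[OF vs(2)] by metis
    then obtain c where c: "\<And>m. vs m = cmul (c m) (xs m - ys m)" by metis
    let ?W = "\<lambda>m. {conormal F KA I (xs m) l d | l d. True}"
    have "\<exists>l d. \<forall>l' d'. (vs m - conormal F KA I (xs m) l d) \<bullet> conormal F KA I (xs m) l' d' = 0" for m
    proof -
      obtain q where q: "q \<in> ?W m" "\<And>s. s \<in> ?W m \<Longrightarrow> (vs m - q) \<bullet> s = 0"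
        using subspace_projection_exists[OF subspace_conormal[of F KA I "xs m"], of "vs m"] by (elim bexE) (simp only:)
      from q(1) obtain l d where "q = conormal F KA I (xs m) l d" by blast
      moreover have "(vs m - q) \<bullet> conormal F KA I (xs m) l' d' = 0" for l' d' by (rule q(2)) blast
      ultimately show ?thesis by blast
    qed
    then have "\<forall>m. \<exists>l d. \<forall>l' d'. (vs m - conormal F KA I (xs m) l d) \<bullet> conormal F KA I (xs m) l' d' = 0" ..
    from choice[OF this] obtain lam where "\<forall>m. \<exists>d. \<forall>l' d'. (vs m - conormal F KA I (xs m) (lam m) d) \<bullet> conormal F KA I (xs m) l' d' = 0" by blast
    from choice[OF this] obtain dd where orth: "\<And>m l' d'. (vs m - conormal F KA I (xs m) (lam m) (dd m)) \<bullet> conormal F KA I (xs m) l' d' = 0" by blast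
    define q where "q m = conormal F KA I (xs m) (lam m) (dd m)" for m
    define p where "p m = vs m - q m" for m
    have pN: "p m \<in> ?N m" for m
      by (rule orthogonal_conormal_in_kernel[OF fKA]) (simp add: p_def q_def orth)
    have pq: "p m \<bullet> q m = 0" for m using orth by (simp add: p_def q_def)
    have qv: "q m \<bullet> vs m = (norm (q m))\<^sup>2" for m
      using pq[of m] by (simp add: p_def inner_diff_left inner_diff_right power2_norm_eq_inner inner_commute)
    have "(norm (vs m))\<^sup>2 = (norm (p m))\<^sup>2 + (norm (q m))\<^sup>2" for m
      using pq[of m] by (simp add: p_def power2_norm_eq_inner inner_diff_left inner_diff_right inner_commute)
    then have "(norm (p m))\<^sup>2 \<le> (norm (vs m))\<^sup>2" "(norm (q m))\<^sup>2 \<le> (norm (vs m))\<^sup>2" for m by simp_all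
    then have "norm (p m) \<le> norm (vs m)" "norm (q m) \<le> norm (vs m)" for m by (meson norm_ge_zero power2_le_imp_le)+
    then have p1: "norm (p m) \<le> 1" and q1: "norm (q m) \<le> 1" for m using vs(3) order_trans by blast+
    have dI: "snd (xs m - ys m) $ i = 0" if "i \<notin> I" for m i using that xI[of m i] yI[of m i] JI by auto
    have "\<exists>r. strict_mono r \<and> (\<lambda>m. (\<Sum>k\<in>KA. cnj (lam (r m) k) * fderiv (F k) (xs (r m)) (xs (r m) - ys (r m))) / of_real (norm (xs (r m) - ys (r m)))) \<longlonglongrightarrow> 0"
    proof (rule conormal_limit[OF xs ys ne _ _ xI pJ])
      have "norm y < \<delta>" using yb by simp
      moreover have "cmod (fst y) \<le> norm y" using norm_fst_le[of "fst y" "snd y"] by simp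
      ultimately show "cmod (fst y) < \<epsilon>" using \<delta>(1) by linarith
      have "(\<Sum>i\<in>J. (cmod (snd y $ i))\<^sup>2) \<le> (\<Sum>i\<in>UNIV. (cmod (snd y $ i))\<^sup>2)"
        by (rule sum_mono2) auto
      also have "\<dots> = (norm (snd y))\<^sup>2" by (simp add: norm_vec_def L2_set_def sum_nonneg)
      also have "\<dots> < \<delta>\<^sup>2"
      proof (rule power_strict_mono)
        show "norm (snd y) < \<delta>" using norm_snd_le[of "snd y" "fst y"] \<open>norm y < \<delta>\<close> by simp
      qed auto
      finally show "(\<Sum>i\<in>J. (cmod (snd y $ i))\<^sup>2) < R" using \<delta>(2) by linarith
      show "snd (ys m) $ i = 0" if "i \<notin> J" for m i using yI that by blast
      show "J \<subseteq> I" "KA \<subseteq> {1..k0}" by fact+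
      show "meets (F k) I" if "k \<in> KA" for k using that by (simp add: KA_def)
      show "feval (F k) (fst (xs m)) (snd (xs m)) = 0" if "k \<in> KA" for k m using xf KA that by blast
      show "feval (F k) (fst (ys m)) (snd (ys m)) = 0" if "k \<in> KA" for k m using yf KA KL that by blast
      show "\<forall>k\<in>{k\<in>KA. meets (F k) J}. b k = 0"
        if "\<forall>i\<in>J. (\<Sum>k\<in>{k\<in>KA. meets (F k) J}. b k * fderiv_z (F k) (fst y) (snd y) i) = 0" for b
      proof -
        have "\<forall>k\<in>{k\<in>KA. meets (F k) J}. meets (F k) J \<and> feval (F k) (fst y) (snd y) = 0"
          using yL KA KL by blast
        then show ?thesis
          using \<delta>(3)[OF yb, unfolded regular_at_def, rule_format, of "{k\<in>KA. meets (F k) J}" J b] KA pJ that by blast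
      qed
      show "cmod (\<Sum>k\<in>KA. cnj (lam m k) * fderiv_z (F k) (fst (xs m)) (snd (xs m)) i) \<le> 1" if "i \<in> I" for m i
      proof -
        have "snd (q m) $ i = cnj (\<Sum>k\<in>KA. cnj (lam m k) * fderiv_z (F k) (fst (xs m)) (snd (xs m)) i)"
          using that by (simp add: q_def conormal_def)
        then have "cmod (\<Sum>k\<in>KA. cnj (lam m k) * fderiv_z (F k) (fst (xs m)) (snd (xs m)) i) = cmod (snd (q m) $ i)"
          by (simp only: complex_mod_cnj)
        also have "\<dots> \<le> norm (q m)"
          using order_trans[OF Finite_Cartesian_Product.norm_nth_le[of "snd (q m)" i] norm_snd_le[of "snd (q m)" "fst (q m)"]] by simp
        finally show ?thesis using q1[of m] by linarith
      qed
    qed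
    then obtain r where r: "strict_mono r" and lim0: "(\<lambda>m. (\<Sum>k\<in>KA. cnj (lam (r m) k) * fderiv (F k) (xs (r m)) (xs (r m) - ys (r m))) / of_real (norm (xs (r m) - ys (r m)))) \<longlonglongrightarrow> 0"
      by blast
    let ?S = "\<lambda>m. \<Sum>k\<in>KA. cnj (lam m k) * fderiv (F k) (xs m) (xs m - ys m)"
    \<comment> \<open>By orthogonality the squared norm of \<open>q\<close> is its pairing with
      \<open>vs\<close>, a complex multiple of the secant of norm at most 1. This leaves the
      normalised pairing that \<open>conormal_limit\<close> sends to 0.\<close>
    have qle: "(norm (q m))\<^sup>2 \<le> cmod (?S m / of_real (norm (xs m - ys m)))" for m
    proof -
      have "q m \<bullet> vs m = Re (\<Sum>k\<in>KA. cnj (lam m k) * fderiv (F k) (xs m) (vs m))"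
        unfolding q_def by (rule conormal_inner) (use dI in \<open>simp add: c cmul_def\<close>)
      then have "(norm (q m))\<^sup>2 = Re (\<Sum>k\<in>KA. cnj (lam m k) * fderiv (F k) (xs m) (vs m))"
        by (simp only: qv)
      also have "(\<Sum>k\<in>KA. cnj (lam m k) * fderiv (F k) (xs m) (vs m)) = c m * ?S m"
        by (simp add: c fderiv_cmul sum_distrib_left mult_ac)
      also have "Re (c m * ?S m) \<le> cmod (c m) * cmod (?S m)"
        using complex_Re_le_cmod[of "c m * ?S m"] by (simp add: norm_mult)
      also have "\<dots> = (cmod (c m) * norm (xs m - ys m)) * (cmod (?S m) / norm (xs m - ys m))"
        using ne[of m] by simp
      also have "\<dots> \<le> 1 * (cmod (?S m) / norm (xs m - ys m))"
        using vs(3)[of m] by (intro mult_right_mono) (simp_all add: c norm_cmul)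
      finally show ?thesis by (simp add: norm_divide)
    qed
    have "(\<lambda>m. (norm (q (r m)))\<^sup>2) \<longlonglongrightarrow> 0"
      by (rule Lim_null_comparison[OF always_eventually tendsto_norm_zero[OF lim0]]) (use qle in auto)
    then have "(\<lambda>m. norm (q (r m))) \<longlonglongrightarrow> 0" using tendsto_real_sqrt[of "\<lambda>m. (norm (q (r m)))\<^sup>2" 0] by simp
    then have "(\<lambda>m. q (r m)) \<longlonglongrightarrow> 0" by (rule tendsto_norm_zero_cancel)
    moreover have "(\<lambda>m. vs (r m)) \<longlonglongrightarrow> u" using LIMSEQ_subseq_LIMSEQ[OF vs(1) r] by (simp add: o_def)
    ultimately have "(\<lambda>m. p (r m)) \<longlonglongrightarrow> u" unfolding p_def using tendsto_diff by fastforce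
    then have "u \<in> T"
      by (rule subspace_lim_closed[OF limT[unfolded tan] sT r]) (use pN p1 in auto)
    then have "norm v *\<^sub>R u \<in> T" by (rule subspace_scale[OF sT])
    then show ?thesis using False by (simp add: u_def)
  qed
qed

lemma complex_submanifold_stratum:
  assumes K: "K \<subseteq> {1..k0}" and reg: "\<And>x. x \<in> ball 0 \<delta> \<Longrightarrow> regular_at x"
  shows "complex_submanifold (toric_stratum k0 F I K \<inter> ball 0 \<delta>)"
  unfolding complex_submanifold_def C1_submanifold_def
proof (intro conjI ballI)
  let ?X = "toric_stratum k0 F I K"
  fix x assume x: "x \<in> ?X \<inter> ball 0 \<delta>"
  then have xX: "x \<in> ?X" and xb: "x \<in> ball 0 \<delta>" by auto
  obtain U L g g' where U: "open U" "x \<in> U" "subspace L" "\<forall>p. (g has_derivative blinfun_apply (g' p)) (at p)"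
    "continuous_on UNIV g'" "\<forall>p. \<forall>l\<in>L. g p \<bullet> l = 0" "?X \<inter> U = {p + g p | p. p \<in> L} \<inter> U"
    using stratum_local(2)[OF K xX reg[OF xb]] by blast
  have "?X \<inter> ball 0 \<delta> \<inter> (U \<inter> ball 0 \<delta>) = {p + g p | p. p \<in> L} \<inter> (U \<inter> ball 0 \<delta>)" using U(7) by blast
  moreover have "open (U \<inter> ball 0 \<delta>)" "x \<in> U \<inter> ball 0 \<delta>" using U xb by auto
  ultimately show "\<exists>U L g g'. open U \<and> x \<in> U \<and> subspace L \<and>
       (\<forall>p. (g has_derivative blinfun_apply (g' p)) (at p)) \<and> continuous_on UNIV g' \<and>
       (\<forall>p. \<forall>l\<in>L. g p \<bullet> l = 0) \<and> ?X \<inter> ball 0 \<delta> \<inter> U = {p + g p | p. p \<in> L} \<inter> U"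
    using U(3-6) by blast
  \<comment> \<open>The equations of the tangent space are complex linear, hence stable under
    multiplication by i.\<close>
  show "cJ ` tangent_space (?X \<inter> ball 0 \<delta>) x \<subseteq> tangent_space (?X \<inter> ball 0 \<delta>) x"
    unfolding tangent_space_open_Int[OF open_ball xb] stratum_local(1)[OF K xX reg[OF xb]]
    by (auto simp: level_kernel_def cJ_cmul fderiv_cmul) (auto simp: cmul_def)
qed

end

section \<open>Assembly of the stratification in a small ball\<close>

theorem theorem3p2:
  fixes k0 :: nat and F :: "nat \<Rightarrow> nat \<times> (nat^'n) \<Rightarrow> complex"
  assumes "k0 \<ge> 1"
    and "\<forall>k\<in>{1..k0}. finite_support (F k)"
    and "\<forall>k\<in>{1..k0}. \<not> (\<exists>c. \<forall>t z. feval (F k) t z = c)"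
    and "\<forall>k\<in>{1..k0}. \<forall>t. feval (F k) t 0 = 0"
    and "newton_admissible k0 F"
  shows "\<exists>U. open U \<and> (0::'n amb) \<in> U \<and>
           whitney_b_stratification (V_f k0 F \<inter> U)
              {S \<inter> U | S. S \<in> toric_strat_Vf k0 F \<and> S \<inter> U \<noteq> {}} \<and>
           {(t, 0) | t. True} \<inter> U \<in> {S \<inter> U | S. S \<in> toric_strat_Vf k0 F \<and> S \<inter> U \<noteq> {}}"
proof -
  obtain \<epsilon> R where "admissible_family k0 F \<epsilon> R"
    using newton_admissible_imp_family[OF assms(2-5)] by blast
  then interpret admissible_family k0 F \<epsilon> R .
  have "\<forall>\<^sub>F x in nhds (0::'n amb). regular_at x" unfolding regular_at_def by (rule eventually_regular)
  then obtain e where e: "e > 0" "\<And>x. dist x 0 < e \<Longrightarrow> regular_at x" unfolding eventually_nhds_metric by blast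
  \<comment> \<open>The three radii secure regularity of the points, the parameter range of the
    hypotheses, and the bound \<open>R\<close> on the sum of squared moduli of coordinates in
    tameness.\<close>
  define \<delta> where "\<delta> = min e (min \<epsilon> (sqrt R))"
  have \<delta>0: "\<delta> > 0" and \<delta>\<epsilon>: "\<delta> \<le> \<epsilon>" using e \<epsilon> R by (auto simp: \<delta>_def)
  have \<delta>R: "\<delta>\<^sup>2 \<le> R"
  proof -
    have "\<delta>\<^sup>2 \<le> (sqrt R)\<^sup>2" using \<delta>0 by (intro power_mono) (auto simp: \<delta>_def)
    then show ?thesis using R by simp
  qed
  have reg: "regular_at x" if "x \<in> ball 0 \<delta>" for x using e(2)[of x] that by (simp add: \<delta>_def dist_commute)
  define U where "U = ball (0::'n amb) \<delta>"
  let ?\<S> = "{S \<inter> U | S. S \<in> toric_strat_Vf k0 F \<and> S \<inter> U \<noteq> {}}"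
  have stratE: thesis if "X \<in> ?\<S>" "\<And>I K. X = toric_stratum k0 F I K \<inter> U \<Longrightarrow> K \<subseteq> {1..k0} \<Longrightarrow> K \<noteq> {} \<Longrightarrow> X \<noteq> {} \<Longrightarrow> thesis" for X thesis
    using that unfolding toric_strat_Vf_def by blast
  have uniq: "I = I' \<and> K = K'" if "x \<in> toric_stratum k0 F I K" "x \<in> toric_stratum k0 F I' K'" "K \<subseteq> {1..k0}" "K' \<subseteq> {1..k0}" for x I I' K K'
  proof -
    have "I = {i. snd x $ i \<noteq> 0}" "I' = {i. snd x $ i \<noteq> 0}"
      using that(1,2) by (auto simp: toric_stratum_def split_beta)
    moreover have "K = {k\<in>{1..k0}. feval (F k) (fst x) (snd x) = 0}" "K' = {k\<in>{1..k0}. feval (F k) (fst x) (snd x) = 0}"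
      using that by (auto simp: toric_stratum_def split_beta)
    ultimately show ?thesis by simp
  qed
  have "whitney_b_stratification (V_f k0 F \<inter> U) ?\<S>"
    unfolding whitney_b_stratification_def
  proof (intro conjI ballI impI)
    have "?\<S> \<subseteq> (\<lambda>(I,K). toric_stratum k0 F I K \<inter> U) ` (UNIV \<times> Pow {1..k0})"
      unfolding toric_strat_Vf_def by auto
    then show "finite ?\<S>" by (rule finite_subset) simp
    show "\<Union>?\<S> = V_f k0 F \<inter> U"
    proof (intro equalityI subsetI)
      fix x assume "x \<in> \<Union>?\<S>"
      then obtain X where X: "X \<in> ?\<S>" "x \<in> X" by blast
      from X(1) show "x \<in> V_f k0 F \<inter> U"
      proof (rule stratE)
        fix I K assume "X = toric_stratum k0 F I K \<inter> U" "K \<subseteq> {1..k0}" "K \<noteq> {}"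
        then show ?thesis using X(2) by (auto simp: toric_stratum_def V_f_def split_beta)
      qed
    next
      fix x assume x: "x \<in> V_f k0 F \<inter> U"
      define K where "K = {k\<in>{1..k0}. feval (F k) (fst x) (snd x) = 0}"
      define I where "I = {i. snd x $ i \<noteq> 0}"
      have xS: "x \<in> toric_stratum k0 F I K" by (auto simp: toric_stratum_def split_beta K_def I_def)
      moreover have "K \<noteq> {}" using x by (auto simp: V_f_def K_def split_beta)
      moreover have "K \<subseteq> {1..k0}" by (auto simp: K_def)
      ultimately have "toric_stratum k0 F I K \<in> toric_strat_Vf k0 F" unfolding toric_strat_Vf_def by blast
      then show "x \<in> \<Union>?\<S>" using xS x by blast
    qed
    show "disjoint ?\<S>"
      unfolding disjoint_def
    proof (intro ballI impI)
      fix X Y assume X: "X \<in> ?\<S>" and Y: "Y \<in> ?\<S>" and ne: "X \<noteq> Y"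
      from X show "X \<inter> Y = {}"
      proof (rule stratE)
        fix I K assume 1: "X = toric_stratum k0 F I K \<inter> U" "K \<subseteq> {1..k0}"
        from Y show ?thesis
        proof (rule stratE)
          fix I' K' assume 2: "Y = toric_stratum k0 F I' K' \<inter> U" "K' \<subseteq> {1..k0}"
          show ?thesis
          proof (rule ccontr)
            assume "X \<inter> Y \<noteq> {}"
            then obtain x where "x \<in> X" "x \<in> Y" by blast
            then have "I = I' \<and> K = K'" using uniq[of x I K I' K'] 1 2 by blast
            then show False using 1 2 ne by blast
          qed
        qed
      qed
    qed
  next
    fix X assume X: "X \<in> ?\<S>"
    then show "X \<noteq> {}" by blast
    from X show "complex_submanifold X"
      by (rule stratE) (use complex_submanifold_stratum reg U_def in blast)
  next
    fix X Y y assume X: "X \<in> ?\<S>" and Y: "Y \<in> ?\<S>" and y: "y \<in> Y"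
    from X show "whitney_b X Y y"
    proof (rule stratE)
      fix I K assume 1: "X = toric_stratum k0 F I K \<inter> U" "K \<subseteq> {1..k0}"
      from Y show ?thesis
      proof (rule stratE)
        fix J L assume 2: "Y = toric_stratum k0 F J L \<inter> U" "L \<subseteq> {1..k0}"
        show ?thesis
          using whitney_b_strata[OF \<delta>\<epsilon> \<delta>R reg 1(2) 2(2), of y J I] y unfolding 1(1) 2(1) U_def by blast
      qed
    qed
  qed
  moreover have "{(t, 0) | t. True} \<inter> U \<in> ?\<S>"
  proof -
    \<comment> \<open>All \<open>F k\<close> vanish on the axis, so the axis is the stratum with no
      nonzero coordinate and every function zero.\<close>
    have ax: "{(t, 0) | t. True} = toric_stratum k0 F {} {1..k0}"
      using assms(4) by (auto simp: toric_stratum_def vec_eq_iff split_beta)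
    have "(0::'n amb) \<in> {(t, 0) | t. True}" by (auto simp: zero_prod_def)
    moreover have "0 \<in> U" using \<delta>0 by (simp add: U_def)
    ultimately have ne: "{(t, 0) | t. True} \<inter> U \<noteq> {}" by blast
    have "toric_stratum k0 F {} {1..k0} \<in> toric_strat_Vf k0 F"
      unfolding toric_strat_Vf_def
    proof (intro CollectI exI conjI)
      show "{1..k0} \<noteq> {}" using assms(1) by simp
      show "toric_stratum k0 F {} {1..k0} \<noteq> {}" using ne unfolding ax by blast
    qed auto
    then show ?thesis using ne unfolding ax by blast
  qed
  moreover have "open U" "0 \<in> U" using \<delta>0 by (auto simp: U_def)
  ultimately show ?thesis by blast
qed

end
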